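(* Let $K$ be an algebraically closed field of characteristic $2$ and let $k\geq 2$ be an integer. There is no stable equivalence of Morita type between the algebras $D(1\mathcal{A})_2^k(0)$ and $D(1\mathcal{A})_2^k(1)$.
   Context: For an integer $k\geq 2$ and $d\in\{0,1\}$, $D(1\mathcal{A})_2^k(d)=K\langle x,y\rangle/I$, where $I$ is the two-sided ideal of the free algebra $K\langle x,y\rangle$ generated by $x^2-(xy)^k$, $y^2-d(xy)^k$, $(xy)^k-(yx)^k$, $(xy)^kx$ and $(yx)^ky$. Two finite-dimensional $K$-algebras $A$ and $B$ are stably equivalent of Morita type if there are bimodules ${}_AM_B$ and ${}_BN_A$, each finitely generated projective as a left and as a right module, such that $M\otimes_B N\cong A\oplus P$ as $A$-$A$-bimodules and $N\otimes_A M\cong B\oplus Q$ as $B$-$B$-bimodules with $P$ and $Q$ projective bimodules. *)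

theory Defs
  imports "HOL-Algebra.Algebra" "HOL-Algebra.Algebraic_Closure_Type" "HOL-Library.Poly_Mapping"
begin

section \<open>Algebras and bimodules over a field\<close>

text \<open>
  The ground field is a type \<open>'k :: field\<close>. A \<open>'k\<close>-algebra is an associative unital,
  not necessarily commutative ring with a compatible scalar multiplication \<open>\<odot>\<close>; it is carried by
  the record \<^type>\<open>module\<close> of HOL-Algebra. (The locale \<^locale>\<open>algebra\<close> of HOL-Algebra is restricted
  to commutative algebras.)
\<close>

locale k_algebra = module "ring_of_type_algebra :: 'k ring" A + ring A
  for A :: "('k::field, 'a) module" (structure) +
  assumes smult_mult_left:
      "\<lbrakk>x \<in> carrier A; y \<in> carrier A\<rbrakk> \<Longrightarrow> (c \<odot> x) \<otimes> y = c \<odot> (x \<otimes> y)"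
    and smult_mult_right:
      "\<lbrakk>x \<in> carrier A; y \<in> carrier A\<rbrakk> \<Longrightarrow> x \<otimes> (c \<odot> y) = c \<odot> (x \<otimes> y)"

definition ground_field :: "('k::field, 'k) module" where
  "ground_field = ring.extend ring_of_type_algebra (module.fields (*))"

text \<open>
  In a bimodule, \<open>\<odot>\<close> is the left and \<open>\<triangleleft>\<close> the right action. As usual in HOL-Algebra, the fields
  \<open>mult\<close> and \<open>one\<close> of the record are unused for modules.
\<close>

record ('a, 'b, 'm) bimodule = "('a, 'm) module" +
  ract :: "'m \<Rightarrow> 'b \<Rightarrow> 'm" (infixl \<open>\<triangleleft>\<index>\<close> 70)

locale bimodule = A: k_algebra A + B: k_algebra B + M: abelian_group M
  for A :: "('k::field, 'a) module" and B :: "('k::field, 'b) module"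
    and M :: "('a, 'b, 'm) bimodule" +
  assumes lact_closed: "\<lbrakk>a \<in> carrier A; m \<in> carrier M\<rbrakk> \<Longrightarrow> a \<odot>\<^bsub>M\<^esub> m \<in> carrier M"
    and lact_add_left: "\<lbrakk>a \<in> carrier A; a' \<in> carrier A; m \<in> carrier M\<rbrakk>
      \<Longrightarrow> (a \<oplus>\<^bsub>A\<^esub> a') \<odot>\<^bsub>M\<^esub> m = a \<odot>\<^bsub>M\<^esub> m \<oplus>\<^bsub>M\<^esub> a' \<odot>\<^bsub>M\<^esub> m"
    and lact_add_right: "\<lbrakk>a \<in> carrier A; m \<in> carrier M; m' \<in> carrier M\<rbrakk>
      \<Longrightarrow> a \<odot>\<^bsub>M\<^esub> (m \<oplus>\<^bsub>M\<^esub> m') = a \<odot>\<^bsub>M\<^esub> m \<oplus>\<^bsub>M\<^esub> a \<odot>\<^bsub>M\<^esub> m'"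
    and lact_assoc: "\<lbrakk>a \<in> carrier A; a' \<in> carrier A; m \<in> carrier M\<rbrakk>
      \<Longrightarrow> (a \<otimes>\<^bsub>A\<^esub> a') \<odot>\<^bsub>M\<^esub> m = a \<odot>\<^bsub>M\<^esub> (a' \<odot>\<^bsub>M\<^esub> m)"
    and lact_one: "m \<in> carrier M \<Longrightarrow> \<one>\<^bsub>A\<^esub> \<odot>\<^bsub>M\<^esub> m = m"
    and ract_closed: "\<lbrakk>m \<in> carrier M; b \<in> carrier B\<rbrakk> \<Longrightarrow> m \<triangleleft>\<^bsub>M\<^esub> b \<in> carrier M"
    and ract_add_right: "\<lbrakk>m \<in> carrier M; b \<in> carrier B; b' \<in> carrier B\<rbrakk>
      \<Longrightarrow> m \<triangleleft>\<^bsub>M\<^esub> (b \<oplus>\<^bsub>B\<^esub> b') = m \<triangleleft>\<^bsub>M\<^esub> b \<oplus>\<^bsub>M\<^esub> m \<triangleleft>\<^bsub>M\<^esub> b'"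
    and ract_add_left: "\<lbrakk>m \<in> carrier M; m' \<in> carrier M; b \<in> carrier B\<rbrakk>
      \<Longrightarrow> (m \<oplus>\<^bsub>M\<^esub> m') \<triangleleft>\<^bsub>M\<^esub> b = m \<triangleleft>\<^bsub>M\<^esub> b \<oplus>\<^bsub>M\<^esub> m' \<triangleleft>\<^bsub>M\<^esub> b"
    and ract_assoc: "\<lbrakk>m \<in> carrier M; b \<in> carrier B; b' \<in> carrier B\<rbrakk>
      \<Longrightarrow> m \<triangleleft>\<^bsub>M\<^esub> (b \<otimes>\<^bsub>B\<^esub> b') = (m \<triangleleft>\<^bsub>M\<^esub> b) \<triangleleft>\<^bsub>M\<^esub> b'"
    and ract_one: "m \<in> carrier M \<Longrightarrow> m \<triangleleft>\<^bsub>M\<^esub> \<one>\<^bsub>B\<^esub> = m"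
    and act_commute: "\<lbrakk>a \<in> carrier A; m \<in> carrier M; b \<in> carrier B\<rbrakk>
      \<Longrightarrow> (a \<odot>\<^bsub>M\<^esub> m) \<triangleleft>\<^bsub>M\<^esub> b = a \<odot>\<^bsub>M\<^esub> (m \<triangleleft>\<^bsub>M\<^esub> b)"
    and scalars_central: "m \<in> carrier M
      \<Longrightarrow> (c \<odot>\<^bsub>A\<^esub> \<one>\<^bsub>A\<^esub>) \<odot>\<^bsub>M\<^esub> m = m \<triangleleft>\<^bsub>M\<^esub> (c \<odot>\<^bsub>B\<^esub> \<one>\<^bsub>B\<^esub>)"

definition bimodule_iso ::
  "('k, 'a) module \<Rightarrow> ('k, 'b) module \<Rightarrow> ('a, 'b, 'm) bimodule \<Rightarrow> ('a, 'b, 'n) bimodule \<Rightarrow> bool" where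
  "bimodule_iso A B M N \<longleftrightarrow> (\<exists>f. bij_betw f (carrier M) (carrier N) \<and>
     (\<forall>m\<in>carrier M. \<forall>m'\<in>carrier M. f (m \<oplus>\<^bsub>M\<^esub> m') = f m \<oplus>\<^bsub>N\<^esub> f m') \<and>
     (\<forall>a\<in>carrier A. \<forall>m\<in>carrier M. f (a \<odot>\<^bsub>M\<^esub> m) = a \<odot>\<^bsub>N\<^esub> f m) \<and>
     (\<forall>m\<in>carrier M. \<forall>b\<in>carrier B. f (m \<triangleleft>\<^bsub>M\<^esub> b) = f m \<triangleleft>\<^bsub>N\<^esub> b))"

definition regular_bimodule :: "('k, 'a) module \<Rightarrow> ('a, 'a, 'a) bimodule" where
  "regular_bimodule A = \<lparr>carrier = carrier A, monoid.mult = monoid.mult A, one = one A, ring.zero = ring.zero A, add = add A,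
     module.smult = monoid.mult A, ract = monoid.mult A\<rparr>"

text \<open>
  One-sided modules are bimodules with the ground field on the other side: a left \<open>A\<close>-module is
  an \<open>A\<close>-\<open>K\<close>-bimodule and a right \<open>B\<close>-module is a \<open>K\<close>-\<open>B\<close>-bimodule.
\<close>

definition left_part :: "('k, 'a) module \<Rightarrow> ('a, 'b, 'm) bimodule \<Rightarrow> ('a, 'k, 'm) bimodule" where
  "left_part A M = \<lparr>carrier = carrier M, monoid.mult = monoid.mult M, one = one M, ring.zero = ring.zero M, add = add M,
     module.smult = module.smult M, ract = (\<lambda>m c. (c \<odot>\<^bsub>A\<^esub> \<one>\<^bsub>A\<^esub>) \<odot>\<^bsub>M\<^esub> m)\<rparr>"

definition right_part :: "('k, 'b) module \<Rightarrow> ('a, 'b, 'm) bimodule \<Rightarrow> ('k, 'b, 'm) bimodule" where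
  "right_part B M = \<lparr>carrier = carrier M, monoid.mult = monoid.mult M, one = one M, ring.zero = ring.zero M, add = add M,
     module.smult = (\<lambda>c m. m \<triangleleft>\<^bsub>M\<^esub> (c \<odot>\<^bsub>B\<^esub> \<one>\<^bsub>B\<^esub>)), ract = ract M\<rparr>"


section \<open>Direct sums and tensor products\<close>

definition direct_sum ::
  "('a, 'b, 'm) bimodule \<Rightarrow> ('a, 'b, 'n) bimodule \<Rightarrow> ('a, 'b, 'm \<times> 'n) bimodule" where
  "direct_sum M N = \<lparr>carrier = carrier M \<times> carrier N,
     monoid.mult = (\<lambda>_ _. undefined), one = undefined,
     ring.zero = (\<zero>\<^bsub>M\<^esub>, \<zero>\<^bsub>N\<^esub>),
     add = (\<lambda>(m, n) (m', n'). (m \<oplus>\<^bsub>M\<^esub> m', n \<oplus>\<^bsub>N\<^esub> n')),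
     module.smult = (\<lambda>a (m, n). (a \<odot>\<^bsub>M\<^esub> m, a \<odot>\<^bsub>N\<^esub> n)),
     ract = (\<lambda>(m, n) b. (m \<triangleleft>\<^bsub>M\<^esub> b, n \<triangleleft>\<^bsub>N\<^esub> b))\<rparr>"

text \<open>The direct sum of copies of \<open>U\<close> indexed by \<open>I\<close>: finitely supported families.\<close>

definition copies :: "'i set \<Rightarrow> ('a, 'b, 'm) bimodule \<Rightarrow> ('a, 'b, 'i \<Rightarrow> 'm) bimodule" where
  "copies I U = \<lparr>carrier = {f. (\<forall>i. f i \<in> carrier U) \<and> (\<forall>i. i \<notin> I \<longrightarrow> f i = \<zero>\<^bsub>U\<^esub>)
       \<and> finite {i. f i \<noteq> \<zero>\<^bsub>U\<^esub>}},
     monoid.mult = (\<lambda>_ _. undefined), one = undefined,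
     ring.zero = (\<lambda>_. \<zero>\<^bsub>U\<^esub>),
     add = (\<lambda>f g i. f i \<oplus>\<^bsub>U\<^esub> g i),
     module.smult = (\<lambda>a f i. a \<odot>\<^bsub>U\<^esub> f i),
     ract = (\<lambda>f b i. f i \<triangleleft>\<^bsub>U\<^esub> b)\<rparr>"

text \<open>
  The tensor product \<open>M \<otimes>\<^sub>B N\<close> is the free abelian group on \<open>M \<times> N\<close> modulo the subgroup generated
  by the biadditivity and \<open>B\<close>-balancing relations; \<open>A\<close> acts on the left through \<open>M\<close> and \<open>C\<close> on the
  right through \<open>N\<close>. An action maps a coset \<open>T\<close> to the coset containing the image of \<open>T\<close>
  under the corresponding endomorphism of the free abelian group.
\<close>

definition tensor_relations ::
  "('k, 'b) module \<Rightarrow> ('a, 'b, 'm) bimodule \<Rightarrow> ('b, 'c, 'n) bimodule \<Rightarrow> ('m \<times> 'n \<Rightarrow>\<^sub>0 int) set" where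
  "tensor_relations B M N =
     {frag_of (m \<oplus>\<^bsub>M\<^esub> m', n) - frag_of (m, n) - frag_of (m', n) | m m' n.
        m \<in> carrier M \<and> m' \<in> carrier M \<and> n \<in> carrier N} \<union>
     {frag_of (m, n \<oplus>\<^bsub>N\<^esub> n') - frag_of (m, n) - frag_of (m, n') | m n n'.
        m \<in> carrier M \<and> n \<in> carrier N \<and> n' \<in> carrier N} \<union>
     {frag_of (m \<triangleleft>\<^bsub>M\<^esub> b, n) - frag_of (m, b \<odot>\<^bsub>N\<^esub> n) | m b n.
        m \<in> carrier M \<and> b \<in> carrier B \<and> n \<in> carrier N}"

definition tensor ::
  "('k, 'b) module \<Rightarrow> ('a, 'b, 'm) bimodule \<Rightarrow> ('b, 'c, 'n) bimodule
    \<Rightarrow> ('a, 'c, ('m \<times> 'n \<Rightarrow>\<^sub>0 int) set) bimodule" where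
  "tensor B M N =
    (let F = free_Abelian_group (carrier M \<times> carrier N);
         R = generate F (tensor_relations B M N)
     in \<lparr>carrier = carrier (F Mod R),
         monoid.mult = (\<lambda>_ _. undefined), one = undefined,
         ring.zero = one (F Mod R),
         add = monoid.mult (F Mod R),
         module.smult = (\<lambda>a T. R <#>\<^bsub>F\<^esub> (frag_extend (\<lambda>(m, n). frag_of (a \<odot>\<^bsub>M\<^esub> m, n)) ` T)),
         ract = (\<lambda>T c. R <#>\<^bsub>F\<^esub> (frag_extend (\<lambda>(m, n). frag_of (m, n \<triangleleft>\<^bsub>N\<^esub> c)) ` T))\<rparr>)"


section \<open>Projective modules\<close>

text \<open>
  \<open>P\<close> is a direct summand of a direct sum of copies of \<open>U\<close>. When \<open>U\<close> is the free module on
  one generator, the types of the index set \<open>I\<close> and of the complement \<open>Q\<close> are no restriction: \<open>P\<close> is a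
  quotient of the free module on the set \<open>carrier P\<close>, and a complement can be taken inside that free
  module.
\<close>

definition summand_of_copies ::
  "('k::field, 'a) module \<Rightarrow> ('k, 'b) module \<Rightarrow> ('a, 'b, 'u) bimodule \<Rightarrow> ('a, 'b, 'm) bimodule
    \<Rightarrow> bool" where
  "summand_of_copies A B U P \<longleftrightarrow>
     (\<exists>(I :: 'm set) (Q :: ('a, 'b, 'm \<Rightarrow> 'u) bimodule).
        bimodule A B Q \<and> bimodule_iso A B (direct_sum P Q) (copies I U))"

definition projective_left :: "('k::field, 'a) module \<Rightarrow> ('a, 'b, 'm) bimodule \<Rightarrow> bool" where
  "projective_left A M \<longleftrightarrow>
     summand_of_copies A ground_field (left_part A (regular_bimodule A)) (left_part A M)"

definition projective_right :: "('k::field, 'b) module \<Rightarrow> ('a, 'b, 'm) bimodule \<Rightarrow> bool" where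
  "projective_right B M \<longleftrightarrow>
     summand_of_copies ground_field B (right_part B (regular_bimodule B)) (right_part B M)"

text \<open>The free \<open>A\<close>-\<open>B\<close>-bimodule on one generator is \<open>A \<otimes>\<^sub>K B\<close>.\<close>

definition projective_bimodule ::
  "('k::field, 'a) module \<Rightarrow> ('k, 'b) module \<Rightarrow> ('a, 'b, 'm) bimodule \<Rightarrow> bool" where
  "projective_bimodule A B M \<longleftrightarrow>
     summand_of_copies A B
       (tensor ground_field (left_part A (regular_bimodule A)) (right_part B (regular_bimodule B))) M"

definition subbimodule ::
  "('k, 'a) module \<Rightarrow> ('k, 'b) module \<Rightarrow> 'm set \<Rightarrow> ('a, 'b, 'm) bimodule \<Rightarrow> bool" where
  "subbimodule A B W M \<longleftrightarrow> additive_subgroup W M \<and>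
     (\<forall>a\<in>carrier A. \<forall>w\<in>W. a \<odot>\<^bsub>M\<^esub> w \<in> W) \<and> (\<forall>w\<in>W. \<forall>b\<in>carrier B. w \<triangleleft>\<^bsub>M\<^esub> b \<in> W)"

definition finitely_generated ::
  "('k, 'a) module \<Rightarrow> ('k, 'b) module \<Rightarrow> ('a, 'b, 'm) bimodule \<Rightarrow> bool" where
  "finitely_generated A B M \<longleftrightarrow>
     (\<exists>S. finite S \<and> S \<subseteq> carrier M \<and> (\<forall>W. subbimodule A B W M \<and> S \<subseteq> W \<longrightarrow> W = carrier M))"

definition fg_projective_left :: "('k::field, 'a) module \<Rightarrow> ('a, 'b, 'm) bimodule \<Rightarrow> bool" where
  "fg_projective_left A M \<longleftrightarrow>
     finitely_generated A ground_field (left_part A M) \<and> projective_left A M"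

definition fg_projective_right :: "('k::field, 'b) module \<Rightarrow> ('a, 'b, 'm) bimodule \<Rightarrow> bool" where
  "fg_projective_right B M \<longleftrightarrow>
     finitely_generated ground_field B (right_part B M) \<and> projective_right B M"


section \<open>Stable equivalence of Morita type\<close>

text \<open>
  HOL cannot quantify over types inside a formula, so the type \<open>'u\<close> in which the bimodules live is a
  parameter; one type suffices for all four of them, since they can be transported to a common one.
  Nonexistence of a stable equivalence of Morita type is the negation of this predicate for
  every type \<open>'u\<close>.
\<close>

definition stably_equivalent_Morita ::
  "'u itself \<Rightarrow> ('k::field, 'a) module \<Rightarrow> ('k, 'b) module \<Rightarrow> bool" where
  "stably_equivalent_Morita TYPE('u) A B \<longleftrightarrow>
     (\<exists>(M :: ('a, 'b, 'u) bimodule) (N :: ('b, 'a, 'u) bimodule)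
       (P :: ('a, 'a, 'u) bimodule) (Q :: ('b, 'b, 'u) bimodule).
        bimodule A B M \<and> fg_projective_left A M \<and> fg_projective_right B M \<and>
        bimodule B A N \<and> fg_projective_left B N \<and> fg_projective_right A N \<and>
        bimodule A A P \<and> projective_bimodule A A P \<and>
        bimodule B B Q \<and> projective_bimodule B B Q \<and>
        bimodule_iso A A (tensor B M N) (direct_sum (regular_bimodule A) P) \<and>
        bimodule_iso B B (tensor A N M) (direct_sum (regular_bimodule B) Q))"


section \<open>The algebras \<open>D(1A)\<^sub>2\<^sup>k(d)\<close>\<close>

datatype letter = letter_x | letter_y

text \<open>
  The free monoid on \<open>x, y\<close>, written additively so that \<^type>\<open>poly_mapping\<close> provides its
  monoid algebra, which is the free algebra \<open>K\<langle>x, y\<rangle>\<close>.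
\<close>

datatype free_word = Word (letters: "letter list")

instantiation free_word :: monoid_add
begin

definition zero_free_word :: free_word where
  "0 = Word []"

definition plus_free_word :: "free_word \<Rightarrow> free_word \<Rightarrow> free_word" where
  "v + w = Word (letters v @ letters w)"

instance
  by standard (simp_all add: zero_free_word_def plus_free_word_def)

end

type_synonym 'k free_alg = "free_word \<Rightarrow>\<^sub>0 'k"

definition gen_x :: "'k::field free_alg" where
  "gen_x = Poly_Mapping.single (Word [letter_x]) 1"

definition gen_y :: "'k::field free_alg" where
  "gen_y = Poly_Mapping.single (Word [letter_y]) 1"

definition scalar :: "'k::field \<Rightarrow> 'k free_alg" where
  "scalar c = Poly_Mapping.single 0 c"

definition free_ring :: "'k::field free_alg ring" where
  "free_ring = ring_of_type_algebra"

definition D1A_ideal :: "nat \<Rightarrow> 'k::field \<Rightarrow> 'k free_alg set" where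
  "D1A_ideal k d = Idl\<^bsub>free_ring\<^esub>
     {gen_x ^ 2 - (gen_x * gen_y) ^ k,
      gen_y ^ 2 - scalar d * (gen_x * gen_y) ^ k,
      (gen_x * gen_y) ^ k - (gen_y * gen_x) ^ k,
      (gen_x * gen_y) ^ k * gen_x,
      (gen_y * gen_x) ^ k * gen_y}"

definition D1A :: "nat \<Rightarrow> 'k::field \<Rightarrow> ('k, 'k free_alg set) module" where
  "D1A k d =
    (let I = D1A_ideal k d; R = free_ring Quot I
     in ring.extend R (module.fields (\<lambda>c T. (I +>\<^bsub>free_ring\<^esub> scalar c) \<otimes>\<^bsub>R\<^esub> T)))"

end

theory Submission
  imports Defs "HOL-Library.Function_Algebras"
begin

text \<open>
  The invariant that separates the two algebras is the first Hochschild cohomology with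
  coefficients in the dual bimodule. A cocycle is a bilinear form \<open>f\<close> on \<open>A\<close> with
  \<open>f(ab, c) - f(a, bc) + f(ca, b) = 0\<close>, and the coboundaries are the forms \<open>g(ab) - g(ba)\<close> for
  a linear form \<open>g\<close>; the quotient is the dual of \<open>HH\<^sub>1(A)\<close>.

  \<^bold>\<open>Transfer.\<close> An \<open>A\<close>-\<open>B\<close>-bimodule \<open>M\<close> that is finitely generated projective over \<open>B\<close> has a finite dual
  basis, so left multiplication by \<open>a\<close> becomes a matrix \<open>X(a)\<close> over \<open>B\<close>. Evaluating a cocycle of \<open>B\<close> on
  \<open>X(a)\<close> and \<open>X(b)\<close> and taking the trace gives a cocycle of \<open>A\<close>. Up to a coboundary the result does not
  depend on the dual basis (\<open>trace_transfer_independent\<close>), the transfer along a tensor product is the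
  composite of the transfers (\<open>tensor_dual_basis\<close>), and along a projective bimodule it is zero
  (\<open>projective_bimodule_trace_zero\<close>). Hence for \<open>M \<otimes> N \<cong> A \<oplus> P\<close> the composite of the transfers along
  \<open>N\<close> and \<open>M\<close> is the identity modulo coboundaries (\<open>stable_equivalence_transfer\<close>).

  \<^bold>\<open>The two algebras.\<close> Both algebras have as basis the alternating words in \<open>x, y\<close> of length below
  \<open>2k\<close> together with the word \<open>s = (xy)\<^sup>k\<close>, and their multiplication tables differ only in
  \<open>y\<^sup>2 = d s\<close>. So commutators, and with them the coboundaries, are the same for \<open>d = 0\<close> and
  \<open>d = 1\<close>. For \<open>d = 1\<close> a cocycle vanishes as soon as one argument is \<open>s\<close>: in characteristic 2 this
  follows from \<open>s = x\<^sup>2 = y\<^sup>2\<close> (\<open>on_words_top_vanishes\<close>). Such a form does not see the difference of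
  the multiplications, so it is a cocycle for \<open>d = 0\<close> too. For \<open>d = 0\<close>, however, there is a derivation
  \<open>D\<close> with \<open>D(y) = 1\<close> and \<open>D(x) = (xy)\<^sup>k\<^sup>-\<^sup>1\<close>, and the coefficient of \<open>s\<close> in \<open>a D(b)\<close> is a cocycle with value
  \<open>1\<close> at \<open>(s, y)\<close> (\<open>cyc\<close>, \<open>cyc_nf\<close>). The cocycles for \<open>d = 1\<close> are therefore a proper subspace of those
  for \<open>d = 0\<close>, with the same coboundaries. A stable equivalence would embed the larger cohomology
  space into the smaller one, which dimensions forbid (\<open>subspace_eq_of_injection_modulo\<close>).
\<close>

section \<open>A dimension argument modulo a subspace\<close>

text \<open>
  If \<open>\<Phi> z \<in> C\<close> for some \<open>z\<close> in \<open>Z0\<close>, then applying \<open>\<Psi>\<close> gives \<open>z \<in> C\<close>. So \<open>\<Phi>\<close> carries a complement of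
  \<open>C\<close> in \<open>Z0\<close> injectively to a subspace of \<open>Z1\<close> that meets \<open>C\<close> only in \<open>0\<close>, and together with \<open>C\<close> this
  subspace has the dimension of \<open>Z0\<close>.
\<close>

lemma (in vector_space) subspace_eq_of_injection_modulo:
  assumes lin: "Vector_Spaces.linear scale scale \<Phi>" "Vector_Spaces.linear scale scale \<Psi>"
    and sub: "subspace C" "subspace Z1" "subspace Z0" "C \<subseteq> Z1" "Z1 \<subseteq> Z0"
    and fin: "finite S" "Z0 \<subseteq> span S"
    and maps: "\<Phi> ` Z0 \<subseteq> Z1" "\<Psi> ` C \<subseteq> C"
    and retract: "\<And>z. z \<in> Z0 \<Longrightarrow> \<Psi> (\<Phi> z) - z \<in> C"
  shows "Z1 = Z0"
proof (rule ccontr)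
  assume "Z1 \<noteq> Z0"
  then obtain z where z: "z \<in> Z0" "z \<notin> Z1" using sub by auto
  interpret P: Vector_Spaces.linear scale scale \<Phi> by (rule lin)
  interpret Q: Vector_Spaces.linear scale scale \<Psi> by (rule lin)
  obtain B where B: "B \<subseteq> C" "independent B" "C \<subseteq> span B"
    using maximal_independent_subset[of C] by metis
  obtain D where D: "B \<subseteq> D" "D \<subseteq> Z0" "independent D" "Z0 \<subseteq> span D"
    using maximal_independent_subset_extend[of B Z0] B sub by (metis order_trans)
  have finD: "finite D" "card D \<le> card S"
    using independent_span_bound[of S D] D fin by auto
  \<comment> \<open>A basis of a complement of \<open>C\<close> in \<open>Z0\<close>. Its image under \<open>\<Phi>\<close> stays independent modulo \<open>C\<close>.\<close>
  define E where "E = D - B"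
  have E: "E \<subseteq> Z0" "D = B \<union> E" "B \<inter> E = {}" "finite E" "finite B"
    using D finD finite_subset[of _ D] by (auto simp: E_def)
  have spanB: "span B = C" using B sub by (metis span_minimal span_mono span_eq_iff subset_antisym)
  have step: "independent (B \<union> \<Phi> ` E') \<and> card (B \<union> \<Phi> ` E') = card B + card E'"
    if "finite E'" "E' \<subseteq> E" for E' using that
  proof (induction E' rule: finite_induct)
    case empty then show ?case using B by simp
  next
    case (insert e E')
    have nin: "\<Phi> e \<notin> span (B \<union> \<Phi> ` E')"
    proof
      assume "\<Phi> e \<in> span (B \<union> \<Phi> ` E')"
      then obtain c w where cw: "\<Phi> e = c + w" "c \<in> span B" "w \<in> span (\<Phi> ` E')"
        unfolding span_Un by auto
      then obtain v where v: "v \<in> span E'" "w = \<Phi> v" by (auto simp: P.span_image)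
      have "v \<in> Z0" using v(1) insert.prems E(1) sub(3) by (meson insert_subset order_trans span_minimal subsetD)
      have ev: "e - v \<in> Z0" using \<open>v \<in> Z0\<close> insert.prems E(1) sub(3) by (auto intro: subspace_diff)
      have "\<Phi> (e - v) \<in> C" using cw v spanB by (simp add: P.diff)
      then have "\<Psi> (\<Phi> (e - v)) \<in> C" using maps by auto
      from subspace_diff[OF sub(1) this retract[OF ev]] have "e - v \<in> C" by simp
      then have "e - v \<in> span B" using spanB by simp
      then have "e - v \<in> span (B \<union> E')" by (meson span_mono subsetD sup_ge1)
      moreover have "v \<in> span (B \<union> E')" using v(1) by (meson span_mono subsetD sup_ge2)
      ultimately have "(e - v) + v \<in> span (B \<union> E')" by (rule span_add)
      then have es: "e \<in> span (B \<union> E')" by simp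
      have "B \<union> E' \<subseteq> D - {e}" using insert.hyps insert.prems E by auto
      then have "e \<in> span (D - {e})" using es span_mono by blast
      then show False using D(3) insert.prems E(2) unfolding dependent_def by auto
    qed
    then have notin: "\<Phi> e \<notin> B \<union> \<Phi> ` E'" using span_base by metis
    have IH: "independent (B \<union> \<Phi> ` E')" "card (B \<union> \<Phi> ` E') = card B + card E'"
      using insert.IH insert.prems by auto
    have eq: "B \<union> \<Phi> ` insert e E' = insert (\<Phi> e) (B \<union> \<Phi> ` E')" by blast
    have "card (B \<union> \<Phi> ` insert e E') = Suc (card (B \<union> \<Phi> ` E'))"
      unfolding eq by (rule card_insert_disjoint) (use E(5) insert.hyps notin in auto)
    then show ?case
      using IH independent_insertI[OF nin IH(1)] card_insert_disjoint[OF insert.hyps] unfolding eq by simp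
  qed
  let ?X = "B \<union> \<Phi> ` E"
  have X: "independent ?X" "card ?X = card B + card E" using step[OF E(4)] by auto
  have "\<Phi> ` E \<subseteq> Z1" using E(1) maps(1) by (meson image_mono order_trans)
  then have "?X \<subseteq> Z1" using B(1) sub(4) by simp
  then have zs: "z \<notin> span ?X" using z sub(2) span_minimal by blast
  then have ind: "independent (insert z ?X)" using X(1) by (rule independent_insertI)
  have "insert z ?X \<subseteq> span D"
    using z(1) order_trans[OF order_trans[OF \<open>?X \<subseteq> Z1\<close> sub(5)] D(4)] D(4) by (meson insert_subset subsetD)
  then have "card (insert z ?X) \<le> card D" using independent_span_bound[OF finD(1) ind] by simp
  moreover have "z \<notin> ?X" using zs span_base by metis
  then have "card (insert z ?X) = Suc (card ?X)"
    by (rule card_insert_disjoint[rotated]) (use E(4,5) in auto)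
  moreover have "card D = card B + card E" unfolding E(2) by (rule card_Un_disjoint) (use E in auto)
  ultimately show False using X(2) by linarith
qed

section \<open>Transfer of Hochschild cocycles along bimodules\<close>

lemma (in abelian_group_hom) hom_finsum:
  assumes "finite I" "\<And>i. i \<in> I \<Longrightarrow> x i \<in> carrier G"
  shows "h (\<Oplus>i\<in>I. x i) = (\<Oplus>\<^bsub>H\<^esub>i\<in>I. h (x i))"
  using assms
proof (induction I rule: finite_induct)
  case (insert i I)
  then have "x \<in> I \<rightarrow> carrier G" "(\<lambda>i. h (x i)) \<in> I \<rightarrow> carrier H" by auto
  then show ?case using insert by (simp add: G.finsum_insert H.finsum_insert)
qed simp

lemma abelian_group_homI':
  assumes "abelian_group G" "abelian_group H"
    and "\<And>x. x \<in> carrier G \<Longrightarrow> h x \<in> carrier H"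
    and "\<And>x y. x \<in> carrier G \<Longrightarrow> y \<in> carrier G \<Longrightarrow> h (x \<oplus>\<^bsub>G\<^esub> y) = h x \<oplus>\<^bsub>H\<^esub> h y"
  shows "abelian_group_hom G H h"
proof -
  interpret G: abelian_group G by fact
  interpret H: abelian_group H by fact
  have "h \<in> hom (add_monoid G) (add_monoid H)"
    by (rule homI) (use assms(3,4) in simp_all)
  then show ?thesis
    by (intro abelian_group_homI assms(1,2) group_hom.intro group_hom_axioms.intro G.a_group H.a_group)
qed

lemma (in abelian_monoid) finsum_finsum_product:
  assumes "finite I" "finite J" "\<And>i j. i \<in> I \<Longrightarrow> j \<in> J \<Longrightarrow> x i j \<in> carrier G"
  shows "(\<Oplus>p\<in>I\<times>J. x (fst p) (snd p)) = (\<Oplus>i\<in>I. \<Oplus>j\<in>J. x i j)"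
  using assms(1,3)
proof (induction I rule: finite_induct)
  case (insert i I)
  have "(\<Oplus>p\<in>insert i I \<times> J. x (fst p) (snd p)) =
      (\<Oplus>p\<in>Pair i ` J. x (fst p) (snd p)) \<oplus> (\<Oplus>p\<in>I\<times>J. x (fst p) (snd p))"
  proof -
    have "insert i I \<times> J = Pair i ` J \<union> I \<times> J" by auto
    then show ?thesis
      by (simp only:) (rule finsum_Un_disjoint, use insert assms(2) in auto)
  qed
  also have "(\<Oplus>p\<in>Pair i ` J. x (fst p) (snd p)) = (\<Oplus>j\<in>J. x i j)"
    by (subst finsum_reindex) (use insert in \<open>auto simp: inj_on_def\<close>)
  also have "\<dots> \<oplus> (\<Oplus>p\<in>I\<times>J. x (fst p) (snd p)) = (\<Oplus>i\<in>insert i I. \<Oplus>j\<in>J. x i j)"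
    using insert by (subst finsum_insert) (auto intro!: finsum_closed)
  finally show ?case .
qed simp

definition linear_form :: "('k::field, 'a) module \<Rightarrow> ('a \<Rightarrow> 'k) \<Rightarrow> bool" where
  "linear_form A g \<longleftrightarrow>
     (\<forall>a\<in>carrier A. \<forall>b\<in>carrier A. g (a \<oplus>\<^bsub>A\<^esub> b) = g a + g b) \<and>
     (\<forall>c. \<forall>a\<in>carrier A. g (c \<odot>\<^bsub>A\<^esub> a) = c * g a)"

definition hochschild_coboundary :: "('k::field, 'a) module \<Rightarrow> ('a \<Rightarrow> 'a \<Rightarrow> 'k) \<Rightarrow> bool" where
  "hochschild_coboundary A f \<longleftrightarrow> (\<exists>g. linear_form A g \<and>
     (\<forall>a\<in>carrier A. \<forall>b\<in>carrier A. f a b = g (a \<otimes>\<^bsub>A\<^esub> b) - g (b \<otimes>\<^bsub>A\<^esub> a)))"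

text \<open>
  A 1-cocycle with coefficients in the dual bimodule: \<open>b \<mapsto> f(\<cdot>, b)\<close> is a derivation of \<open>A\<close> into
  \<open>Hom(A, K)\<close>.
\<close>

locale hochschild_cocycle = k_algebra A for A :: "('k::field, 'a) module" (structure) +
  fixes f :: "'a \<Rightarrow> 'a \<Rightarrow> 'k"
  assumes linear_left: "b \<in> carrier A \<Longrightarrow> linear_form A (\<lambda>a. f a b)"
    and linear_right: "a \<in> carrier A \<Longrightarrow> linear_form A (f a)"
    and cocycle: "\<lbrakk>a \<in> carrier A; b \<in> carrier A; c \<in> carrier A\<rbrakk>
      \<Longrightarrow> f (a \<otimes> b) c - f a (b \<otimes> c) + f (c \<otimes> a) b = 0"

lemma (in k_algebra) smult_carrier [simp, intro]: "a \<in> carrier A \<Longrightarrow> c \<odot> a \<in> carrier A"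
  by (rule smult_closed) (simp add: ring_of_type_algebra_def)

lemma (in k_algebra) linear_form_finsum:
  assumes "linear_form A g" "finite I" "\<And>i. i \<in> I \<Longrightarrow> x i \<in> carrier A"
  shows "g (\<Oplus>i\<in>I. x i) = (\<Sum>i\<in>I. g (x i))"
proof -
  have "g (\<zero> \<oplus> \<zero>) = g \<zero> + g \<zero>" using assms(1) unfolding linear_form_def by blast
  then have z: "g \<zero> = 0" by (metis add_cancel_right_left l_zero zero_closed)
  show ?thesis using assms(2,3)
  proof (induction I rule: finite_induct)
    case (insert i I)
    then have "x \<in> I \<rightarrow> carrier A" by auto
    then show ?case using insert assms(1) by (simp add: finsum_insert linear_form_def)
  qed (simp add: z)
qed

text \<open>
  The trace of \<open>f\<close> applied to a product of two rectangular matrices; for a single entry it is \<open>f\<close>.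
\<close>

definition trace_pairing ::
  "('a \<Rightarrow> 'a \<Rightarrow> 'k::comm_monoid_add) \<Rightarrow> 'i set \<Rightarrow> 'j set \<Rightarrow> ('i \<Rightarrow> 'j \<Rightarrow> 'a) \<Rightarrow> ('j \<Rightarrow> 'i \<Rightarrow> 'a) \<Rightarrow> 'k" where
  "trace_pairing f I J P Q = (\<Sum>i\<in>I. \<Sum>j\<in>J. f (P i j) (Q j i))"

text \<open>
  The cocycle identity survives the passage to matrices because the trace is cyclic. Rectangular
  matrices are needed since different dual bases of one module have different sizes.
\<close>

lemma (in hochschild_cocycle) trace_pairing_cocycle:
  assumes fin: "finite I" "finite J" "finite K"
    and P: "\<And>i j. i \<in> I \<Longrightarrow> j \<in> J \<Longrightarrow> P i j \<in> carrier A"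
    and Q: "\<And>j k. j \<in> J \<Longrightarrow> k \<in> K \<Longrightarrow> Q j k \<in> carrier A"
    and R: "\<And>k i. k \<in> K \<Longrightarrow> i \<in> I \<Longrightarrow> R k i \<in> carrier A"
    and PQ: "\<And>i k. i \<in> I \<Longrightarrow> k \<in> K \<Longrightarrow> PQ i k = (\<Oplus>j\<in>J. P i j \<otimes> Q j k)"
    and QR: "\<And>j i. j \<in> J \<Longrightarrow> i \<in> I \<Longrightarrow> QR j i = (\<Oplus>k\<in>K. Q j k \<otimes> R k i)"
    and RP: "\<And>k j. k \<in> K \<Longrightarrow> j \<in> J \<Longrightarrow> RP k j = (\<Oplus>i\<in>I. R k i \<otimes> P i j)"
  shows "trace_pairing f I K PQ R - trace_pairing f I J P QR + trace_pairing f K J RP Q = 0"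
proof -
  have 1: "trace_pairing f I K PQ R = (\<Sum>i\<in>I. \<Sum>j\<in>J. \<Sum>k\<in>K. f (P i j \<otimes> Q j k) (R k i))"
  proof -
    have "f (PQ i k) (R k i) = (\<Sum>j\<in>J. f (P i j \<otimes> Q j k) (R k i))" if "i \<in> I" "k \<in> K" for i k
      unfolding PQ[OF that]
      by (rule linear_form_finsum) (use that fin P Q R linear_left in auto)
    then have "trace_pairing f I K PQ R = (\<Sum>i\<in>I. \<Sum>k\<in>K. \<Sum>j\<in>J. f (P i j \<otimes> Q j k) (R k i))"
      by (simp add: trace_pairing_def)
    also have "\<dots> = (\<Sum>i\<in>I. \<Sum>j\<in>J. \<Sum>k\<in>K. f (P i j \<otimes> Q j k) (R k i))"
      by (intro sum.cong refl sum.swap)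
    finally show ?thesis .
  qed
  have 2: "trace_pairing f I J P QR = (\<Sum>i\<in>I. \<Sum>j\<in>J. \<Sum>k\<in>K. f (P i j) (Q j k \<otimes> R k i))"
  proof -
    have "f (P i j) (QR j i) = (\<Sum>k\<in>K. f (P i j) (Q j k \<otimes> R k i))" if "i \<in> I" "j \<in> J" for i j
      unfolding QR[OF that(2,1)]
      by (rule linear_form_finsum) (use that fin P Q R linear_right in auto)
    then show ?thesis by (simp add: trace_pairing_def)
  qed
  have 3: "trace_pairing f K J RP Q = (\<Sum>i\<in>I. \<Sum>j\<in>J. \<Sum>k\<in>K. f (R k i \<otimes> P i j) (Q j k))"
  proof -
    have "f (RP k j) (Q j k) = (\<Sum>i\<in>I. f (R k i \<otimes> P i j) (Q j k))" if "k \<in> K" "j \<in> J" for k j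
      unfolding RP[OF that]
      by (rule linear_form_finsum) (use that fin P Q R linear_left in auto)
    then have "trace_pairing f K J RP Q = (\<Sum>k\<in>K. \<Sum>j\<in>J. \<Sum>i\<in>I. f (R k i \<otimes> P i j) (Q j k))"
      by (simp add: trace_pairing_def)
    also have "\<dots> = (\<Sum>k\<in>K. \<Sum>i\<in>I. \<Sum>j\<in>J. f (R k i \<otimes> P i j) (Q j k))"
      by (intro sum.cong refl sum.swap)
    also have "\<dots> = (\<Sum>i\<in>I. \<Sum>k\<in>K. \<Sum>j\<in>J. f (R k i \<otimes> P i j) (Q j k))" by (rule sum.swap)
    also have "\<dots> = (\<Sum>i\<in>I. \<Sum>j\<in>J. \<Sum>k\<in>K. f (R k i \<otimes> P i j) (Q j k))"
      by (intro sum.cong refl sum.swap)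
    finally show ?thesis .
  qed
  show ?thesis
    unfolding 1 2 3 sum_subtractf[symmetric] sum.distrib[symmetric]
    by (intro sum.neutral ballI cocycle P Q R)
qed

lemma (in hochschild_cocycle) cocycle_one: "a \<in> carrier A \<Longrightarrow> f a \<one> = 0"
  using cocycle[of a \<one> \<one>] by simp

text \<open>
  Generators together with right linear coordinates. Existence of such a finite system is what
  being finitely generated projective over \<open>B\<close> means.
\<close>

locale right_dual_basis = bimodule A B M
  for A :: "('k::field, 'a) module" and B :: "('k, 'b) module" and M :: "('a, 'b, 'm) bimodule" +
  fixes I :: "'i set" and m :: "'i \<Rightarrow> 'm" and \<phi> :: "'i \<Rightarrow> 'm \<Rightarrow> 'b"
  assumes finite_index: "finite I"
    and basis_closed: "i \<in> I \<Longrightarrow> m i \<in> carrier M"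
    and coord_hom: "i \<in> I \<Longrightarrow> abelian_group_hom M B (\<phi> i)"
    and coord_ract: "\<lbrakk>i \<in> I; t \<in> carrier M; b \<in> carrier B\<rbrakk> \<Longrightarrow> \<phi> i (t \<triangleleft>\<^bsub>M\<^esub> b) = \<phi> i t \<otimes>\<^bsub>B\<^esub> b"
    and expansion: "t \<in> carrier M \<Longrightarrow> t = (\<Oplus>\<^bsub>M\<^esub>i\<in>I. m i \<triangleleft>\<^bsub>M\<^esub> \<phi> i t)"
begin

lemma coord_closed [simp, intro]: "i \<in> I \<Longrightarrow> t \<in> carrier M \<Longrightarrow> \<phi> i t \<in> carrier B"
  by (rule abelian_group_hom.hom_closed[OF coord_hom])

lemma coord_add: "\<lbrakk>i \<in> I; t \<in> carrier M; t' \<in> carrier M\<rbrakk>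
    \<Longrightarrow> \<phi> i (t \<oplus>\<^bsub>M\<^esub> t') = \<phi> i t \<oplus>\<^bsub>B\<^esub> \<phi> i t'"
  by (rule abelian_group_hom.hom_add[OF coord_hom])

lemma coord_finsum:
  assumes "i \<in> I" "finite J" "\<And>j. j \<in> J \<Longrightarrow> x j \<in> carrier M"
  shows "\<phi> i (\<Oplus>\<^bsub>M\<^esub>j\<in>J. x j) = (\<Oplus>\<^bsub>B\<^esub>j\<in>J. \<phi> i (x j))"
  by (rule abelian_group_hom.hom_finsum[OF coord_hom]) (use assms in auto)

end

lemma (in bimodule) lact_hom: "a \<in> carrier A \<Longrightarrow> abelian_group_hom M M (\<lambda>m. a \<odot>\<^bsub>M\<^esub> m)"
  by (rule abelian_group_homI') (auto simp: lact_add_right lact_closed M.abelian_group_axioms)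

lemma (in bimodule) ract_hom: "b \<in> carrier B \<Longrightarrow> abelian_group_hom M M (\<lambda>m. m \<triangleleft>\<^bsub>M\<^esub> b)"
  by (rule abelian_group_homI') (auto simp: ract_add_left ract_closed M.abelian_group_axioms)

lemma (in bimodule) ract_hom_right: "m \<in> carrier M \<Longrightarrow> abelian_group_hom B M (\<lambda>b. m \<triangleleft>\<^bsub>M\<^esub> b)"
  by (rule abelian_group_homI') (auto simp: ract_add_right ract_closed M.abelian_group_axioms B.is_abelian_group)

text \<open>
  Matrix coefficients multiply like morphisms: writing \<open>X\<^sub>s\<^sub>t(a)\<close> for the coordinates in the system \<open>s\<close>
  of \<open>a\<close> times the generators of \<open>t\<close>, one has \<open>X\<^sub>s\<^sub>t(a) X\<^sub>t\<^sub>u(b) = X\<^sub>s\<^sub>u(ab)\<close>. Taking \<open>a = 1\<close> or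
  \<open>b = 1\<close>, this also expresses the change between dual bases.
\<close>

lemma coordinates_mult:
  assumes s: "right_dual_basis A B M I m \<phi>" and t: "right_dual_basis A B M J n \<psi>"
    and i: "i \<in> I" and u: "u \<in> carrier M" and a: "a \<in> carrier A" and b: "b \<in> carrier A"
  shows "\<phi> i ((a \<otimes>\<^bsub>A\<^esub> b) \<odot>\<^bsub>M\<^esub> u) =
    (\<Oplus>\<^bsub>B\<^esub>j\<in>J. \<phi> i (a \<odot>\<^bsub>M\<^esub> n j) \<otimes>\<^bsub>B\<^esub> \<psi> j (b \<odot>\<^bsub>M\<^esub> u))"
proof -
  interpret s: right_dual_basis A B M I m \<phi> by (rule s)
  interpret t: right_dual_basis A B M J n \<psi> by (rule t)
  have bu: "b \<odot>\<^bsub>M\<^esub> u \<in> carrier M" using b u by (rule s.lact_closed)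
  have "(a \<otimes>\<^bsub>A\<^esub> b) \<odot>\<^bsub>M\<^esub> u = a \<odot>\<^bsub>M\<^esub> (\<Oplus>\<^bsub>M\<^esub>j\<in>J. n j \<triangleleft>\<^bsub>M\<^esub> \<psi> j (b \<odot>\<^bsub>M\<^esub> u))"
    using t.expansion[OF bu] s.lact_assoc[OF a b u] by simp
  also have "\<dots> = (\<Oplus>\<^bsub>M\<^esub>j\<in>J. a \<odot>\<^bsub>M\<^esub> (n j \<triangleleft>\<^bsub>M\<^esub> \<psi> j (b \<odot>\<^bsub>M\<^esub> u)))"
    by (rule abelian_group_hom.hom_finsum[OF s.lact_hom[OF a]])
      (use t.finite_index bu in \<open>auto intro!: s.ract_closed t.basis_closed\<close>)
  also have "\<phi> i \<dots> = (\<Oplus>\<^bsub>B\<^esub>j\<in>J. \<phi> i (a \<odot>\<^bsub>M\<^esub> (n j \<triangleleft>\<^bsub>M\<^esub> \<psi> j (b \<odot>\<^bsub>M\<^esub> u))))"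
    by (rule s.coord_finsum) (use t.finite_index i a bu in \<open>auto intro!: s.ract_closed t.basis_closed s.lact_closed\<close>)
  also have "\<dots> = (\<Oplus>\<^bsub>B\<^esub>j\<in>J. \<phi> i (a \<odot>\<^bsub>M\<^esub> n j) \<otimes>\<^bsub>B\<^esub> \<psi> j (b \<odot>\<^bsub>M\<^esub> u))"
    by (rule s.B.finsum_cong')
      (use i a bu in \<open>auto simp: s.act_commute[symmetric] t.basis_closed s.coord_ract s.lact_closed\<close>)
  finally show ?thesis .
qed

text \<open>
  The form \<open>F\<^sub>s\<^sub>t(a, b) = tr f(X\<^sub>s\<^sub>t(a), X\<^sub>t\<^sub>s(b))\<close>. Besides the transfer of \<open>f\<close>, which is the case \<open>s = t\<close>,
  the case of two different dual bases is used to compare their transfers.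
\<close>

definition mixed_trace ::
  "('a, 'b, 'm) bimodule \<Rightarrow> ('b \<Rightarrow> 'b \<Rightarrow> 'k::comm_monoid_add) \<Rightarrow>
   'i set \<Rightarrow> ('i \<Rightarrow> 'm) \<Rightarrow> ('i \<Rightarrow> 'm \<Rightarrow> 'b) \<Rightarrow>
   'j set \<Rightarrow> ('j \<Rightarrow> 'm) \<Rightarrow> ('j \<Rightarrow> 'm \<Rightarrow> 'b) \<Rightarrow> 'a \<Rightarrow> 'a \<Rightarrow> 'k" where
  "mixed_trace M f I m \<phi> J n \<psi> a b =
     trace_pairing f I J (\<lambda>i j. \<phi> i (a \<odot>\<^bsub>M\<^esub> n j)) (\<lambda>j i. \<psi> j (b \<odot>\<^bsub>M\<^esub> m i))"

lemma mixed_trace_cocycle: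
  assumes f: "hochschild_cocycle B f"
    and s: "right_dual_basis A B M I m \<phi>" and t: "right_dual_basis A B M J n \<psi>"
    and u: "right_dual_basis A B M K l \<chi>"
    and a: "a \<in> carrier A" and b: "b \<in> carrier A" and c: "c \<in> carrier A"
  shows "mixed_trace M f I m \<phi> K l \<chi> (a \<otimes>\<^bsub>A\<^esub> b) c - mixed_trace M f I m \<phi> J n \<psi> a (b \<otimes>\<^bsub>A\<^esub> c)
    + mixed_trace M f K l \<chi> J n \<psi> (c \<otimes>\<^bsub>A\<^esub> a) b = 0"
proof -
  interpret s: right_dual_basis A B M I m \<phi> by (rule s)
  interpret t: right_dual_basis A B M J n \<psi> by (rule t)
  interpret u: right_dual_basis A B M K l \<chi> by (rule u)
  interpret hochschild_cocycle B f by (rule f)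
  show ?thesis unfolding mixed_trace_def
    by (rule trace_pairing_cocycle)
      (use a b c coordinates_mult[OF s t] coordinates_mult[OF t u] coordinates_mult[OF u s] in
        \<open>auto simp: s.lact_closed s.basis_closed t.basis_closed u.basis_closed
          s.finite_index t.finite_index u.finite_index\<close>)
qed

lemma (in bimodule) lact_scalar:
  assumes "a \<in> carrier A" "t \<in> carrier M"
  shows "(c \<odot>\<^bsub>A\<^esub> a) \<odot>\<^bsub>M\<^esub> t = (a \<odot>\<^bsub>M\<^esub> t) \<triangleleft>\<^bsub>M\<^esub> (c \<odot>\<^bsub>B\<^esub> \<one>\<^bsub>B\<^esub>)"
proof -
  have "c \<odot>\<^bsub>A\<^esub> a = (c \<odot>\<^bsub>A\<^esub> \<one>\<^bsub>A\<^esub>) \<otimes>\<^bsub>A\<^esub> a"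
    using assms by (simp add: A.smult_mult_left)
  then show ?thesis using assms by (simp add: lact_assoc scalars_central lact_closed)
qed

lemma linear_form_sum:
  assumes "\<And>i. i \<in> I \<Longrightarrow> linear_form A (g i)"
  shows "linear_form A (\<lambda>a. \<Sum>i\<in>I. g i a)"
  unfolding linear_form_def
proof (intro conjI ballI allI)
  fix a b assume "a \<in> carrier A" "b \<in> carrier A"
  then have "g i (a \<oplus>\<^bsub>A\<^esub> b) = g i a + g i b" if "i \<in> I" for i
    using assms[OF that] unfolding linear_form_def by blast
  then show "(\<Sum>i\<in>I. g i (a \<oplus>\<^bsub>A\<^esub> b)) = (\<Sum>i\<in>I. g i a) + (\<Sum>i\<in>I. g i b)"
    by (simp add: sum.distrib)
next
  fix c a assume "a \<in> carrier A"
  then have "g i (c \<odot>\<^bsub>A\<^esub> a) = c * g i a" if "i \<in> I" for i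
    using assms[OF that] unfolding linear_form_def by blast
  then show "(\<Sum>i\<in>I. g i (c \<odot>\<^bsub>A\<^esub> a)) = c * (\<Sum>i\<in>I. g i a)"
    by (simp add: sum_distrib_left)
qed

lemma (in right_dual_basis) linear_form_coord:
  assumes g: "linear_form B g" and i: "i \<in> I" and t: "t \<in> carrier M"
  shows "linear_form A (\<lambda>a. g (\<phi> i (a \<odot>\<^bsub>M\<^esub> t)))"
  unfolding linear_form_def
proof (intro conjI ballI allI)
  fix a b assume ab: "a \<in> carrier A" "b \<in> carrier A"
  then have c: "\<phi> i (a \<odot>\<^bsub>M\<^esub> t) \<in> carrier B" "\<phi> i (b \<odot>\<^bsub>M\<^esub> t) \<in> carrier B"
    using i t by (simp_all add: lact_closed)
  have "\<phi> i ((a \<oplus>\<^bsub>A\<^esub> b) \<odot>\<^bsub>M\<^esub> t) = \<phi> i (a \<odot>\<^bsub>M\<^esub> t) \<oplus>\<^bsub>B\<^esub> \<phi> i (b \<odot>\<^bsub>M\<^esub> t)"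
    using ab i t by (simp add: lact_add_left coord_add lact_closed)
  then show "g (\<phi> i ((a \<oplus>\<^bsub>A\<^esub> b) \<odot>\<^bsub>M\<^esub> t)) = g (\<phi> i (a \<odot>\<^bsub>M\<^esub> t)) + g (\<phi> i (b \<odot>\<^bsub>M\<^esub> t))"
    using g c unfolding linear_form_def by simp
next
  fix c a assume a: "a \<in> carrier A"
  then have cl: "a \<odot>\<^bsub>M\<^esub> t \<in> carrier M" "\<phi> i (a \<odot>\<^bsub>M\<^esub> t) \<in> carrier B"
    using i t by (simp_all add: lact_closed)
  have "\<phi> i ((c \<odot>\<^bsub>A\<^esub> a) \<odot>\<^bsub>M\<^esub> t) = c \<odot>\<^bsub>B\<^esub> \<phi> i (a \<odot>\<^bsub>M\<^esub> t)"
    using lact_scalar[OF a t] cl i by (simp add: coord_ract B.smult_mult_right)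
  then show "g (\<phi> i ((c \<odot>\<^bsub>A\<^esub> a) \<odot>\<^bsub>M\<^esub> t)) = c * g (\<phi> i (a \<odot>\<^bsub>M\<^esub> t))"
    using g cl(2) unfolding linear_form_def by simp
qed

lemma linear_form_mixed_trace:
  assumes f: "hochschild_cocycle B f"
    and s: "right_dual_basis A B M I m \<phi>" and t: "right_dual_basis A B M J n \<psi>"
    and b: "b \<in> carrier A"
  shows "linear_form A (\<lambda>a. mixed_trace M f I m \<phi> J n \<psi> a b)"
    and "linear_form A (mixed_trace M f I m \<phi> J n \<psi> b)"
proof -
  interpret s: right_dual_basis A B M I m \<phi> by (rule s)
  interpret t: right_dual_basis A B M J n \<psi> by (rule t)
  interpret hochschild_cocycle B f by (rule f)
  have "linear_form A (\<lambda>a. f (\<phi> i (a \<odot>\<^bsub>M\<^esub> n j)) (\<psi> j (b \<odot>\<^bsub>M\<^esub> m i)))" if "i \<in> I" "j \<in> J" for i j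
    by (rule s.linear_form_coord[OF linear_left])
      (use that b in \<open>auto intro!: t.coord_closed s.lact_closed s.basis_closed t.basis_closed\<close>)
  then show "linear_form A (\<lambda>a. mixed_trace M f I m \<phi> J n \<psi> a b)"
    unfolding mixed_trace_def trace_pairing_def by (intro linear_form_sum)
  have "linear_form A (\<lambda>a. f (\<phi> i (b \<odot>\<^bsub>M\<^esub> n j)) (\<psi> j (a \<odot>\<^bsub>M\<^esub> m i)))" if "i \<in> I" "j \<in> J" for i j
    by (rule t.linear_form_coord[OF linear_right])
      (use that b in \<open>auto intro!: s.coord_closed s.lact_closed s.basis_closed t.basis_closed\<close>)
  then show "linear_form A (mixed_trace M f I m \<phi> J n \<psi> b)"
    unfolding mixed_trace_def trace_pairing_def by (intro linear_form_sum)
qed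

abbreviation trace_transfer ::
  "('a, 'b, 'm) bimodule \<Rightarrow> 'i set \<Rightarrow> ('i \<Rightarrow> 'm) \<Rightarrow> ('i \<Rightarrow> 'm \<Rightarrow> 'b) \<Rightarrow>
   ('b \<Rightarrow> 'b \<Rightarrow> 'k::comm_monoid_add) \<Rightarrow> 'a \<Rightarrow> 'a \<Rightarrow> 'k" where
  "trace_transfer M I m \<phi> f \<equiv> mixed_trace M f I m \<phi> I m \<phi>"

lemma trace_transfer_cocycle:
  assumes f: "hochschild_cocycle B f" and s: "right_dual_basis A B M I m \<phi>"
  shows "hochschild_cocycle A (trace_transfer M I m \<phi> f)"
proof -
  interpret s: right_dual_basis A B M I m \<phi> by (rule s)
  show ?thesis
    by unfold_locales (fact linear_form_mixed_trace[OF f s s] mixed_trace_cocycle[OF f s s s])+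
qed

text \<open>
  The comparison is through \<open>G = F\<^sub>t\<^sub>s\<close>: the mixed cocycle identities express \<open>F\<^sub>t\<^sub>t(a, b) - F\<^sub>s\<^sub>s(a, b)\<close> as
  \<open>G(ab, 1) - G(ba, 1)\<close>.
\<close>

lemma trace_transfer_independent:
  fixes f :: "'b \<Rightarrow> 'b \<Rightarrow> 'k::field"
  assumes f: "hochschild_cocycle B f"
    and s: "right_dual_basis A B M I m \<phi>" and t: "right_dual_basis A B M J n \<psi>"
  shows "hochschild_coboundary A
    (\<lambda>a b. trace_transfer M J n \<psi> f a b - trace_transfer M I m \<phi> f a b)"
proof -
  interpret s: right_dual_basis A B M I m \<phi> by (rule s)
  define F where "F = mixed_trace M f I m \<phi> J n \<psi>"
  define G where "G = mixed_trace M f J n \<psi> I m \<phi>"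
  have one: "\<one>\<^bsub>A\<^esub> \<in> carrier A" by simp
  \<comment> \<open>Exchanging the two dual bases changes the sign of the value at \<open>(c, 1)\<close>, since the transfers vanish there.\<close>
  have FG: "F c \<one>\<^bsub>A\<^esub> = - G c \<one>\<^bsub>A\<^esub>" if c: "c \<in> carrier A" for c
  proof -
    have "trace_transfer M I m \<phi> f c \<one>\<^bsub>A\<^esub> = 0"
      using hochschild_cocycle.cocycle_one[OF trace_transfer_cocycle[OF f s] c] .
    moreover have "F c \<one>\<^bsub>A\<^esub> - trace_transfer M I m \<phi> f c \<one>\<^bsub>A\<^esub> + G c \<one>\<^bsub>A\<^esub> = 0"
      using mixed_trace_cocycle[OF f s s t c one one] c by (simp add: F_def G_def)
    ultimately show ?thesis by (simp add: eq_neg_iff_add_eq_0)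
  qed
  have "trace_transfer M J n \<psi> f a b - trace_transfer M I m \<phi> f a b = G (a \<otimes>\<^bsub>A\<^esub> b) \<one>\<^bsub>A\<^esub> - G (b \<otimes>\<^bsub>A\<^esub> a) \<one>\<^bsub>A\<^esub>"
    if a: "a \<in> carrier A" and b: "b \<in> carrier A" for a b
  proof -
    have 1: "F (a \<otimes>\<^bsub>A\<^esub> b) \<one>\<^bsub>A\<^esub> - trace_transfer M I m \<phi> f a b + G a b = 0"
      using mixed_trace_cocycle[OF f s s t a b one] a b by (simp add: F_def G_def)
    have 2: "trace_transfer M J n \<psi> f a b - G a b + G (b \<otimes>\<^bsub>A\<^esub> a) \<one>\<^bsub>A\<^esub> = 0"
      using mixed_trace_cocycle[OF f t s t a one b] a b by (simp add: F_def G_def)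
    have 3: "F (a \<otimes>\<^bsub>A\<^esub> b) \<one>\<^bsub>A\<^esub> = - G (a \<otimes>\<^bsub>A\<^esub> b) \<one>\<^bsub>A\<^esub>" by (rule FG) (use a b in simp)
    have alg: "x' - x = g - h" if "p = - g" "p - x + u = 0" "x' - u + h = 0" for x x' g h p u :: 'k
    proof -
      have "x' - x - (g - h) = (x' - u + h) + (p - x + u) - (p + g)" by (simp add: algebra_simps)
      also have "\<dots> = 0" unfolding that(2,3) by (simp add: that(1))
      finally show ?thesis by simp
    qed
    show ?thesis by (rule alg[OF 3 1 2])
  qed
  moreover have "linear_form A (\<lambda>c. G c \<one>\<^bsub>A\<^esub>)"
    unfolding G_def by (rule linear_form_mixed_trace(1)[OF f t s one])
  ultimately show ?thesis unfolding hochschild_coboundary_def by blast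
qed

lemma trace_transfer_coboundary:
  assumes f: "hochschild_coboundary B f" and s: "right_dual_basis A B M I m \<phi>"
  shows "hochschild_coboundary A (trace_transfer M I m \<phi> f)"
proof -
  interpret s: right_dual_basis A B M I m \<phi> by (rule s)
  obtain g where g: "linear_form B g"
    "\<And>a b. a \<in> carrier B \<Longrightarrow> b \<in> carrier B \<Longrightarrow> f a b = g (a \<otimes>\<^bsub>B\<^esub> b) - g (b \<otimes>\<^bsub>B\<^esub> a)"
    using f unfolding hochschild_coboundary_def by blast
  define G where "G a = (\<Sum>i\<in>I. g (\<phi> i (a \<odot>\<^bsub>M\<^esub> m i)))" for a
  have *: "(\<Sum>i\<in>I. \<Sum>j\<in>I. g (\<phi> i (a \<odot>\<^bsub>M\<^esub> m j) \<otimes>\<^bsub>B\<^esub> \<phi> j (b \<odot>\<^bsub>M\<^esub> m i))) = G (a \<otimes>\<^bsub>A\<^esub> b)"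
    if a: "a \<in> carrier A" and b: "b \<in> carrier A" for a b
    unfolding G_def
  proof (rule sum.cong[OF refl])
    fix i assume i: "i \<in> I"
    show "(\<Sum>j\<in>I. g (\<phi> i (a \<odot>\<^bsub>M\<^esub> m j) \<otimes>\<^bsub>B\<^esub> \<phi> j (b \<odot>\<^bsub>M\<^esub> m i))) = g (\<phi> i ((a \<otimes>\<^bsub>A\<^esub> b) \<odot>\<^bsub>M\<^esub> m i))"
      unfolding coordinates_mult[OF s s i s.basis_closed[OF i] a b]
      by (rule s.B.linear_form_finsum[symmetric])
        (use g(1) i a b in \<open>auto simp: s.finite_index s.lact_closed s.basis_closed\<close>)
  qed
  have "trace_transfer M I m \<phi> f a b = G (a \<otimes>\<^bsub>A\<^esub> b) - G (b \<otimes>\<^bsub>A\<^esub> a)"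
    if a: "a \<in> carrier A" and b: "b \<in> carrier A" for a b
  proof -
    have "trace_transfer M I m \<phi> f a b =
      (\<Sum>i\<in>I. \<Sum>j\<in>I. g (\<phi> i (a \<odot>\<^bsub>M\<^esub> m j) \<otimes>\<^bsub>B\<^esub> \<phi> j (b \<odot>\<^bsub>M\<^esub> m i))) -
      (\<Sum>i\<in>I. \<Sum>j\<in>I. g (\<phi> j (b \<odot>\<^bsub>M\<^esub> m i) \<otimes>\<^bsub>B\<^esub> \<phi> i (a \<odot>\<^bsub>M\<^esub> m j)))"
      using a b by (simp add: mixed_trace_def trace_pairing_def g(2) s.lact_closed s.basis_closed sum_subtractf)
    also have "(\<Sum>i\<in>I. \<Sum>j\<in>I. g (\<phi> j (b \<odot>\<^bsub>M\<^esub> m i) \<otimes>\<^bsub>B\<^esub> \<phi> i (a \<odot>\<^bsub>M\<^esub> m j))) = G (b \<otimes>\<^bsub>A\<^esub> a)"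
      unfolding *[OF b a, symmetric] by (rule sum.swap)
    finally show ?thesis using *[OF a b] by simp
  qed
  moreover have "linear_form A G"
    unfolding G_def by (intro linear_form_sum s.linear_form_coord[OF g(1)] s.basis_closed)
  ultimately show ?thesis unfolding hochschild_coboundary_def by blast
qed

text \<open>
  If left multiplication is described by matrices \<open>L(a)\<close> of scalars on both the generators and the
  coordinates, then \<open>X(a) = L(a) E = E L(a)\<close> for \<open>E = X(1)\<close>. The cocycle identity for \<open>X(a)\<close>, \<open>L(b)\<close>, \<open>E\<close>
  reduces the transfer to values \<open>f(c, 1)\<close>, and these are zero for every cocycle.
\<close>

lemma trace_transfer_scalar_action:
  assumes f: "hochschild_cocycle B f" and s: "right_dual_basis A B M I m \<phi>"
    and basis: "\<And>a j. a \<in> carrier A \<Longrightarrow> j \<in> I \<Longrightarrow>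
      a \<odot>\<^bsub>M\<^esub> m j = (\<Oplus>\<^bsub>M\<^esub>i\<in>I. m i \<triangleleft>\<^bsub>M\<^esub> (\<mu> i j a \<odot>\<^bsub>B\<^esub> \<one>\<^bsub>B\<^esub>))"
    and coord: "\<And>a i t. a \<in> carrier A \<Longrightarrow> i \<in> I \<Longrightarrow> t \<in> carrier M \<Longrightarrow>
      \<phi> i (a \<odot>\<^bsub>M\<^esub> t) = (\<Oplus>\<^bsub>B\<^esub>j\<in>I. (\<mu> i j a \<odot>\<^bsub>B\<^esub> \<one>\<^bsub>B\<^esub>) \<otimes>\<^bsub>B\<^esub> \<phi> j t)"
    and a: "a \<in> carrier A" and b: "b \<in> carrier A"
  shows "trace_transfer M I m \<phi> f a b = 0"
proof -
  interpret s: right_dual_basis A B M I m \<phi> by (rule s)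
  interpret hochschild_cocycle B f by (rule f)
  let ?X = "\<lambda>a i j. \<phi> i (a \<odot>\<^bsub>M\<^esub> m j)"
  let ?L = "\<lambda>i j. \<mu> i j b \<odot>\<^bsub>B\<^esub> \<one>\<^bsub>B\<^esub>"
  have one: "\<one>\<^bsub>A\<^esub> \<in> carrier A" by simp
  have ab: "?X (a \<otimes>\<^bsub>A\<^esub> b) i k = (\<Oplus>\<^bsub>B\<^esub>j\<in>I. ?X a i j \<otimes>\<^bsub>B\<^esub> ?L j k)" if "i \<in> I" "k \<in> I" for i k
  proof -
    have "(a \<otimes>\<^bsub>A\<^esub> b) \<odot>\<^bsub>M\<^esub> m k = a \<odot>\<^bsub>M\<^esub> (\<Oplus>\<^bsub>M\<^esub>j\<in>I. m j \<triangleleft>\<^bsub>M\<^esub> ?L j k)"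
      using basis[OF b that(2)] s.lact_assoc[OF a b s.basis_closed[OF that(2)]] by simp
    also have "\<dots> = (\<Oplus>\<^bsub>M\<^esub>j\<in>I. a \<odot>\<^bsub>M\<^esub> (m j \<triangleleft>\<^bsub>M\<^esub> ?L j k))"
      by (rule abelian_group_hom.hom_finsum[OF s.lact_hom[OF a]])
        (auto simp: s.finite_index intro!: s.ract_closed s.basis_closed)
    also have "\<phi> i \<dots> = (\<Oplus>\<^bsub>B\<^esub>j\<in>I. \<phi> i (a \<odot>\<^bsub>M\<^esub> (m j \<triangleleft>\<^bsub>M\<^esub> ?L j k)))"
      by (rule s.coord_finsum) (use that a in \<open>auto simp: s.finite_index intro!: s.ract_closed s.basis_closed s.lact_closed\<close>)
    also have "\<dots> = (\<Oplus>\<^bsub>B\<^esub>j\<in>I. ?X a i j \<otimes>\<^bsub>B\<^esub> ?L j k)"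
      by (rule s.B.finsum_cong')
        (use that a in \<open>auto simp: s.act_commute[symmetric] s.basis_closed s.coord_ract s.lact_closed\<close>)
    finally show ?thesis .
  qed
  have ba: "?X b j i = (\<Oplus>\<^bsub>B\<^esub>k\<in>I. ?L j k \<otimes>\<^bsub>B\<^esub> ?X \<one>\<^bsub>A\<^esub> k i)" if "j \<in> I" "i \<in> I" for j i
    using coord[OF b that(1) s.basis_closed[OF that(2)]] that
    by (simp add: s.lact_one s.basis_closed cong: s.B.finsum_cong)
  have aX: "?X a k j = (\<Oplus>\<^bsub>B\<^esub>i\<in>I. ?X \<one>\<^bsub>A\<^esub> k i \<otimes>\<^bsub>B\<^esub> ?X a i j)" if "k \<in> I" "j \<in> I" for k j
    using coordinates_mult[OF s s that(1) s.basis_closed[OF that(2)] one a] a by (simp only: s.A.l_one)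
  have cl: "?X c i j \<in> carrier B" if "i \<in> I" "j \<in> I" "c \<in> carrier A" for c i j
    using that by (simp add: s.lact_closed s.basis_closed)
  have lc: "?L i j \<in> carrier B" for i j by simp
  have "trace_pairing f I I (?X (a \<otimes>\<^bsub>A\<^esub> b)) (?X \<one>\<^bsub>A\<^esub>) - trace_pairing f I I (?X a) (?X b)
      + trace_pairing f I I (?X a) ?L = 0"
    by (rule trace_pairing_cocycle) (assumption | rule s.finite_index cl lc ab ba aX a b one s.A.m_closed)+
  moreover have "trace_pairing f I I (?X (a \<otimes>\<^bsub>A\<^esub> b)) (?X \<one>\<^bsub>A\<^esub>) = 0"
    using hochschild_cocycle.cocycle_one[OF trace_transfer_cocycle[OF f s], of "a \<otimes>\<^bsub>A\<^esub> b"] a b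
    by (simp add: mixed_trace_def)
  moreover have "trace_pairing f I I (?X a) ?L = 0"
    unfolding trace_pairing_def
  proof (intro sum.neutral ballI)
    fix i j assume ij: "i \<in> I" "j \<in> I"
    have x: "?X a i j \<in> carrier B" using ij a by (simp add: s.lact_closed s.basis_closed)
    show "f (?X a i j) (?L j i) = 0"
      using linear_right[OF x] cocycle_one[OF x] by (simp add: linear_form_def)
  qed
  ultimately show ?thesis by (simp add: mixed_trace_def)
qed

section \<open>Direct sums, copies and one-sided parts of bimodules\<close>

lemma ground_field_simps [simp]:
  "carrier ground_field = UNIV" "monoid.mult ground_field = (*)" "one ground_field = 1"
  "ring.zero ground_field = 0" "add ground_field = (+)" "module.smult ground_field = (*)"
  by (simp_all add: ground_field_def ring_of_type_algebra_def ring.defs module.defs)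

lemma k_algebra_ground_field: "k_algebra (ground_field :: ('k::field, 'k) module)"
proof -
  have ab: "abelian_group (ground_field :: ('k, 'k) module)"
    by (rule abelian_groupI) (auto simp: algebra_simps intro: exI[of _ "- x" for x])
  have "ring (ground_field :: ('k, 'k) module)"
    by (rule ringI[OF ab]) (auto simp: algebra_simps intro!: monoid.intro)
  moreover have "module (ring_of_type_algebra :: 'k ring) (ground_field :: ('k, 'k) module)"
    by (rule moduleI[OF cring_from_type_algebra ab])
      (auto simp: ring_of_type_algebra_def algebra_simps)
  ultimately show ?thesis
    by (intro k_algebra.intro k_algebra_axioms.intro) (auto simp: algebra_simps)
qed

lemma abelian_group_transfer_record:
  assumes "abelian_group G" and "carrier H = carrier G" "ring.zero H = ring.zero G" "add H = add G"
  shows "abelian_group H"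
  by (rule abelian_groupI) (use abelian_groupE[OF assms(1)] in \<open>auto simp: assms(2-4)\<close>)

lemma (in k_algebra) bimodule_regular: "bimodule A A (regular_bimodule A)"
proof -
  have "abelian_group (regular_bimodule A)"
    by (rule abelian_group_transfer_record[OF is_abelian_group]) (simp_all add: regular_bimodule_def)
  then show ?thesis
    by (intro bimodule.intro bimodule_axioms.intro k_algebra_axioms)
      (auto simp: regular_bimodule_def l_distr r_distr m_assoc smult_mult_left smult_mult_right)
qed

lemma (in bimodule) bimodule_left_part: "bimodule A ground_field (left_part A M)"
proof -
  have ab: "abelian_group (left_part A M)"
    by (rule abelian_group_transfer_record[OF M.abelian_group_axioms]) (simp_all add: left_part_def)
  have add: "((c + d) \<odot>\<^bsub>A\<^esub> \<one>\<^bsub>A\<^esub>) = (c \<odot>\<^bsub>A\<^esub> \<one>\<^bsub>A\<^esub>) \<oplus>\<^bsub>A\<^esub> (d \<odot>\<^bsub>A\<^esub> \<one>\<^bsub>A\<^esub>)"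
    and mult: "((c * d) \<odot>\<^bsub>A\<^esub> \<one>\<^bsub>A\<^esub>) = (c \<odot>\<^bsub>A\<^esub> \<one>\<^bsub>A\<^esub>) \<otimes>\<^bsub>A\<^esub> (d \<odot>\<^bsub>A\<^esub> \<one>\<^bsub>A\<^esub>)"
    and one: "(1 \<odot>\<^bsub>A\<^esub> \<one>\<^bsub>A\<^esub>) = \<one>\<^bsub>A\<^esub>" for c d
    using A.smult_l_distr[of c d "\<one>\<^bsub>A\<^esub>"] A.smult_assoc1[of c d "\<one>\<^bsub>A\<^esub>"] A.smult_one[of "\<one>\<^bsub>A\<^esub>"]
    by (simp_all add: ring_of_type_algebra_def A.smult_mult_left)
  have comm: "(c \<odot>\<^bsub>A\<^esub> \<one>\<^bsub>A\<^esub>) \<otimes>\<^bsub>A\<^esub> a = a \<otimes>\<^bsub>A\<^esub> (c \<odot>\<^bsub>A\<^esub> \<one>\<^bsub>A\<^esub>)" if "a \<in> carrier A" for c a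
    using that by (simp add: A.smult_mult_left A.smult_mult_right)
  show ?thesis
  proof (intro bimodule.intro bimodule_axioms.intro k_algebra_ground_field A.k_algebra_axioms ab)
    fix m b b' assume "m \<in> carrier (left_part A M)"
    then have m: "m \<in> carrier M" by (simp add: left_part_def)
    have "(b * b') \<odot>\<^bsub>A\<^esub> \<one>\<^bsub>A\<^esub> = (b' \<odot>\<^bsub>A\<^esub> \<one>\<^bsub>A\<^esub>) \<otimes>\<^bsub>A\<^esub> (b \<odot>\<^bsub>A\<^esub> \<one>\<^bsub>A\<^esub>)"
      unfolding mult by (rule comm) simp
    then show "m \<triangleleft>\<^bsub>left_part A M\<^esub> (b \<otimes>\<^bsub>ground_field\<^esub> b') = (m \<triangleleft>\<^bsub>left_part A M\<^esub> b) \<triangleleft>\<^bsub>left_part A M\<^esub> b'"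
      using m by (simp add: left_part_def lact_assoc)
  next
    fix a m b assume "a \<in> carrier A" "m \<in> carrier (left_part A M)"
    then show "(a \<odot>\<^bsub>left_part A M\<^esub> m) \<triangleleft>\<^bsub>left_part A M\<^esub> b = a \<odot>\<^bsub>left_part A M\<^esub> (m \<triangleleft>\<^bsub>left_part A M\<^esub> b)"
      using comm[of a b] by (simp add: left_part_def lact_assoc[symmetric])
  qed (auto simp: left_part_def lact_closed lact_add_left lact_add_right lact_assoc lact_one add one)
qed

lemma (in bimodule) bimodule_right_part: "bimodule ground_field B (right_part B M)"
proof -
  have ab: "abelian_group (right_part B M)"
    by (rule abelian_group_transfer_record[OF M.abelian_group_axioms]) (simp_all add: right_part_def)
  have add: "((c + d) \<odot>\<^bsub>B\<^esub> \<one>\<^bsub>B\<^esub>) = (c \<odot>\<^bsub>B\<^esub> \<one>\<^bsub>B\<^esub>) \<oplus>\<^bsub>B\<^esub> (d \<odot>\<^bsub>B\<^esub> \<one>\<^bsub>B\<^esub>)"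
    and mult: "((c * d) \<odot>\<^bsub>B\<^esub> \<one>\<^bsub>B\<^esub>) = (c \<odot>\<^bsub>B\<^esub> \<one>\<^bsub>B\<^esub>) \<otimes>\<^bsub>B\<^esub> (d \<odot>\<^bsub>B\<^esub> \<one>\<^bsub>B\<^esub>)"
    and one: "(1 \<odot>\<^bsub>B\<^esub> \<one>\<^bsub>B\<^esub>) = \<one>\<^bsub>B\<^esub>" for c d
    using B.smult_l_distr[of c d "\<one>\<^bsub>B\<^esub>"] B.smult_assoc1[of c d "\<one>\<^bsub>B\<^esub>"] B.smult_one[of "\<one>\<^bsub>B\<^esub>"]
    by (simp_all add: ring_of_type_algebra_def B.smult_mult_left)
  have comm: "(c \<odot>\<^bsub>B\<^esub> \<one>\<^bsub>B\<^esub>) \<otimes>\<^bsub>B\<^esub> a = a \<otimes>\<^bsub>B\<^esub> (c \<odot>\<^bsub>B\<^esub> \<one>\<^bsub>B\<^esub>)" if "a \<in> carrier B" for c a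
    using that by (simp add: B.smult_mult_left B.smult_mult_right)
  show ?thesis
  proof (intro bimodule.intro bimodule_axioms.intro k_algebra_ground_field B.k_algebra_axioms ab)
    fix m a a' assume "m \<in> carrier (right_part B M)"
    then have m: "m \<in> carrier M" by (simp add: right_part_def)
    have "(a * a') \<odot>\<^bsub>B\<^esub> \<one>\<^bsub>B\<^esub> = (a' \<odot>\<^bsub>B\<^esub> \<one>\<^bsub>B\<^esub>) \<otimes>\<^bsub>B\<^esub> (a \<odot>\<^bsub>B\<^esub> \<one>\<^bsub>B\<^esub>)"
      unfolding mult by (rule comm) simp
    then show "(a \<otimes>\<^bsub>ground_field\<^esub> a') \<odot>\<^bsub>right_part B M\<^esub> m = a \<odot>\<^bsub>right_part B M\<^esub> (a' \<odot>\<^bsub>right_part B M\<^esub> m)"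
      using m by (simp add: right_part_def ract_assoc)
  next
    fix a m b assume "b \<in> carrier B" "m \<in> carrier (right_part B M)"
    then show "(a \<odot>\<^bsub>right_part B M\<^esub> m) \<triangleleft>\<^bsub>right_part B M\<^esub> b = a \<odot>\<^bsub>right_part B M\<^esub> (m \<triangleleft>\<^bsub>right_part B M\<^esub> b)"
      using comm[of b a] by (simp add: right_part_def ract_assoc[symmetric])
  qed (auto simp: right_part_def ract_closed ract_add_left ract_add_right ract_assoc ract_one add one)
qed

lemma bimodule_direct_sum:
  assumes "bimodule A B M" "bimodule A B N"
  shows "bimodule A B (direct_sum M N)"
proof -
  interpret M: bimodule A B M by fact
  interpret N: bimodule A B N by fact
  have "abelian_group (direct_sum M N)"
  proof (rule abelian_groupI, goal_cases)
    case (6 x)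
    then show ?case
      by (intro bexI[of _ "(\<ominus>\<^bsub>M\<^esub> fst x, \<ominus>\<^bsub>N\<^esub> snd x)"]) (auto simp: direct_sum_def M.M.l_neg N.M.l_neg)
  qed (auto simp: direct_sum_def M.M.a_ac N.M.a_ac)
  then show ?thesis
    by (intro bimodule.intro bimodule_axioms.intro M.A.k_algebra_axioms M.B.k_algebra_axioms)
      (auto simp: direct_sum_def M.lact_closed M.lact_add_left M.lact_add_right M.lact_assoc M.lact_one
        M.ract_closed M.ract_add_right M.ract_add_left M.ract_assoc M.ract_one M.act_commute M.scalars_central
        N.lact_closed N.lact_add_left N.lact_add_right N.lact_assoc N.lact_one
        N.ract_closed N.ract_add_right N.ract_add_left N.ract_assoc N.ract_one N.act_commute N.scalars_central)
qed

lemma (in bimodule) lact_zero [simp]: "a \<in> carrier A \<Longrightarrow> a \<odot>\<^bsub>M\<^esub> \<zero>\<^bsub>M\<^esub> = \<zero>\<^bsub>M\<^esub>"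
  using abelian_group_hom.hom_zero[OF lact_hom] .

lemma (in bimodule) ract_zero [simp]: "b \<in> carrier B \<Longrightarrow> \<zero>\<^bsub>M\<^esub> \<triangleleft>\<^bsub>M\<^esub> b = \<zero>\<^bsub>M\<^esub>"
  using abelian_group_hom.hom_zero[OF ract_hom] .

lemma carrier_copies: "f \<in> carrier (copies I U) \<longleftrightarrow>
    (\<forall>i. f i \<in> carrier U) \<and> (\<forall>i. i \<notin> I \<longrightarrow> f i = \<zero>\<^bsub>U\<^esub>) \<and> finite {i. f i \<noteq> \<zero>\<^bsub>U\<^esub>}"
  by (simp add: copies_def)

lemma copies_simps [simp]:
  "ring.zero (copies I U) = (\<lambda>_. \<zero>\<^bsub>U\<^esub>)"
  "add (copies I U) = (\<lambda>f g i. f i \<oplus>\<^bsub>U\<^esub> g i)"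
  "module.smult (copies I U) = (\<lambda>a f i. a \<odot>\<^bsub>U\<^esub> f i)"
  "ract (copies I U) = (\<lambda>f b i. f i \<triangleleft>\<^bsub>U\<^esub> b)"
  by (simp_all add: copies_def)

lemma (in bimodule) bimodule_copies: "bimodule A B (copies I M)"
proof -
  have at: "f i \<in> carrier M" if "f \<in> carrier (copies I M)" for f i
    using that by (simp add: carrier_copies)
  have add: "(\<lambda>i. f i \<oplus>\<^bsub>M\<^esub> g i) \<in> carrier (copies I M)"
    if f: "f \<in> carrier (copies I M)" and g: "g \<in> carrier (copies I M)" for f g
  proof -
    have "{i. f i \<oplus>\<^bsub>M\<^esub> g i \<noteq> \<zero>\<^bsub>M\<^esub>} \<subseteq> {i. f i \<noteq> \<zero>\<^bsub>M\<^esub>} \<union> {i. g i \<noteq> \<zero>\<^bsub>M\<^esub>}" by auto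
    moreover have "finite ({i. f i \<noteq> \<zero>\<^bsub>M\<^esub>} \<union> {i. g i \<noteq> \<zero>\<^bsub>M\<^esub>})"
      using f g by (simp add: carrier_copies)
    ultimately have "finite {i. f i \<oplus>\<^bsub>M\<^esub> g i \<noteq> \<zero>\<^bsub>M\<^esub>}" by (rule finite_subset)
    then show ?thesis using f g by (simp add: carrier_copies)
  qed
  have op: "(\<lambda>i. h (f i)) \<in> carrier (copies I M)"
    if f: "f \<in> carrier (copies I M)" and h: "h \<zero>\<^bsub>M\<^esub> = \<zero>\<^bsub>M\<^esub>" "\<And>m. m \<in> carrier M \<Longrightarrow> h m \<in> carrier M" for f h
  proof -
    have "{i. h (f i) \<noteq> \<zero>\<^bsub>M\<^esub>} \<subseteq> {i. f i \<noteq> \<zero>\<^bsub>M\<^esub>}" using h(1) by auto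
    then have "finite {i. h (f i) \<noteq> \<zero>\<^bsub>M\<^esub>}" by (rule finite_subset) (use f in \<open>simp add: carrier_copies\<close>)
    then show ?thesis using f h by (simp add: carrier_copies)
  qed
  have ab: "abelian_group (copies I M)"
  proof (rule abelian_groupI, goal_cases)
    case (6 f)
    then show ?case
      by (intro bexI[of _ "\<lambda>i. \<ominus>\<^bsub>M\<^esub> f i"]) (auto simp: M.l_neg at intro!: op[of f "\<lambda>m. \<ominus>\<^bsub>M\<^esub> m"])
  next
    case (1 f g) then show ?case using add by simp
  next
    case 2 then show ?case by (simp add: carrier_copies)
  next
    case (3 f g h) then show ?case by (simp add: at M.a_assoc)
  next
    case (4 f g) then show ?case by (simp add: fun_eq_iff at M.a_comm)
  next
    case (5 f) then show ?case by (simp add: at)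
  qed
  show ?thesis
  proof (intro bimodule.intro bimodule_axioms.intro A.k_algebra_axioms B.k_algebra_axioms ab, goal_cases)
    case (1 a f) then show ?case using op[of f "\<lambda>m. a \<odot>\<^bsub>M\<^esub> m"] by (simp add: lact_closed)
  next
    case (6 f b) then show ?case using op[of f "\<lambda>m. m \<triangleleft>\<^bsub>M\<^esub> b"] by (simp add: ract_closed)
  qed (simp_all add: at lact_add_left lact_add_right lact_assoc lact_one
        ract_add_right ract_add_left ract_assoc ract_one act_commute scalars_central)
qed

definition bimodule_hom ::
  "('k, 'a) module \<Rightarrow> ('k, 'b) module \<Rightarrow> ('a, 'b, 'm) bimodule \<Rightarrow> ('a, 'b, 'n) bimodule \<Rightarrow> ('m \<Rightarrow> 'n) \<Rightarrow> bool"
  where "bimodule_hom A B M N h \<longleftrightarrow> abelian_group_hom M N h \<and>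
     (\<forall>a\<in>carrier A. \<forall>m\<in>carrier M. h (a \<odot>\<^bsub>M\<^esub> m) = a \<odot>\<^bsub>N\<^esub> h m) \<and>
     (\<forall>m\<in>carrier M. \<forall>b\<in>carrier B. h (m \<triangleleft>\<^bsub>M\<^esub> b) = h m \<triangleleft>\<^bsub>N\<^esub> b)"

lemma bimodule_hom_comp:
  assumes "bimodule_hom A B M N h" "bimodule_hom A B N L h'"
  shows "bimodule_hom A B M L (\<lambda>m. h' (h m))"
proof -
  interpret h: abelian_group_hom M N h using assms(1) by (simp add: bimodule_hom_def)
  interpret h': abelian_group_hom N L h' using assms(2) by (simp add: bimodule_hom_def)
  have "abelian_group_hom M L (\<lambda>m. h' (h m))"
    by (rule abelian_group_homI') (auto simp: h.G.abelian_group_axioms h'.H.abelian_group_axioms)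
  then show ?thesis using assms by (simp add: bimodule_hom_def)
qed

lemma bimodule_iso_inverse:
  assumes "bimodule A B M" "bimodule A B N" "bimodule_iso A B M N"
  obtains f g where "bimodule_hom A B M N f" "bimodule_hom A B N M g"
    "\<And>m. m \<in> carrier M \<Longrightarrow> g (f m) = m" "\<And>n. n \<in> carrier N \<Longrightarrow> f (g n) = n"
proof -
  interpret M: bimodule A B M by fact
  interpret N: bimodule A B N by fact
  obtain f where f: "bij_betw f (carrier M) (carrier N)"
     "\<And>m m'. m\<in>carrier M \<Longrightarrow> m'\<in>carrier M \<Longrightarrow> f (m \<oplus>\<^bsub>M\<^esub> m') = f m \<oplus>\<^bsub>N\<^esub> f m'"
     "\<And>a m. a\<in>carrier A \<Longrightarrow> m\<in>carrier M \<Longrightarrow> f (a \<odot>\<^bsub>M\<^esub> m) = a \<odot>\<^bsub>N\<^esub> f m"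
     "\<And>m b. m\<in>carrier M \<Longrightarrow> b\<in>carrier B \<Longrightarrow> f (m \<triangleleft>\<^bsub>M\<^esub> b) = f m \<triangleleft>\<^bsub>N\<^esub> b"
    using assms(3) unfolding bimodule_iso_def by blast
  define g where "g = inv_into (carrier M) f"
  have gf: "g (f m) = m" if "m \<in> carrier M" for m
    using f(1) that by (simp add: g_def bij_betw_inv_into_left)
  have fg: "f (g n) = n" if "n \<in> carrier N" for n
    using f(1) that by (simp add: g_def bij_betw_inv_into_right)
  have fc: "f m \<in> carrier N" if "m \<in> carrier M" for m using f(1) that by (auto simp: bij_betw_def)
  have gc: "g n \<in> carrier M" if "n \<in> carrier N" for n
    using bij_betw_inv_into[OF f(1)] that by (auto simp: g_def bij_betw_def)
  have "bimodule_hom A B M N f" unfolding bimodule_hom_def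
    by (intro conjI ballI abelian_group_homI' M.M.abelian_group_axioms N.M.abelian_group_axioms)
      (simp_all add: f fc)
  moreover have "bimodule_hom A B N M g" unfolding bimodule_hom_def
  proof (intro conjI ballI abelian_group_homI' M.M.abelian_group_axioms N.M.abelian_group_axioms)
    fix x y assume "x \<in> carrier N" "y \<in> carrier N"
    then show "g (x \<oplus>\<^bsub>N\<^esub> y) = g x \<oplus>\<^bsub>M\<^esub> g y"
      using gf[of "g x \<oplus>\<^bsub>M\<^esub> g y"] by (simp add: f gc fg)
  next
    fix a x assume "a \<in> carrier A" "x \<in> carrier N"
    then show "g (a \<odot>\<^bsub>N\<^esub> x) = a \<odot>\<^bsub>M\<^esub> g x"
      using gf[of "a \<odot>\<^bsub>M\<^esub> g x"] by (simp add: f gc fg M.lact_closed)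
  next
    fix b x assume "x \<in> carrier N" "b \<in> carrier B"
    then show "g (x \<triangleleft>\<^bsub>N\<^esub> b) = g x \<triangleleft>\<^bsub>M\<^esub> b"
      using gf[of "g x \<triangleleft>\<^bsub>M\<^esub> b"] by (simp add: f gc fg M.ract_closed)
  qed (rule gc)
  ultimately show thesis using that gf fg by blast
qed

text \<open>
  A finitely generated summand of a possibly infinite direct sum of copies of \<open>U\<close> is already a summand of
  finitely many copies, since the images of the generators have finite support. The complement is
  discarded: only the inclusions \<open>\<iota> j\<close> and projections \<open>\<pi> j\<close> are kept.
\<close>

lemma finite_retraction:
  fixes P :: "('a, 'b, 'm) bimodule" and U :: "('a, 'b, 'u) bimodule"
  assumes P: "bimodule A B P" and U: "bimodule A B U"
    and sum: "summand_of_copies A B U P"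
    and S: "finite S" "S \<subseteq> carrier P" "\<And>W. subbimodule A B W P \<Longrightarrow> S \<subseteq> W \<Longrightarrow> W = carrier P"
  obtains J :: "'m set" and \<iota> :: "'m \<Rightarrow> 'm \<Rightarrow> 'u" and \<pi> :: "'m \<Rightarrow> 'u \<Rightarrow> 'm"
  where "finite J" "\<And>j. j \<in> J \<Longrightarrow> bimodule_hom A B P U (\<iota> j)" "\<And>j. j \<in> J \<Longrightarrow> bimodule_hom A B U P (\<pi> j)"
    "\<And>p. p \<in> carrier P \<Longrightarrow> p = (\<Oplus>\<^bsub>P\<^esub>j\<in>J. \<pi> j (\<iota> j p))"
proof -
  interpret P: bimodule A B P by (rule P)
  interpret U: bimodule A B U by (rule U)
  obtain I :: "'m set" and Q :: "('a, 'b, 'm \<Rightarrow> 'u) bimodule"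
    where Q: "bimodule A B Q" and iso: "bimodule_iso A B (direct_sum P Q) (copies I U)"
    using sum unfolding summand_of_copies_def by blast
  interpret Q: bimodule A B Q by (rule Q)
  have D: "bimodule A B (direct_sum P Q)" by (rule bimodule_direct_sum[OF P Q])
  interpret D: bimodule A B "direct_sum P Q" by (rule D)
  interpret C: bimodule A B "copies I U" by (rule U.bimodule_copies)
  obtain \<theta> g where \<theta>: "bimodule_hom A B (direct_sum P Q) (copies I U) \<theta>"
    and g: "bimodule_hom A B (copies I U) (direct_sum P Q) g"
    and g\<theta>: "\<And>m. m \<in> carrier (direct_sum P Q) \<Longrightarrow> g (\<theta> m) = m"
    and "\<And>c. c \<in> carrier (copies I U) \<Longrightarrow> \<theta> (g c) = c"
    by (rule bimodule_iso_inverse[OF D U.bimodule_copies iso], rule that)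
  have "bimodule_hom A B P (direct_sum P Q) (\<lambda>p. (p, \<zero>\<^bsub>Q\<^esub>))"
    unfolding bimodule_hom_def
    by (intro conjI ballI abelian_group_homI' P.M.abelian_group_axioms D.M.abelian_group_axioms)
      (auto simp: direct_sum_def)
  then have \<theta>': "bimodule_hom A B P (copies I U) (\<lambda>p. \<theta> (p, \<zero>\<^bsub>Q\<^esub>))"
    by (rule bimodule_hom_comp[OF _ \<theta>])
  have "bimodule_hom A B (direct_sum P Q) P fst"
    unfolding bimodule_hom_def
    by (intro conjI ballI abelian_group_homI' P.M.abelian_group_axioms D.M.abelian_group_axioms)
      (auto simp: direct_sum_def)
  then have g': "bimodule_hom A B (copies I U) P (\<lambda>c. fst (g c))"
    by (rule bimodule_hom_comp[OF g])
  define \<delta> :: "'m \<Rightarrow> 'u \<Rightarrow> 'm \<Rightarrow> 'u" where "\<delta> j u = (\<lambda>i. if i = j then u else \<zero>\<^bsub>U\<^esub>)" for j u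
  have \<delta>c: "\<delta> j u \<in> carrier (copies I U)" if "j \<in> I" "u \<in> carrier U" for j u
    using that by (auto simp: carrier_copies \<delta>_def)
  have \<delta>: "bimodule_hom A B U (copies I U) (\<delta> j)" if "j \<in> I" for j
    unfolding bimodule_hom_def
    by (intro conjI ballI abelian_group_homI' U.M.abelian_group_axioms C.M.abelian_group_axioms \<delta>c that)
      (auto simp: \<delta>_def fun_eq_iff)
  have ev: "bimodule_hom A B (copies I U) U (\<lambda>f. f j)" for j
    unfolding bimodule_hom_def
    by (intro conjI ballI abelian_group_homI' U.M.abelian_group_axioms C.M.abelian_group_axioms)
      (auto simp: carrier_copies)
  define \<iota> where "\<iota> j p = \<theta> (p, \<zero>\<^bsub>Q\<^esub>) j" for j p
  define \<pi> where "\<pi> j u = fst (g (\<delta> j u))" for j u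
  have \<iota>: "bimodule_hom A B P U (\<iota> j)" for j
    unfolding \<iota>_def by (rule bimodule_hom_comp[OF \<theta>' ev])
  have \<pi>: "bimodule_hom A B U P (\<pi> j)" if "j \<in> I" for j
    unfolding \<pi>_def by (rule bimodule_hom_comp[OF \<delta>[OF that] g'])
  have \<theta>c: "\<theta> (p, \<zero>\<^bsub>Q\<^esub>) \<in> carrier (copies I U)" if "p \<in> carrier P" for p
    using \<theta>' that abelian_group_hom.hom_closed unfolding bimodule_hom_def by metis
  \<comment> \<open>The elements supported on \<open>J\<close> form a subbimodule \<open>W\<close> that contains the generators, hence all of \<open>P\<close>.\<close>
  define J where "J = (\<Union>s\<in>S. {i. \<iota> i s \<noteq> \<zero>\<^bsub>U\<^esub>})"
  have "finite {i. \<iota> i s \<noteq> \<zero>\<^bsub>U\<^esub>}" "{i. \<iota> i s \<noteq> \<zero>\<^bsub>U\<^esub>} \<subseteq> I" if "s \<in> S" for s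
    using \<theta>c[of s] that S(2) unfolding carrier_copies \<iota>_def by blast+
  then have J: "finite J" "J \<subseteq> I" using S(1) by (auto simp: J_def)
  define W where "W = {p \<in> carrier P. \<forall>i. i \<notin> J \<longrightarrow> \<iota> i p = \<zero>\<^bsub>U\<^esub>}"
  have \<iota>h: "abelian_group_hom P U (\<iota> j)" for j using \<iota> by (simp add: bimodule_hom_def)
  have "subbimodule A B W P"
    unfolding subbimodule_def
  proof (intro conjI ballI)
    have "subgroup W (add_monoid P)"
    proof (rule group.subgroupI[OF P.M.a_group])
      show "W \<noteq> {}" using abelian_group_hom.hom_zero[OF \<iota>h] by (auto simp: W_def)
    next
      fix a assume "a \<in> W"
      then show "inv\<^bsub>add_monoid P\<^esub> a \<in> W"
        using abelian_group_hom.hom_a_inv[OF \<iota>h] by (simp add: W_def a_inv_def[symmetric])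
    qed (use abelian_group_hom.hom_add[OF \<iota>h] in \<open>auto simp: W_def\<close>)
    then show "additive_subgroup W P" by (rule additive_subgroupI)
  qed (use \<iota> in \<open>auto simp: W_def bimodule_hom_def P.lact_closed P.ract_closed\<close>)
  moreover have "S \<subseteq> W" using S(2) by (auto simp: W_def J_def)
  ultimately have W: "W = carrier P" by (rule S(3))
  have "p = (\<Oplus>\<^bsub>P\<^esub>j\<in>J. \<pi> j (\<iota> j p))" if p: "p \<in> carrier P" for p
  proof -
    have \<iota>c: "\<iota> j p \<in> carrier U" for j using abelian_group_hom.hom_closed[OF \<iota>h p] .
    have dc: "\<delta> j (\<iota> j p) \<in> carrier (copies I U)" if "j \<in> J" for j using \<delta>c that J(2) \<iota>c by blast
    have "\<theta> (p, \<zero>\<^bsub>Q\<^esub>) = (\<Oplus>\<^bsub>copies I U\<^esub>j\<in>J. \<delta> j (\<iota> j p))"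
    proof
      fix i
      have "(\<Oplus>\<^bsub>copies I U\<^esub>j\<in>J. \<delta> j (\<iota> j p)) i = (\<Oplus>\<^bsub>U\<^esub>j\<in>J. \<delta> j (\<iota> j p) i)"
        by (rule abelian_group_hom.hom_finsum[where h = "\<lambda>f. f i"])
          (use ev J dc in \<open>auto simp: bimodule_hom_def\<close>)
      also have "\<dots> = (\<Oplus>\<^bsub>U\<^esub>j\<in>J. if i = j then \<iota> j p else \<zero>\<^bsub>U\<^esub>)"
        by (rule U.M.finsum_cong') (auto simp: \<delta>_def \<iota>c)
      also have "\<dots> = \<iota> i p"
      proof (cases "i \<in> J")
        case True
        then show ?thesis by (rule U.M.finsum_singleton) (use J \<iota>c in auto)
      next
        case False
        then have "(\<Oplus>\<^bsub>U\<^esub>j\<in>J. if i = j then \<iota> j p else \<zero>\<^bsub>U\<^esub>) = (\<Oplus>\<^bsub>U\<^esub>j\<in>J. \<zero>\<^bsub>U\<^esub>)"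
          by (intro U.M.finsum_cong') auto
        moreover have "\<iota> i p = \<zero>\<^bsub>U\<^esub>" using W p False by (auto simp: W_def)
        ultimately show ?thesis by (simp add: U.M.finsum_zero)
      qed
      finally show "\<theta> (p, \<zero>\<^bsub>Q\<^esub>) i = (\<Oplus>\<^bsub>copies I U\<^esub>j\<in>J. \<delta> j (\<iota> j p)) i"
        by (simp add: \<iota>_def)
    qed
    then have "fst (g (\<theta> (p, \<zero>\<^bsub>Q\<^esub>))) = (\<Oplus>\<^bsub>P\<^esub>j\<in>J. fst (g (\<delta> j (\<iota> j p))))"
      using abelian_group_hom.hom_finsum[where h = "\<lambda>c. fst (g c)" and G = "copies I U" and H = P, OF _ J(1) dc] g'
      by (simp add: bimodule_hom_def)
    moreover have "g (\<theta> (p, \<zero>\<^bsub>Q\<^esub>)) = (p, \<zero>\<^bsub>Q\<^esub>)" by (rule g\<theta>) (use p in \<open>simp add: direct_sum_def\<close>)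
    ultimately show ?thesis by (simp add: \<pi>_def)
  qed
  then show thesis using that[of J \<iota> \<pi>] J \<iota> \<pi> by blast
qed

section \<open>Tensor products of bimodules\<close>

locale bimodule_pair = left: bimodule A B M + right: bimodule B C N
  for A :: "('k::field, 'a) module" and B :: "('k, 'b) module" and C :: "('k, 'c) module"
    and M :: "('a, 'b, 'm) bimodule" and N :: "('b, 'c, 'n) bimodule"
begin

abbreviation pairs :: "('m \<times> 'n) set" where "pairs \<equiv> carrier M \<times> carrier N"
abbreviation frags :: "('m \<times> 'n \<Rightarrow>\<^sub>0 int) monoid" where "frags \<equiv> free_Abelian_group pairs"
abbreviation relators :: "('m \<times> 'n \<Rightarrow>\<^sub>0 int) set" where "relators \<equiv> generate frags (tensor_relations B M N)"
abbreviation T :: "('a, 'c, ('m \<times> 'n \<Rightarrow>\<^sub>0 int) set) bimodule" where "T \<equiv> tensor B M N"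

definition pure :: "'m \<Rightarrow> 'n \<Rightarrow> ('m \<times> 'n \<Rightarrow>\<^sub>0 int) set" where
  "pure m n = relators #>\<^bsub>frags\<^esub> frag_of (m, n)"

lemma frags_add: "p \<in> carrier frags \<Longrightarrow> q \<in> carrier frags \<Longrightarrow> p + q \<in> carrier frags"
  using keys_add[of p q] by auto

lemma frags_diff: "p \<in> carrier frags \<Longrightarrow> q \<in> carrier frags \<Longrightarrow> p - q \<in> carrier frags"
  using keys_diff[of p q] by auto

lemma tensor_relators:
  "m \<in> carrier M \<Longrightarrow> m' \<in> carrier M \<Longrightarrow> n \<in> carrier N \<Longrightarrow>
    frag_of (m \<oplus>\<^bsub>M\<^esub> m', n) - frag_of (m, n) - frag_of (m', n) \<in> tensor_relations B M N"
  "m \<in> carrier M \<Longrightarrow> n \<in> carrier N \<Longrightarrow> n' \<in> carrier N \<Longrightarrow>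
    frag_of (m, n \<oplus>\<^bsub>N\<^esub> n') - frag_of (m, n) - frag_of (m, n') \<in> tensor_relations B M N"
  "m \<in> carrier M \<Longrightarrow> b \<in> carrier B \<Longrightarrow> n \<in> carrier N \<Longrightarrow>
    frag_of (m \<triangleleft>\<^bsub>M\<^esub> b, n) - frag_of (m, b \<odot>\<^bsub>N\<^esub> n) \<in> tensor_relations B M N"
  unfolding tensor_relations_def by blast+

lemma tensor_relators_cases [consumes 1]:
  assumes "r \<in> tensor_relations B M N"
  obtains m m' n where "r = frag_of (m \<oplus>\<^bsub>M\<^esub> m', n) - frag_of (m, n) - frag_of (m', n)"
      "m \<in> carrier M" "m' \<in> carrier M" "n \<in> carrier N"
    | m n n' where "r = frag_of (m, n \<oplus>\<^bsub>N\<^esub> n') - frag_of (m, n) - frag_of (m, n')"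
      "m \<in> carrier M" "n \<in> carrier N" "n' \<in> carrier N"
    | m b n where "r = frag_of (m \<triangleleft>\<^bsub>M\<^esub> b, n) - frag_of (m, b \<odot>\<^bsub>N\<^esub> n)"
      "m \<in> carrier M" "b \<in> carrier B" "n \<in> carrier N"
  using assms unfolding tensor_relations_def 
  by (elim UnE CollectE exE conjE)
    ((rule that(1); assumption) | (rule that(2); assumption) | (rule that(3); assumption))+

lemma tensor_relations_subset: "tensor_relations B M N \<subseteq> carrier frags"
proof
  have fr: "frag_of (m, n) \<in> carrier frags" if "m \<in> carrier M" "n \<in> carrier N" for m n
    using that by simp
  fix r assume "r \<in> tensor_relations B M N"
  then show "r \<in> carrier frags"
    unfolding tensor_relations_def
    by (elim UnE CollectE exE conjE; simp only:; intro frags_diff fr; simp add: left.ract_closed right.lact_closed)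
qed

lemma relators_normal: "relators \<lhd> frags"
  by (rule comm_group.subgroup_imp_normal[OF abelian_free_Abelian_group])
    (rule group.generate_is_subgroup[OF group_free_Abelian_group tensor_relations_subset])

lemma relators_carrier: "r \<in> relators \<Longrightarrow> r \<in> carrier frags"
  using normal_imp_subgroup[OF relators_normal] subgroup.subset by blast

lemma relators_add: "r \<in> relators \<Longrightarrow> s \<in> relators \<Longrightarrow> r + s \<in> relators"
  using generate.eng[of r frags _ s] by simp

lemma tensor_simps:
  "carrier T = (\<lambda>p. relators #>\<^bsub>frags\<^esub> p) ` carrier frags"
  "ring.zero T = relators"
  "add T = monoid.mult (frags Mod relators)"
  by (simp_all add: tensor_def Let_def carrier_FactGroup)

lemma abelian_group_tensor: "abelian_group T"
proof -
  have cg: "comm_group (frags Mod relators)"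
    by (rule comm_group.abelian_FactGroup[OF abelian_free_Abelian_group normal_imp_subgroup[OF relators_normal]])
  have T: "carrier T = carrier (frags Mod relators)" "add T = monoid.mult (frags Mod relators)"
    "ring.zero T = one (frags Mod relators)"
    by (simp_all only: tensor_def Let_def partial_object.simps monoid.simps ring.simps)
  show ?thesis
    by (rule abelian_groupI) (use comm_groupE[OF cg] in \<open>simp_all only: T\<close>)
qed

sublocale T: abelian_group T by (rule abelian_group_tensor)

lemma coset_closed: "p \<in> carrier frags \<Longrightarrow> relators #>\<^bsub>frags\<^esub> p \<in> carrier T"
  by (simp add: tensor_simps(1))

lemma coset_add:
  "p \<in> carrier frags \<Longrightarrow> q \<in> carrier frags \<Longrightarrow>
   (relators #>\<^bsub>frags\<^esub> p) \<oplus>\<^bsub>T\<^esub> (relators #>\<^bsub>frags\<^esub> q) = relators #>\<^bsub>frags\<^esub> (p + q)"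
  using normal.rcos_sum[OF relators_normal] by (simp add: tensor_simps(3))

lemma coset_relation:
  assumes "r \<in> relators" shows "relators #>\<^bsub>frags\<^esub> r = \<zero>\<^bsub>T\<^esub>"
  using group.coset_join2[OF group_free_Abelian_group relators_carrier[OF assms]
      normal_imp_subgroup[OF relators_normal] assms]
  by (simp add: tensor_simps(2))

lemma coset_eqI:
  assumes p: "p \<in> carrier frags" and q: "q \<in> carrier frags" and d: "p - q \<in> relators"
  shows "relators #>\<^bsub>frags\<^esub> p = relators #>\<^bsub>frags\<^esub> q"
proof -
  have "relators #>\<^bsub>frags\<^esub> p = (relators #>\<^bsub>frags\<^esub> (p - q)) \<oplus>\<^bsub>T\<^esub> (relators #>\<^bsub>frags\<^esub> q)"
    using coset_add[OF relators_carrier[OF d] q] by simp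
  then show ?thesis using coset_relation[OF d] coset_closed[OF q] by simp
qed

lemma coset_diff:
  assumes "p \<in> carrier frags" "q \<in> carrier frags"
  shows "relators #>\<^bsub>frags\<^esub> (p - q) = (relators #>\<^bsub>frags\<^esub> p) \<ominus>\<^bsub>T\<^esub> (relators #>\<^bsub>frags\<^esub> q)"
proof -
  have "(relators #>\<^bsub>frags\<^esub> (p - q)) \<oplus>\<^bsub>T\<^esub> (relators #>\<^bsub>frags\<^esub> q) = relators #>\<^bsub>frags\<^esub> p"
    using coset_add[OF frags_diff[OF assms] assms(2)] by simp
  moreover have minus: "x = y \<ominus>\<^bsub>T\<^esub> z" if "x \<in> carrier T" "z \<in> carrier T" "x \<oplus>\<^bsub>T\<^esub> z = y" for x y z
    unfolding that(3)[symmetric] a_minus_def using that(1,2) by (simp add: T.a_assoc T.r_neg)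
  ultimately show ?thesis using assms by (intro minus coset_closed frags_diff)
qed

lemma pure_closed: "m \<in> carrier M \<Longrightarrow> n \<in> carrier N \<Longrightarrow> pure m n \<in> carrier T"
  unfolding pure_def by (rule coset_closed) simp

lemma tensor_induct:
  assumes t: "t \<in> carrier T"
    and pure: "\<And>m n. m \<in> carrier M \<Longrightarrow> n \<in> carrier N \<Longrightarrow> P (pure m n)"
    and zero: "P \<zero>\<^bsub>T\<^esub>"
    and diff: "\<And>t t'. t \<in> carrier T \<Longrightarrow> t' \<in> carrier T \<Longrightarrow> P t \<Longrightarrow> P t' \<Longrightarrow> P (t \<ominus>\<^bsub>T\<^esub> t')"
  shows "P t"
proof -
  obtain p where p: "p \<in> carrier frags" "t = relators #>\<^bsub>frags\<^esub> p"
    using t by (auto simp only: tensor_simps(1))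
  have "Poly_Mapping.keys p \<subseteq> pairs" using p(1) by simp
  then have "P (relators #>\<^bsub>frags\<^esub> p)"
  proof (rule free_Abelian_group_induct)
    show "P (relators #>\<^bsub>frags\<^esub> 0)" using zero coset_relation[OF generate.one] by simp
  next
    fix x y assume xy: "Poly_Mapping.keys x \<subseteq> pairs" "Poly_Mapping.keys y \<subseteq> pairs"
      and P: "P (relators #>\<^bsub>frags\<^esub> x)" "P (relators #>\<^bsub>frags\<^esub> y)"
    then have c: "x \<in> carrier frags" "y \<in> carrier frags" by auto
    show "P (relators #>\<^bsub>frags\<^esub> (x - y))"
      unfolding coset_diff[OF c] by (rule diff[OF coset_closed[OF c(1)] coset_closed[OF c(2)] P])
  next
    fix a assume "a \<in> pairs"
    then show "P (relators #>\<^bsub>frags\<^esub> frag_of a)" using pure by (cases a) (auto simp: pure_def)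
  qed
  then show ?thesis using p(2) by simp
qed

text \<open>
  Pure tensors generate, so identities between additive maps, in particular the bimodule axioms,
  need only be checked on them.
\<close>

lemma hom_eqI:
  assumes h: "abelian_group_hom T G h" and h': "abelian_group_hom T G h'"
    and eq: "\<And>m n. m \<in> carrier M \<Longrightarrow> n \<in> carrier N \<Longrightarrow> h (pure m n) = h' (pure m n)"
    and t: "t \<in> carrier T"
  shows "h t = h' t"
proof -
  interpret h: abelian_group_hom T G h by (rule h)
  interpret h': abelian_group_hom T G h' by (rule h')
  show ?thesis
    by (rule tensor_induct[OF t, of "\<lambda>t. h t = h' t"]) (auto simp: eq a_minus_def)
qed

lemma
  assumes "m \<in> carrier M" "n \<in> carrier N"
  shows pure_add_left: "m' \<in> carrier M \<Longrightarrow> pure (m \<oplus>\<^bsub>M\<^esub> m') n = pure m n \<oplus>\<^bsub>T\<^esub> pure m' n"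
    and pure_add_right: "n' \<in> carrier N \<Longrightarrow> pure m (n \<oplus>\<^bsub>N\<^esub> n') = pure m n \<oplus>\<^bsub>T\<^esub> pure m n'"
    and pure_balanced: "b \<in> carrier B \<Longrightarrow> pure (m \<triangleleft>\<^bsub>M\<^esub> b) n = pure m (b \<odot>\<^bsub>N\<^esub> n)"
proof -
  have fr: "frag_of (m, n) \<in> carrier frags" if "m \<in> carrier M" "n \<in> carrier N" for m n
    using that by simp
  note fr = fr frags_add
  show "pure (m \<oplus>\<^bsub>M\<^esub> m') n = pure m n \<oplus>\<^bsub>T\<^esub> pure m' n" if m': "m' \<in> carrier M"
  proof -
    have "frag_of (m \<oplus>\<^bsub>M\<^esub> m', n) - (frag_of (m, n) + frag_of (m', n)) \<in> relators"
      unfolding diff_diff_eq[symmetric]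
      by (intro generate.incl tensor_relators assms m')
    then show ?thesis using assms m' unfolding pure_def
      by (simp add: coset_add coset_eqI fr del: carrier_free_Abelian_group_iff)
  qed
  show "pure m (n \<oplus>\<^bsub>N\<^esub> n') = pure m n \<oplus>\<^bsub>T\<^esub> pure m n'" if n': "n' \<in> carrier N"
  proof -
    have "frag_of (m, n \<oplus>\<^bsub>N\<^esub> n') - (frag_of (m, n) + frag_of (m, n')) \<in> relators"
      unfolding diff_diff_eq[symmetric]
      by (intro generate.incl tensor_relators assms n')
    then show ?thesis using assms n' unfolding pure_def
      by (simp add: coset_add coset_eqI fr del: carrier_free_Abelian_group_iff)
  qed
  show "pure (m \<triangleleft>\<^bsub>M\<^esub> b) n = pure m (b \<odot>\<^bsub>N\<^esub> n)" if b: "b \<in> carrier B"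
  proof -
    have "frag_of (m \<triangleleft>\<^bsub>M\<^esub> b, n) - frag_of (m, b \<odot>\<^bsub>N\<^esub> n) \<in> relators"
      by (intro generate.incl tensor_relators assms b)
    then show ?thesis using assms b unfolding pure_def
      by (intro coset_eqI) (simp_all add: left.ract_closed right.lact_closed)
  qed
qed

lemma universal:
  fixes G :: "('g, 'e) ring_scheme"
  assumes G: "abelian_group G"
    and q: "\<And>m n. m \<in> carrier M \<Longrightarrow> n \<in> carrier N \<Longrightarrow> q m n \<in> carrier G"
    and add_left: "\<And>m m' n. m \<in> carrier M \<Longrightarrow> m' \<in> carrier M \<Longrightarrow> n \<in> carrier N
      \<Longrightarrow> q (m \<oplus>\<^bsub>M\<^esub> m') n = q m n \<oplus>\<^bsub>G\<^esub> q m' n"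
    and add_right: "\<And>m n n'. m \<in> carrier M \<Longrightarrow> n \<in> carrier N \<Longrightarrow> n' \<in> carrier N
      \<Longrightarrow> q m (n \<oplus>\<^bsub>N\<^esub> n') = q m n \<oplus>\<^bsub>G\<^esub> q m n'"
    and balanced: "\<And>m b n. m \<in> carrier M \<Longrightarrow> b \<in> carrier B \<Longrightarrow> n \<in> carrier N
      \<Longrightarrow> q (m \<triangleleft>\<^bsub>M\<^esub> b) n = q m (b \<odot>\<^bsub>N\<^esub> n)"
  obtains h where "abelian_group_hom T G h"
    "\<And>m n. m \<in> carrier M \<Longrightarrow> n \<in> carrier N \<Longrightarrow> h (pure m n) = q m n"
proof -
  interpret G: abelian_group G by (rule G)
  have img: "case_prod q ` pairs \<subseteq> carrier (add_monoid G)" using q by auto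
  obtain h0 where h0: "h0 \<in> hom frags (add_monoid G)" "\<And>x. x \<in> pairs \<Longrightarrow> h0 (frag_of x) = case_prod q x"
    using comm_group.free_Abelian_group_universal[OF G.a_comm_group img] by blast
  interpret h0: group_hom frags "add_monoid G" h0
    by (intro group_hom.intro group_hom_axioms.intro G.a_group h0(1)) simp
  have h0_diff: "h0 (x - y) = h0 x \<ominus>\<^bsub>G\<^esub> h0 y" if "x \<in> carrier frags" "y \<in> carrier frags" for x y
  proof -
    have "- y \<in> carrier frags" using that by simp
    then have "h0 (x + (- y)) = h0 x \<oplus>\<^bsub>G\<^esub> h0 (- y)" using h0.hom_mult[of x "- y"] that by simp
    moreover have "h0 (- y) = \<ominus>\<^bsub>G\<^esub> h0 y" using h0.hom_inv[of y] that by (simp add: a_inv_def)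
    ultimately show ?thesis by (simp add: a_minus_def)
  qed
  have h0q: "h0 (frag_of (m, n)) = q m n" if "m \<in> carrier M" "n \<in> carrier N" for m n
    using h0(2)[of "(m, n)"] that by simp
  have fr: "frag_of (m, n) \<in> carrier frags" if "m \<in> carrier M" "n \<in> carrier N" for m n
    using that by simp
  have "tensor_relations B M N \<subseteq> kernel frags (add_monoid G) h0"
  proof
    fix r assume r: "r \<in> tensor_relations B M N"
    have cancel: "(x \<oplus>\<^bsub>G\<^esub> y) \<ominus>\<^bsub>G\<^esub> x \<ominus>\<^bsub>G\<^esub> y = \<zero>\<^bsub>G\<^esub>" if "x \<in> carrier G" "y \<in> carrier G" for x y
    proof -
      have "(x \<oplus>\<^bsub>G\<^esub> y) \<ominus>\<^bsub>G\<^esub> x = y" using that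
        by (simp add: a_minus_def G.a_comm[of x y] G.a_assoc G.r_neg)
      then show ?thesis using that by (simp add: a_minus_def G.r_neg)
    qed
    have "h0 r = \<zero>\<^bsub>G\<^esub>"
      using r unfolding tensor_relations_def
    proof (elim UnE CollectE exE conjE)
      fix m m' n assume *: "r = frag_of (m \<oplus>\<^bsub>M\<^esub> m', n) - frag_of (m, n) - frag_of (m', n)"
        and mn: "m \<in> carrier M" "m' \<in> carrier M" "n \<in> carrier N"
      show ?thesis
        unfolding * using mn fr by (simp add: h0_diff frags_diff h0q add_left cancel q
            del: carrier_free_Abelian_group_iff)
    next
      fix m n n' assume *: "r = frag_of (m, n \<oplus>\<^bsub>N\<^esub> n') - frag_of (m, n) - frag_of (m, n')"
        and mn: "m \<in> carrier M" "n \<in> carrier N" "n' \<in> carrier N"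
      show ?thesis
        unfolding * using mn fr by (simp add: h0_diff frags_diff h0q add_right cancel q
            del: carrier_free_Abelian_group_iff)
    next
      fix m b n assume *: "r = frag_of (m \<triangleleft>\<^bsub>M\<^esub> b, n) - frag_of (m, b \<odot>\<^bsub>N\<^esub> n)"
        and mn: "m \<in> carrier M" "b \<in> carrier B" "n \<in> carrier N"
      have c: "m \<triangleleft>\<^bsub>M\<^esub> b \<in> carrier M" "b \<odot>\<^bsub>N\<^esub> n \<in> carrier N"
        using mn by (simp_all add: left.ract_closed right.lact_closed)
      show ?thesis
        unfolding * using mn c fr by (simp add: h0_diff h0q balanced q a_minus_def G.r_neg
            del: carrier_free_Abelian_group_iff)
    qed
    then show "r \<in> kernel frags (add_monoid G) h0"
      using subsetD[OF tensor_relations_subset r] by (simp add: kernel_def del: carrier_free_Abelian_group_iff)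
  qed
  then have "relators \<subseteq> kernel frags (add_monoid G) h0"
    by (rule group.generate_subgroup_incl[OF group_free_Abelian_group _ h0.subgroup_kernel])
  then obtain g where g: "g \<in> hom (frags Mod relators) (add_monoid G)"
    "\<And>x. x \<in> carrier frags \<Longrightarrow> g (relators #>\<^bsub>frags\<^esub> x) = h0 x"
    using h0.FactGroup_universal_kernel[OF relators_normal] by blast
  show thesis
  proof (rule that[of g])
    show "abelian_group_hom T G g"
      using g(1) by (intro abelian_group_homI' abelian_group_tensor G) (auto simp: hom_def tensor_def Let_def)
  qed (simp add: pure_def g(2) h0q fr)
qed

lemma frag_extend_closed:
  assumes "\<And>x. x \<in> pairs \<Longrightarrow> \<sigma> x \<in> pairs" and "p \<in> carrier frags"
  shows "frag_extend (\<lambda>x. frag_of (\<sigma> x)) p \<in> carrier frags"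
proof -
  have "Poly_Mapping.keys (frag_extend (\<lambda>x. frag_of (\<sigma> x)) p) \<subseteq> (\<Union>x\<in>Poly_Mapping.keys p. {\<sigma> x})"
    using keys_frag_extend[of "\<lambda>x. frag_of (\<sigma> x)" p] by (simp add: keys_frag_of)
  moreover have "\<sigma> x \<in> pairs" if "x \<in> Poly_Mapping.keys p" for x
    by (rule assms(1)) (use assms(2) that in \<open>unfold carrier_free_Abelian_group_iff, blast\<close>)
  ultimately show ?thesis unfolding carrier_free_Abelian_group_iff by blast
qed

text \<open>
  An action on a tensor product is the coset of the image of a coset. If the map \<open>\<sigma>\<close> of pairs
  respects the defining relations, then this is the coset of the image of any representative.
\<close>

lemma coset_image:
  assumes \<sigma>: "\<And>x. x \<in> pairs \<Longrightarrow> \<sigma> x \<in> pairs"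
    and rel: "\<And>r. r \<in> tensor_relations B M N \<Longrightarrow> frag_extend (\<lambda>x. frag_of (\<sigma> x)) r \<in> tensor_relations B M N"
    and p: "p \<in> carrier frags"
  shows "relators <#>\<^bsub>frags\<^esub> (frag_extend (\<lambda>x. frag_of (\<sigma> x)) ` (relators #>\<^bsub>frags\<^esub> p)) =
    relators #>\<^bsub>frags\<^esub> frag_extend (\<lambda>x. frag_of (\<sigma> x)) p"
proof -
  let ?e = "frag_extend (\<lambda>x. frag_of (\<sigma> x))"
  have er: "?e r \<in> relators" if "r \<in> relators" for r
    using that
  proof (induction rule: generate.induct)
    case one then show ?case using generate.one[of frags] by simp
  next
    case (incl h) then show ?case by (intro generate.incl rel)
  next
    case (inv h)
    have h: "h \<in> carrier frags" using inv tensor_relations_subset by blast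
    have eh: "?e h \<in> carrier frags" by (rule frag_extend_closed[OF \<sigma> h])
    have "inv\<^bsub>frags\<^esub> (?e h) \<in> relators" by (rule generate.inv[OF rel[OF inv]])
    then show ?case using h eh by (simp add: frag_extend_minus)
  next
    case (eng h1 h2) then show ?case using relators_add by (simp add: frag_extend_add)
  qed
  show ?thesis
  proof (rule Set.set_eqI)
    fix x
    have "x \<in> relators <#>\<^bsub>frags\<^esub> (?e ` (relators #>\<^bsub>frags\<^esub> p)) \<longleftrightarrow>
        (\<exists>r\<in>relators. \<exists>s\<in>relators. x = r + (?e s + ?e p))"
      by (auto simp: set_mult_def r_coset_def frag_extend_add)
    also have "\<dots> \<longleftrightarrow> (\<exists>r\<in>relators. x = r + ?e p)"
    proof
      assume "\<exists>r\<in>relators. \<exists>s\<in>relators. x = r + (?e s + ?e p)"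
      then obtain r s where "r \<in> relators" "s \<in> relators" "x = r + (?e s + ?e p)" by blast
      then show "\<exists>r\<in>relators. x = r + ?e p"
        using relators_add[OF _ er[of s]] by (intro bexI[of _ "r + ?e s"]) (auto simp: add.assoc)
    next
      assume "\<exists>r\<in>relators. x = r + ?e p"
      then obtain r where "r \<in> relators" "x = r + ?e p" by blast
      moreover have "0 \<in> relators" using generate.one[of frags] by simp
      ultimately show "\<exists>r\<in>relators. \<exists>s\<in>relators. x = r + (?e s + ?e p)"
        by (intro bexI[of _ r] bexI[of _ 0]) auto
    qed
    also have "\<dots> \<longleftrightarrow> x \<in> relators #>\<^bsub>frags\<^esub> ?e p" by (auto simp: r_coset_def)
    finally show "x \<in> relators <#>\<^bsub>frags\<^esub> (?e ` (relators #>\<^bsub>frags\<^esub> p)) \<longleftrightarrow> x \<in> relators #>\<^bsub>frags\<^esub> ?e p" .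
  qed
qed

lemma lact_coset:
  assumes a: "a \<in> carrier A" and p: "p \<in> carrier frags"
  shows "a \<odot>\<^bsub>T\<^esub> (relators #>\<^bsub>frags\<^esub> p) =
    relators #>\<^bsub>frags\<^esub> frag_extend (\<lambda>x. frag_of (case x of (m, n) \<Rightarrow> (a \<odot>\<^bsub>M\<^esub> m, n))) p"
proof -
  have eq: "(\<lambda>(m, n). frag_of (a \<odot>\<^bsub>M\<^esub> m, n)) = (\<lambda>x. frag_of (case x of (m, n) \<Rightarrow> (a \<odot>\<^bsub>M\<^esub> m, n)))" by auto
  have "frag_extend (\<lambda>x. frag_of (case x of (m, n) \<Rightarrow> (a \<odot>\<^bsub>M\<^esub> m, n))) r \<in> tensor_relations B M N"
    if "r \<in> tensor_relations B M N" for r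
  proof (rule tensor_relators_cases[OF that], goal_cases)
    case (1 m m' n)
    then show ?case
      using tensor_relators(1)[of "a \<odot>\<^bsub>M\<^esub> m" "a \<odot>\<^bsub>M\<^esub> m'" n] a
      by (simp add: frag_extend_diff left.lact_add_right left.lact_closed)
  next
    case (2 m n n')
    then show ?case
      using tensor_relators(2)[of "a \<odot>\<^bsub>M\<^esub> m" n n'] a
      by (simp add: frag_extend_diff left.lact_closed)
  next
    case (3 m b n)
    then show ?case
      using tensor_relators(3)[of "a \<odot>\<^bsub>M\<^esub> m" b n] a
      by (simp add: frag_extend_diff left.lact_closed left.act_commute)
  qed
  note rel = this
  have "(case x of (m, n) \<Rightarrow> (a \<odot>\<^bsub>M\<^esub> m, n)) \<in> pairs" if "x \<in> pairs" for x
    using that a by (cases x) (simp add: left.lact_closed)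
  from coset_image[OF this rel p] show ?thesis by (simp add: tensor_def Let_def eq)
qed

lemma ract_coset:
  assumes c: "c \<in> carrier C" and p: "p \<in> carrier frags"
  shows "(relators #>\<^bsub>frags\<^esub> p) \<triangleleft>\<^bsub>T\<^esub> c =
    relators #>\<^bsub>frags\<^esub> frag_extend (\<lambda>x. frag_of (case x of (m, n) \<Rightarrow> (m, n \<triangleleft>\<^bsub>N\<^esub> c))) p"
proof -
  have eq: "(\<lambda>(m, n). frag_of (m, n \<triangleleft>\<^bsub>N\<^esub> c)) = (\<lambda>x. frag_of (case x of (m, n) \<Rightarrow> (m, n \<triangleleft>\<^bsub>N\<^esub> c)))" by auto
  have "frag_extend (\<lambda>x. frag_of (case x of (m, n) \<Rightarrow> (m, n \<triangleleft>\<^bsub>N\<^esub> c))) r \<in> tensor_relations B M N"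
    if "r \<in> tensor_relations B M N" for r
  proof (rule tensor_relators_cases[OF that], goal_cases)
    case (1 m m' n)
    then show ?case
      using tensor_relators(1)[of m m' "n \<triangleleft>\<^bsub>N\<^esub> c"] c
      by (simp add: frag_extend_diff right.ract_closed)
  next
    case (2 m n n')
    then show ?case
      using tensor_relators(2)[of m "n \<triangleleft>\<^bsub>N\<^esub> c" "n' \<triangleleft>\<^bsub>N\<^esub> c"] c
      by (simp add: frag_extend_diff right.ract_closed right.ract_add_left)
  next
    case (3 m b n)
    then show ?case
      using tensor_relators(3)[of m b "n \<triangleleft>\<^bsub>N\<^esub> c"] c
      by (simp add: frag_extend_diff right.ract_closed right.act_commute)
  qed
  note rel = this
  have "(case x of (m, n) \<Rightarrow> (m, n \<triangleleft>\<^bsub>N\<^esub> c)) \<in> pairs" if "x \<in> pairs" for x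
    using that c by (cases x) (simp add: right.ract_closed)
  from coset_image[OF this rel p] show ?thesis by (simp add: tensor_def Let_def eq)
qed

lemma tensor_cases:
  assumes "t \<in> carrier T"
  obtains p where "p \<in> carrier frags" "t = relators #>\<^bsub>frags\<^esub> p"
  using assms by (auto simp only: tensor_simps(1))

lemma lact_pure: "a \<in> carrier A \<Longrightarrow> m \<in> carrier M \<Longrightarrow> n \<in> carrier N \<Longrightarrow>
    a \<odot>\<^bsub>T\<^esub> pure m n = pure (a \<odot>\<^bsub>M\<^esub> m) n"
  unfolding pure_def by (subst lact_coset) auto

lemma ract_pure: "c \<in> carrier C \<Longrightarrow> m \<in> carrier M \<Longrightarrow> n \<in> carrier N \<Longrightarrow>
    pure m n \<triangleleft>\<^bsub>T\<^esub> c = pure m (n \<triangleleft>\<^bsub>N\<^esub> c)"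
  unfolding pure_def by (subst ract_coset) auto

lemma tensor_lact_hom:
  assumes a: "a \<in> carrier A"
  shows "abelian_group_hom T T (\<lambda>t. a \<odot>\<^bsub>T\<^esub> t)"
proof (intro abelian_group_homI' abelian_group_tensor)
  let ?e = "frag_extend (\<lambda>x. frag_of (case x of (m, n) \<Rightarrow> (a \<odot>\<^bsub>M\<^esub> m, n)))"
  have e: "?e p \<in> carrier frags" if "p \<in> carrier frags" for p
    by (rule frag_extend_closed[OF _ that]) (use a in \<open>auto simp: left.lact_closed\<close>)
  fix t assume t: "t \<in> carrier T"
  then obtain p where p: "p \<in> carrier frags" "t = relators #>\<^bsub>frags\<^esub> p" by (rule tensor_cases)
  show "a \<odot>\<^bsub>T\<^esub> t \<in> carrier T" unfolding p(2) lact_coset[OF a p(1)] by (rule coset_closed[OF e[OF p(1)]])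
  fix t' assume "t' \<in> carrier T"
  then obtain q where q: "q \<in> carrier frags" "t' = relators #>\<^bsub>frags\<^esub> q" by (rule tensor_cases)
  show "a \<odot>\<^bsub>T\<^esub> (t \<oplus>\<^bsub>T\<^esub> t') = a \<odot>\<^bsub>T\<^esub> t \<oplus>\<^bsub>T\<^esub> a \<odot>\<^bsub>T\<^esub> t'"
    unfolding p(2) q(2) coset_add[OF p(1) q(1)] lact_coset[OF a p(1)] lact_coset[OF a q(1)]
      lact_coset[OF a frags_add[OF p(1) q(1)]] coset_add[OF e[OF p(1)] e[OF q(1)]]
    by (simp add: frag_extend_add)
qed

lemma tensor_ract_hom:
  assumes c: "c \<in> carrier C"
  shows "abelian_group_hom T T (\<lambda>t. t \<triangleleft>\<^bsub>T\<^esub> c)"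
proof (intro abelian_group_homI' abelian_group_tensor)
  let ?e = "frag_extend (\<lambda>x. frag_of (case x of (m, n) \<Rightarrow> (m, n \<triangleleft>\<^bsub>N\<^esub> c)))"
  have e: "?e p \<in> carrier frags" if "p \<in> carrier frags" for p
    by (rule frag_extend_closed[OF _ that]) (use c in \<open>auto simp: right.ract_closed\<close>)
  fix t assume t: "t \<in> carrier T"
  then obtain p where p: "p \<in> carrier frags" "t = relators #>\<^bsub>frags\<^esub> p" by (rule tensor_cases)
  show "t \<triangleleft>\<^bsub>T\<^esub> c \<in> carrier T" unfolding p(2) ract_coset[OF c p(1)] by (rule coset_closed[OF e[OF p(1)]])
  fix t' assume "t' \<in> carrier T"
  then obtain q where q: "q \<in> carrier frags" "t' = relators #>\<^bsub>frags\<^esub> q" by (rule tensor_cases)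
  show "(t \<oplus>\<^bsub>T\<^esub> t') \<triangleleft>\<^bsub>T\<^esub> c = t \<triangleleft>\<^bsub>T\<^esub> c \<oplus>\<^bsub>T\<^esub> t' \<triangleleft>\<^bsub>T\<^esub> c"
    unfolding p(2) q(2) coset_add[OF p(1) q(1)] ract_coset[OF c p(1)] ract_coset[OF c q(1)]
      ract_coset[OF c frags_add[OF p(1) q(1)]] coset_add[OF e[OF p(1)] e[OF q(1)]]
    by (simp add: frag_extend_add)
qed

lemma hom_pointwise_add:
  assumes "abelian_group_hom T T h" "abelian_group_hom T T h'"
  shows "abelian_group_hom T T (\<lambda>t. h t \<oplus>\<^bsub>T\<^esub> h' t)"
proof -
  interpret h: abelian_group_hom T T h by fact
  interpret h': abelian_group_hom T T h' by fact
  show ?thesis by (intro abelian_group_homI' abelian_group_tensor) (simp_all add: T.a_ac)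
qed

lemma hom_compose:
  assumes "abelian_group_hom T T h" "abelian_group_hom T T h'"
  shows "abelian_group_hom T T (\<lambda>t. h (h' t))"
proof -
  interpret h: abelian_group_hom T T h by fact
  interpret h': abelian_group_hom T T h' by fact
  show ?thesis by (intro abelian_group_homI' abelian_group_tensor) simp_all
qed

lemma hom_identity: "abelian_group_hom T T (\<lambda>t. t)"
  by (intro abelian_group_homI' abelian_group_tensor) simp_all

lemma bimodule_tensor: "bimodule A C T"
proof (intro bimodule.intro bimodule_axioms.intro left.A.k_algebra_axioms right.B.k_algebra_axioms abelian_group_tensor)
  note pure = lact_pure ract_pure left.lact_closed right.ract_closed pure_closed
  note homs = tensor_lact_hom tensor_ract_hom hom_pointwise_add hom_identity
    hom_compose[OF tensor_lact_hom tensor_lact_hom] hom_compose[OF tensor_ract_hom tensor_ract_hom]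
    hom_compose[OF tensor_lact_hom tensor_ract_hom] hom_compose[OF tensor_ract_hom tensor_lact_hom]
  show "a \<odot>\<^bsub>T\<^esub> t \<in> carrier T" if "a \<in> carrier A" "t \<in> carrier T" for a t
    using abelian_group_hom.hom_closed[OF tensor_lact_hom] that by blast
  show "t \<triangleleft>\<^bsub>T\<^esub> c \<in> carrier T" if "t \<in> carrier T" "c \<in> carrier C" for t c
    using abelian_group_hom.hom_closed[OF tensor_ract_hom] that by blast
  show "a \<odot>\<^bsub>T\<^esub> (t \<oplus>\<^bsub>T\<^esub> t') = a \<odot>\<^bsub>T\<^esub> t \<oplus>\<^bsub>T\<^esub> a \<odot>\<^bsub>T\<^esub> t'"
    if "a \<in> carrier A" "t \<in> carrier T" "t' \<in> carrier T" for a t t'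
    using abelian_group_hom.hom_add[OF tensor_lact_hom] that by blast
  show "(t \<oplus>\<^bsub>T\<^esub> t') \<triangleleft>\<^bsub>T\<^esub> c = t \<triangleleft>\<^bsub>T\<^esub> c \<oplus>\<^bsub>T\<^esub> t' \<triangleleft>\<^bsub>T\<^esub> c"
    if "t \<in> carrier T" "t' \<in> carrier T" "c \<in> carrier C" for t t' c
    using abelian_group_hom.hom_add[OF tensor_ract_hom] that by blast
  show "(a \<oplus>\<^bsub>A\<^esub> a') \<odot>\<^bsub>T\<^esub> t = a \<odot>\<^bsub>T\<^esub> t \<oplus>\<^bsub>T\<^esub> a' \<odot>\<^bsub>T\<^esub> t"
    if a: "a \<in> carrier A" "a' \<in> carrier A" and t: "t \<in> carrier T" for a a' t
    by (rule hom_eqI[where G = T, OF _ _ _ t]) (use a in \<open>simp_all add: homs pure left.lact_add_left pure_add_left\<close>)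
  show "t \<triangleleft>\<^bsub>T\<^esub> (c \<oplus>\<^bsub>C\<^esub> c') = t \<triangleleft>\<^bsub>T\<^esub> c \<oplus>\<^bsub>T\<^esub> t \<triangleleft>\<^bsub>T\<^esub> c'"
    if t: "t \<in> carrier T" and c: "c \<in> carrier C" "c' \<in> carrier C" for c c' t
    by (rule hom_eqI[where G = T, OF _ _ _ t]) (use c in \<open>simp_all add: homs pure right.ract_add_right pure_add_right\<close>)
  show "(a \<otimes>\<^bsub>A\<^esub> a') \<odot>\<^bsub>T\<^esub> t = a \<odot>\<^bsub>T\<^esub> (a' \<odot>\<^bsub>T\<^esub> t)"
    if a: "a \<in> carrier A" "a' \<in> carrier A" and t: "t \<in> carrier T" for a a' t
    by (rule hom_eqI[where G = T, OF _ _ _ t]) (use a in \<open>simp_all add: homs pure left.lact_assoc\<close>)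
  show "t \<triangleleft>\<^bsub>T\<^esub> (c \<otimes>\<^bsub>C\<^esub> c') = (t \<triangleleft>\<^bsub>T\<^esub> c) \<triangleleft>\<^bsub>T\<^esub> c'"
    if t: "t \<in> carrier T" and c: "c \<in> carrier C" "c' \<in> carrier C" for c c' t
    by (rule hom_eqI[where G = T, OF _ _ _ t]) (use c in \<open>simp_all add: homs pure right.ract_assoc\<close>)
  show "\<one>\<^bsub>A\<^esub> \<odot>\<^bsub>T\<^esub> t = t" if t: "t \<in> carrier T" for t
    by (rule hom_eqI[where G = T, OF _ _ _ t]) (simp_all add: homs pure left.lact_one)
  show "t \<triangleleft>\<^bsub>T\<^esub> \<one>\<^bsub>C\<^esub> = t" if t: "t \<in> carrier T" for t
    by (rule hom_eqI[where G = T, OF _ _ _ t]) (simp_all add: homs pure right.ract_one)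
  show "(a \<odot>\<^bsub>T\<^esub> t) \<triangleleft>\<^bsub>T\<^esub> c = a \<odot>\<^bsub>T\<^esub> (t \<triangleleft>\<^bsub>T\<^esub> c)"
    if a: "a \<in> carrier A" and t: "t \<in> carrier T" and c: "c \<in> carrier C" for a t c
    by (rule hom_eqI[where G = T, OF _ _ _ t]) (use a c in \<open>simp_all add: homs pure\<close>)
  show "(k \<odot>\<^bsub>A\<^esub> \<one>\<^bsub>A\<^esub>) \<odot>\<^bsub>T\<^esub> t = t \<triangleleft>\<^bsub>T\<^esub> (k \<odot>\<^bsub>C\<^esub> \<one>\<^bsub>C\<^esub>)" if t: "t \<in> carrier T" for k t
  proof (rule hom_eqI[where G = T, OF _ _ _ t])
    fix m n assume "m \<in> carrier M" "n \<in> carrier N"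
    then show "(k \<odot>\<^bsub>A\<^esub> \<one>\<^bsub>A\<^esub>) \<odot>\<^bsub>T\<^esub> pure m n = pure m n \<triangleleft>\<^bsub>T\<^esub> (k \<odot>\<^bsub>C\<^esub> \<one>\<^bsub>C\<^esub>)"
      by (simp add: pure left.scalars_central pure_balanced right.scalars_central)
  qed (simp_all add: homs)
qed

end

section \<open>Transfer along a stable equivalence\<close>

text \<open>
  The generators are the images of \<open>1\<close> under the projections from the copies of \<open>B\<close>, and the
  inclusions are the coordinates.
\<close>

lemma dual_basis_of_fg_projective:
  fixes M :: "('a, 'b, 'm) bimodule"
  assumes M: "bimodule A B M" and fg: "fg_projective_right B M"
  obtains I :: "'m set" and m \<phi> where "right_dual_basis A B M I m \<phi>"
proof -
  interpret M: bimodule A B M by (rule M)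
  let ?U = "right_part B (regular_bimodule B)" and ?M = "right_part B M"
  have U: "bimodule ground_field B ?U"
    by (rule bimodule.bimodule_right_part[OF M.B.bimodule_regular])
  have rec: "carrier ?M = carrier M" "carrier ?U = carrier B" "add ?M = add M" "add ?U = add B"
    "ract ?M = ract M" "ract ?U = monoid.mult B" "ring.zero ?M = ring.zero M" "ring.zero ?U = ring.zero B"
    by (simp_all add: right_part_def regular_bimodule_def)
  obtain S where S: "finite S" "S \<subseteq> carrier ?M"
      "\<forall>W. subbimodule ground_field B W ?M \<and> S \<subseteq> W \<longrightarrow> W = carrier ?M"
    using fg unfolding fg_projective_right_def finitely_generated_def by (elim conjE exE)
  have sum: "summand_of_copies ground_field B ?U ?M"
    using fg unfolding fg_projective_right_def projective_right_def by (rule conjunct2)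
  obtain J :: "'m set" and \<iota> \<pi> where J: "finite J"
    and \<iota>: "\<And>j. j \<in> J \<Longrightarrow> bimodule_hom ground_field B ?M ?U (\<iota> j)"
    and \<pi>: "\<And>j. j \<in> J \<Longrightarrow> bimodule_hom ground_field B ?U ?M (\<pi> j)"
    and exp: "\<And>p. p \<in> carrier ?M \<Longrightarrow> p = (\<Oplus>\<^bsub>?M\<^esub>j\<in>J. \<pi> j (\<iota> j p))"
    by (rule finite_retraction[OF M.bimodule_right_part U sum S(1,2) S(3)[rule_format]], simp, rule that)
  have fs: "finsum ?M g K = finsum M g K" for g :: "'x \<Rightarrow> 'm" and K
    by (simp add: finsum_def finprod_def rec)
  have \<iota>c: "\<iota> j t \<in> carrier B" if "j \<in> J" "t \<in> carrier M" for j t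
    using abelian_group_hom.hom_closed[of ?M ?U "\<iota> j" t] \<iota>[OF that(1)] that(2) by (simp add: bimodule_hom_def rec)
  have \<pi>c: "\<pi> j b \<in> carrier M" if "j \<in> J" "b \<in> carrier B" for j b
    using abelian_group_hom.hom_closed[of ?U ?M "\<pi> j" b] \<pi>[OF that(1)] that(2) by (simp add: bimodule_hom_def rec)
  have \<iota>a: "\<iota> j (t \<oplus>\<^bsub>M\<^esub> t') = \<iota> j t \<oplus>\<^bsub>B\<^esub> \<iota> j t'" if "j \<in> J" "t \<in> carrier M" "t' \<in> carrier M" for j t t'
    using abelian_group_hom.hom_add[of ?M ?U "\<iota> j" t t'] \<iota>[OF that(1)] that(2,3) by (simp add: bimodule_hom_def rec)
  have "right_dual_basis A B M J (\<lambda>j. \<pi> j \<one>\<^bsub>B\<^esub>) \<iota>"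
  proof (intro right_dual_basis.intro right_dual_basis_axioms.intro M J)
    show "\<pi> j \<one>\<^bsub>B\<^esub> \<in> carrier M" if "j \<in> J" for j using \<pi>c that by simp
    show "abelian_group_hom M B (\<iota> j)" if "j \<in> J" for j
      by (rule abelian_group_homI'[OF M.M.abelian_group_axioms M.B.is_abelian_group]) (use \<iota>c \<iota>a that in auto)
    show "\<iota> j (t \<triangleleft>\<^bsub>M\<^esub> b) = \<iota> j t \<otimes>\<^bsub>B\<^esub> b" if "j \<in> J" "t \<in> carrier M" "b \<in> carrier B" for j t b
      using \<iota>[OF that(1)] that(2,3) by (simp add: bimodule_hom_def rec)
    show "t = (\<Oplus>\<^bsub>M\<^esub>j\<in>J. \<pi> j \<one>\<^bsub>B\<^esub> \<triangleleft>\<^bsub>M\<^esub> \<iota> j t)" if t: "t \<in> carrier M" for t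
    proof -
      have eq: "\<pi> j (\<iota> j t) = \<pi> j \<one>\<^bsub>B\<^esub> \<triangleleft>\<^bsub>M\<^esub> \<iota> j t" if j: "j \<in> J" for j
      proof -
        have "\<pi> j (\<one>\<^bsub>B\<^esub> \<otimes>\<^bsub>B\<^esub> \<iota> j t) = \<pi> j \<one>\<^bsub>B\<^esub> \<triangleleft>\<^bsub>M\<^esub> \<iota> j t"
          using \<pi>[OF j] \<iota>c[OF j t] by (simp add: bimodule_hom_def rec del: M.B.l_one)
        then show ?thesis using \<iota>c[OF j t] by simp
      qed
      have "t = (\<Oplus>\<^bsub>M\<^esub>j\<in>J. \<pi> j (\<iota> j t))" using exp[of t] t by (simp add: fs rec)
      also have "\<dots> = (\<Oplus>\<^bsub>M\<^esub>j\<in>J. \<pi> j \<one>\<^bsub>B\<^esub> \<triangleleft>\<^bsub>M\<^esub> \<iota> j t)"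
        by (rule M.M.finsum_cong') (use eq \<iota>c \<pi>c t in \<open>auto intro!: M.ract_closed\<close>)
      finally show ?thesis .
    qed
  qed
  then show thesis by (rule that)
qed

lemma transport_dual_basis:
  assumes s: "right_dual_basis A B M I m \<phi>" and N: "bimodule A B N"
    and f: "bimodule_hom A B M N f" and g: "bimodule_hom A B N M g"
    and gf: "\<And>t. t \<in> carrier M \<Longrightarrow> g (f t) = t" and fg: "\<And>t. t \<in> carrier N \<Longrightarrow> f (g t) = t"
  shows "right_dual_basis A B N I (\<lambda>i. f (m i)) (\<lambda>i t. \<phi> i (g t))"
    and "\<And>h a b. a \<in> carrier A \<Longrightarrow> b \<in> carrier A \<Longrightarrow>
      trace_transfer N I (\<lambda>i. f (m i)) (\<lambda>i t. \<phi> i (g t)) h a b = trace_transfer M I m \<phi> h a b"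
proof -
  interpret s: right_dual_basis A B M I m \<phi> by (rule s)
  interpret N: bimodule A B N by (rule N)
  interpret f: abelian_group_hom M N f using f by (simp add: bimodule_hom_def)
  interpret g: abelian_group_hom N M g using g by (simp add: bimodule_hom_def)
  have gl: "g (a \<odot>\<^bsub>N\<^esub> t) = a \<odot>\<^bsub>M\<^esub> g t" if "a \<in> carrier A" "t \<in> carrier N" for a t
    using g that by (simp add: bimodule_hom_def)
  have gr: "g (t \<triangleleft>\<^bsub>N\<^esub> b) = g t \<triangleleft>\<^bsub>M\<^esub> b" if "b \<in> carrier B" "t \<in> carrier N" for b t
    using g that by (simp add: bimodule_hom_def)
  have fr: "f (t \<triangleleft>\<^bsub>M\<^esub> b) = f t \<triangleleft>\<^bsub>N\<^esub> b" if "b \<in> carrier B" "t \<in> carrier M" for b t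
    using f that by (simp add: bimodule_hom_def)
  show "right_dual_basis A B N I (\<lambda>i. f (m i)) (\<lambda>i t. \<phi> i (g t))"
  proof (intro right_dual_basis.intro right_dual_basis_axioms.intro N s.finite_index)
    show "f (m i) \<in> carrier N" if "i \<in> I" for i using s.basis_closed[OF that] by simp
    show "abelian_group_hom N B (\<lambda>t. \<phi> i (g t))" if "i \<in> I" for i
      by (rule abelian_group_homI'[OF N.M.abelian_group_axioms s.B.is_abelian_group])
        (use that in \<open>auto simp: s.coord_add\<close>)
    show "\<phi> i (g (t \<triangleleft>\<^bsub>N\<^esub> b)) = \<phi> i (g t) \<otimes>\<^bsub>B\<^esub> b" if "i \<in> I" "t \<in> carrier N" "b \<in> carrier B" for i t b
      using that by (simp add: gr s.coord_ract)
    show "t = (\<Oplus>\<^bsub>N\<^esub>i\<in>I. f (m i) \<triangleleft>\<^bsub>N\<^esub> \<phi> i (g t))" if t: "t \<in> carrier N" for t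
    proof -
      have "t = f (\<Oplus>\<^bsub>M\<^esub>i\<in>I. m i \<triangleleft>\<^bsub>M\<^esub> \<phi> i (g t))"
        using s.expansion[of "g t"] fg[OF t] t by simp
      also have "\<dots> = (\<Oplus>\<^bsub>N\<^esub>i\<in>I. f (m i \<triangleleft>\<^bsub>M\<^esub> \<phi> i (g t)))"
        by (rule f.hom_finsum) (use t s.finite_index in \<open>auto intro!: s.ract_closed s.basis_closed\<close>)
      also have "\<dots> = (\<Oplus>\<^bsub>N\<^esub>i\<in>I. f (m i) \<triangleleft>\<^bsub>N\<^esub> \<phi> i (g t))"
        by (rule N.M.finsum_cong') (use t in \<open>auto simp: fr s.basis_closed intro!: N.ract_closed\<close>)
      finally show ?thesis .
    qed
  qed
  show "trace_transfer N I (\<lambda>i. f (m i)) (\<lambda>i t. \<phi> i (g t)) h a b = trace_transfer M I m \<phi> h a b"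
    if "a \<in> carrier A" "b \<in> carrier A" for h a b
    using that by (simp add: mixed_trace_def trace_pairing_def gl gf s.basis_closed)
qed

text \<open>
  The products \<open>m i \<otimes> n j\<close> with the coordinates \<open>u \<otimes> v \<mapsto> \<psi> j (\<phi> i u \<odot> v)\<close> form a dual basis, and its matrix
  of left multiplication is the matrix for \<open>N\<close> applied to the entries of the matrix for \<open>M\<close>.
\<close>

lemma tensor_dual_basis:
  fixes A :: "('k::field, 'a) module" and I :: "'i set" and J :: "'j set"
    and M :: "('a, 'b, 'm) bimodule" and N :: "('b, 'c, 'n) bimodule"
  assumes s: "right_dual_basis A B M I m \<phi>" and t: "right_dual_basis B C N J n \<psi>"
  obtains x :: "'i \<times> 'j \<Rightarrow> ('m \<times> 'n \<Rightarrow>\<^sub>0 int) set" and h where "right_dual_basis A C (tensor B M N) (I \<times> J) x h"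
    "\<And>i k j l a. i \<in> I \<Longrightarrow> k \<in> J \<Longrightarrow> j \<in> I \<Longrightarrow> l \<in> J \<Longrightarrow> a \<in> carrier A \<Longrightarrow>
      h (i, k) (a \<odot>\<^bsub>tensor B M N\<^esub> x (j, l)) = \<psi> k (\<phi> i (a \<odot>\<^bsub>M\<^esub> m j) \<odot>\<^bsub>N\<^esub> n l)"
    "\<And>(f :: 'c \<Rightarrow> 'c \<Rightarrow> 'k) a b. a \<in> carrier A \<Longrightarrow> b \<in> carrier A \<Longrightarrow>
      trace_transfer (tensor B M N) (I \<times> J) x h f a b =
      trace_transfer M I m \<phi> (trace_transfer N J n \<psi> f) a b"
proof -
  interpret s: right_dual_basis A B M I m \<phi> by (rule s)
  interpret t: right_dual_basis B C N J n \<psi> by (rule t)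
  interpret bimodule_pair A B C M N ..
  define q where "q p u v = \<psi> (snd p) (\<phi> (fst p) u \<odot>\<^bsub>N\<^esub> v)" for p u v
  have "\<exists>h. abelian_group_hom T C h \<and> (\<forall>u\<in>carrier M. \<forall>v\<in>carrier N. h (pure u v) = q p u v)"
    if p: "p \<in> I \<times> J" for p
  proof (rule universal[of C "q p"])
    show "abelian_group C" by (rule t.B.is_abelian_group)
  qed (use p in \<open>auto simp: q_def s.coord_add t.coord_add s.coord_ract t.lact_add_left t.lact_add_right
      t.lact_assoc t.lact_closed\<close>)
  then obtain h where h: "\<And>p. p \<in> I \<times> J \<Longrightarrow> abelian_group_hom T C (h p)"
    "\<And>p u v. p \<in> I \<times> J \<Longrightarrow> u \<in> carrier M \<Longrightarrow> v \<in> carrier N \<Longrightarrow> h p (pure u v) = q p u v"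
    by metis
  define x where "x p = pure (m (fst p)) (n (snd p))" for p
  interpret TT: bimodule A C T by (rule bimodule_tensor)
  have xc: "x p \<in> carrier T" if "p \<in> I \<times> J" for p
    using that by (auto simp: x_def intro!: pure_closed s.basis_closed t.basis_closed)
  have hc: "h p u \<in> carrier C" if "p \<in> I \<times> J" "u \<in> carrier T" for p u
    by (rule abelian_group_hom.hom_closed[OF h(1)]) fact+
  have ha: "h p (u \<oplus>\<^bsub>T\<^esub> v) = h p u \<oplus>\<^bsub>C\<^esub> h p v" if "p \<in> I \<times> J" "u \<in> carrier T" "v \<in> carrier T" for p u v
    by (rule abelian_group_hom.hom_add[OF h(1)]) fact+
  have hr: "h p (u \<triangleleft>\<^bsub>T\<^esub> c) = h p u \<otimes>\<^bsub>C\<^esub> c"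
    if p: "p \<in> I \<times> J" and u: "u \<in> carrier T" and c: "c \<in> carrier C" for p u c
  proof (rule hom_eqI[where G = C, OF _ _ _ u])
    show "abelian_group_hom T C (\<lambda>u. h p (u \<triangleleft>\<^bsub>T\<^esub> c))" "abelian_group_hom T C (\<lambda>u. h p u \<otimes>\<^bsub>C\<^esub> c)"
      by (intro abelian_group_homI' abelian_group_tensor t.B.is_abelian_group;
          simp add: p c hc ha TT.ract_closed TT.ract_add_left t.B.l_distr)+
    fix y z assume "y \<in> carrier M" "z \<in> carrier N"
    then show "h p (pure y z \<triangleleft>\<^bsub>T\<^esub> c) = h p (pure y z) \<otimes>\<^bsub>C\<^esub> c"
      using p c by (auto simp: ract_pure h(2) q_def t.ract_closed t.act_commute[symmetric] t.coord_ract
          t.lact_closed)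
  qed
  have exp: "u = (\<Oplus>\<^bsub>T\<^esub>p\<in>I\<times>J. x p \<triangleleft>\<^bsub>T\<^esub> h p u)" if u: "u \<in> carrier T" for u
  proof (rule hom_eqI[where G = T, OF hom_identity _ _ u])
    have fin: "finite (I \<times> J)" using s.finite_index t.finite_index by simp
    show "abelian_group_hom T T (\<lambda>u. \<Oplus>\<^bsub>T\<^esub>p\<in>I\<times>J. x p \<triangleleft>\<^bsub>T\<^esub> h p u)"
    proof (intro abelian_group_homI' abelian_group_tensor)
      fix u v assume u: "u \<in> carrier T" and v: "v \<in> carrier T"
      show "(\<Oplus>\<^bsub>T\<^esub>p\<in>I\<times>J. x p \<triangleleft>\<^bsub>T\<^esub> h p u) \<in> carrier T"
        by (rule T.finsum_closed) (use u in \<open>auto intro!: TT.ract_closed xc hc\<close>)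
      have "(\<Oplus>\<^bsub>T\<^esub>p\<in>I\<times>J. x p \<triangleleft>\<^bsub>T\<^esub> h p (u \<oplus>\<^bsub>T\<^esub> v)) =
          (\<Oplus>\<^bsub>T\<^esub>p\<in>I\<times>J. x p \<triangleleft>\<^bsub>T\<^esub> h p u \<oplus>\<^bsub>T\<^esub> x p \<triangleleft>\<^bsub>T\<^esub> h p v)"
      proof (rule T.finsum_cong')
        fix p assume p: "p \<in> I \<times> J"
        show "x p \<triangleleft>\<^bsub>T\<^esub> h p (u \<oplus>\<^bsub>T\<^esub> v) = x p \<triangleleft>\<^bsub>T\<^esub> h p u \<oplus>\<^bsub>T\<^esub> x p \<triangleleft>\<^bsub>T\<^esub> h p v"
          unfolding ha[OF p u v] by (rule TT.ract_add_right[OF xc[OF p] hc[OF p u] hc[OF p v]])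
      qed (use u v in \<open>auto intro!: TT.ract_closed xc hc\<close>)
      then show "(\<Oplus>\<^bsub>T\<^esub>p\<in>I\<times>J. x p \<triangleleft>\<^bsub>T\<^esub> h p (u \<oplus>\<^bsub>T\<^esub> v)) =
          (\<Oplus>\<^bsub>T\<^esub>p\<in>I\<times>J. x p \<triangleleft>\<^bsub>T\<^esub> h p u) \<oplus>\<^bsub>T\<^esub> (\<Oplus>\<^bsub>T\<^esub>p\<in>I\<times>J. x p \<triangleleft>\<^bsub>T\<^esub> h p v)"
        by (subst T.finsum_addf[symmetric]) (use u v in \<open>auto intro!: TT.ract_closed xc hc\<close>)
    qed
    fix y z assume y: "y \<in> carrier M" and z: "z \<in> carrier N"
    have \<phi>z: "\<phi> i y \<odot>\<^bsub>N\<^esub> z \<in> carrier N" if "i \<in> I" for i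
      using that y z by (simp add: t.lact_closed)
    have "(\<Oplus>\<^bsub>T\<^esub>p\<in>I\<times>J. x p \<triangleleft>\<^bsub>T\<^esub> h p (pure y z)) =
        (\<Oplus>\<^bsub>T\<^esub>p\<in>I\<times>J. pure (m (fst p)) (n (snd p) \<triangleleft>\<^bsub>N\<^esub> \<psi> (snd p) (\<phi> (fst p) y \<odot>\<^bsub>N\<^esub> z)))"
      by (rule T.finsum_cong')
        (use y z \<phi>z in \<open>auto simp: x_def h(2) q_def ract_pure s.basis_closed t.basis_closed
          intro!: pure_closed t.ract_closed\<close>)
    also have "\<dots> = (\<Oplus>\<^bsub>T\<^esub>i\<in>I. \<Oplus>\<^bsub>T\<^esub>j\<in>J. pure (m i) (n j \<triangleleft>\<^bsub>N\<^esub> \<psi> j (\<phi> i y \<odot>\<^bsub>N\<^esub> z)))"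
      by (rule T.finsum_finsum_product)
        (use \<phi>z in \<open>auto intro!: pure_closed t.ract_closed s.basis_closed t.basis_closed
          simp: s.finite_index t.finite_index\<close>)
    also have "\<dots> = (\<Oplus>\<^bsub>T\<^esub>i\<in>I. pure (m i \<triangleleft>\<^bsub>M\<^esub> \<phi> i y) z)"
    proof (rule T.finsum_cong')
      fix i assume i: "i \<in> I"
      have "abelian_group_hom N T (pure (m i))"
        by (rule abelian_group_homI')
          (use i in \<open>auto simp: s.basis_closed pure_add_right pure_closed abelian_group_tensor t.M.abelian_group_axioms\<close>)
      then have "(\<Oplus>\<^bsub>T\<^esub>j\<in>J. pure (m i) (n j \<triangleleft>\<^bsub>N\<^esub> \<psi> j (\<phi> i y \<odot>\<^bsub>N\<^esub> z))) =
          pure (m i) (\<Oplus>\<^bsub>N\<^esub>j\<in>J. n j \<triangleleft>\<^bsub>N\<^esub> \<psi> j (\<phi> i y \<odot>\<^bsub>N\<^esub> z))"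
        by (rule abelian_group_hom.hom_finsum[symmetric])
          (use \<phi>z[OF i] in \<open>auto intro!: t.ract_closed t.basis_closed simp: t.finite_index\<close>)
      also have "\<dots> = pure (m i) (\<phi> i y \<odot>\<^bsub>N\<^esub> z)" using t.expansion[OF \<phi>z[OF i]] by simp
      also have "\<dots> = pure (m i \<triangleleft>\<^bsub>M\<^esub> \<phi> i y) z"
        using i y z by (simp add: pure_balanced s.basis_closed)
      finally show "(\<Oplus>\<^bsub>T\<^esub>j\<in>J. pure (m i) (n j \<triangleleft>\<^bsub>N\<^esub> \<psi> j (\<phi> i y \<odot>\<^bsub>N\<^esub> z))) = pure (m i \<triangleleft>\<^bsub>M\<^esub> \<phi> i y) z" .
    qed (use y z in \<open>auto intro!: pure_closed s.ract_closed s.basis_closed\<close>)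
    also have "\<dots> = pure (\<Oplus>\<^bsub>M\<^esub>i\<in>I. m i \<triangleleft>\<^bsub>M\<^esub> \<phi> i y) z"
    proof (rule abelian_group_hom.hom_finsum[symmetric, where h = "\<lambda>y. pure y z"])
      show "abelian_group_hom M T (\<lambda>y. pure y z)"
        by (rule abelian_group_homI')
          (use z in \<open>auto simp: pure_add_left pure_closed abelian_group_tensor s.M.abelian_group_axioms\<close>)
    qed (use y in \<open>auto intro!: s.ract_closed s.basis_closed simp: s.finite_index\<close>)
    also have "\<dots> = pure y z" using s.expansion[OF y] by simp
    finally show "pure y z = (\<Oplus>\<^bsub>T\<^esub>p\<in>I\<times>J. x p \<triangleleft>\<^bsub>T\<^esub> h p (pure y z))" by simp
  qed
  have basis: "right_dual_basis A C T (I \<times> J) x h"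
    by (intro right_dual_basis.intro right_dual_basis_axioms.intro bimodule_tensor finite_cartesian_product
        s.finite_index t.finite_index xc h(1) hr exp)
  have hx: "h (i, k) (a \<odot>\<^bsub>T\<^esub> x (j, l)) = \<psi> k (\<phi> i (a \<odot>\<^bsub>M\<^esub> m j) \<odot>\<^bsub>N\<^esub> n l)"
    if "i \<in> I" "k \<in> J" "j \<in> I" "l \<in> J" "a \<in> carrier A" for i j k l a
    using that by (simp add: x_def lact_pure h(2) q_def s.basis_closed t.basis_closed s.lact_closed)
  have "trace_transfer T (I \<times> J) x h f a b = trace_transfer M I m \<phi> (trace_transfer N J n \<psi> f) a b"
    if a: "a \<in> carrier A" and b: "b \<in> carrier A" for f :: "'c \<Rightarrow> 'c \<Rightarrow> 'k" and a b
  proof -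
    have "trace_transfer T (I \<times> J) x h f a b =
       (\<Sum>i\<in>I. \<Sum>k\<in>J. \<Sum>j\<in>I. \<Sum>l\<in>J. f (\<psi> k (\<phi> i (a \<odot>\<^bsub>M\<^esub> m j) \<odot>\<^bsub>N\<^esub> n l)) (\<psi> l (\<phi> j (b \<odot>\<^bsub>M\<^esub> m i) \<odot>\<^bsub>N\<^esub> n k)))"
      unfolding mixed_trace_def trace_pairing_def sum.cartesian_product' by (simp add: hx a b)
    also have "\<dots> = (\<Sum>i\<in>I. \<Sum>j\<in>I. \<Sum>k\<in>J. \<Sum>l\<in>J. f (\<psi> k (\<phi> i (a \<odot>\<^bsub>M\<^esub> m j) \<odot>\<^bsub>N\<^esub> n l)) (\<psi> l (\<phi> j (b \<odot>\<^bsub>M\<^esub> m i) \<odot>\<^bsub>N\<^esub> n k)))"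
      by (intro sum.cong refl sum.swap)
    finally show ?thesis by (simp add: mixed_trace_def trace_pairing_def)
  qed
  from hx this show thesis by (rule that[OF basis])
qed

definition algebra_basis ::
  "('k::field, 'a) module \<Rightarrow> 'w set \<Rightarrow> ('w \<Rightarrow> 'a) \<Rightarrow> ('w \<Rightarrow> 'a \<Rightarrow> 'k) \<Rightarrow> bool" where
  "algebra_basis A W e coef \<longleftrightarrow> finite W \<and> (\<forall>w\<in>W. e w \<in> carrier A \<and> linear_form A (coef w)) \<and>
     (\<forall>a\<in>carrier A. a = (\<Oplus>\<^bsub>A\<^esub>w\<in>W. coef w a \<odot>\<^bsub>A\<^esub> e w))"

abbreviation free_bimodule :: "('k::field, 'a) module \<Rightarrow> ('a, 'a, ('a \<times> 'a \<Rightarrow>\<^sub>0 int) set) bimodule" where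
  "free_bimodule A \<equiv>
    tensor ground_field (left_part A (regular_bimodule A)) (right_part A (regular_bimodule A))"

text \<open>
  In \<open>A \<otimes>\<^sub>K A\<close> the elements \<open>e w \<otimes> 1\<close> form a right dual basis on which left multiplication has scalar
  coefficients, namely those of left multiplication on \<open>A\<close>.
\<close>

lemma free_bimodule_coordinates:
  fixes A :: "('k::field, 'a) module" and W :: "'w set"
  assumes A: "k_algebra A" and basis: "algebra_basis A W e coef"
  obtains x :: "'w \<times> unit \<Rightarrow> ('a \<times> 'a \<Rightarrow>\<^sub>0 int) set" and h
  where "right_dual_basis A A (free_bimodule A) (W \<times> UNIV) x h"
    "\<And>a p q. a \<in> carrier A \<Longrightarrow> p \<in> W \<times> UNIV \<Longrightarrow> q \<in> W \<times> UNIV \<Longrightarrow>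
       h p (a \<odot>\<^bsub>free_bimodule A\<^esub> x q) = coef (fst p) (a \<otimes>\<^bsub>A\<^esub> e (fst q)) \<odot>\<^bsub>A\<^esub> \<one>\<^bsub>A\<^esub>"
proof -
  interpret A: k_algebra A by (rule A)
  let ?L = "left_part A (regular_bimodule A)" and ?R = "right_part A (regular_bimodule A)"
  have L: "bimodule A ground_field ?L"
    by (rule bimodule.bimodule_left_part[OF A.bimodule_regular])
  interpret L: bimodule A ground_field ?L by (rule L)
  have R: "bimodule ground_field A ?R"
    by (rule bimodule.bimodule_right_part[OF A.bimodule_regular])
  interpret R: bimodule ground_field A ?R by (rule R)
  have rec: "carrier ?L = carrier A" "carrier ?R = carrier A" "add ?L = add A" "add ?R = add A"
    "ring.zero ?L = ring.zero A" "ring.zero ?R = ring.zero A" "module.smult ?L = monoid.mult A" "ract ?R = monoid.mult A"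
    "ract ?L = (\<lambda>m c. (c \<odot>\<^bsub>A\<^esub> \<one>\<^bsub>A\<^esub>) \<otimes>\<^bsub>A\<^esub> m)" "module.smult ?R = (\<lambda>c m. m \<otimes>\<^bsub>A\<^esub> (c \<odot>\<^bsub>A\<^esub> \<one>\<^bsub>A\<^esub>))"
    by (simp_all add: left_part_def right_part_def regular_bimodule_def)
  have W: "finite W" and ec: "\<And>w. w \<in> W \<Longrightarrow> e w \<in> carrier A" and coef: "\<And>w. w \<in> W \<Longrightarrow> linear_form A (coef w)"
    and exp: "\<And>a. a \<in> carrier A \<Longrightarrow> a = (\<Oplus>\<^bsub>A\<^esub>w\<in>W. coef w a \<odot>\<^bsub>A\<^esub> e w)"
    using basis unfolding algebra_basis_def by blast+
  have fs: "finsum ?L g K = finsum A g K" for g :: "'w \<Rightarrow> 'a" and K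
    by (simp add: finsum_def finprod_def rec)
  have ca: "coef w (a \<oplus>\<^bsub>A\<^esub> b) = coef w a + coef w b" "coef w (c \<odot>\<^bsub>A\<^esub> a) = c * coef w a"
    if "w \<in> W" "a \<in> carrier A" "b \<in> carrier A" for w a b c
    using coef[OF that(1)] that(2,3) by (simp_all add: linear_form_def)
  have s: "right_dual_basis A ground_field ?L W e coef"
  proof (intro right_dual_basis.intro right_dual_basis_axioms.intro L W)
    show "abelian_group_hom ?L ground_field (coef w)" if "w \<in> W" for w
      by (rule abelian_group_homI'[OF L.M.abelian_group_axioms L.B.is_abelian_group])
        (simp_all add: rec ca that)
    show "t = (\<Oplus>\<^bsub>?L\<^esub>w\<in>W. e w \<triangleleft>\<^bsub>?L\<^esub> coef w t)" if t: "t \<in> carrier ?L" for t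
    proof -
      have "(\<Oplus>\<^bsub>?L\<^esub>w\<in>W. e w \<triangleleft>\<^bsub>?L\<^esub> coef w t) = (\<Oplus>\<^bsub>A\<^esub>w\<in>W. coef w t \<odot>\<^bsub>A\<^esub> e w)"
        unfolding fs by (rule A.finsum_cong') (auto simp: rec ec A.smult_mult_left)
      then show ?thesis using exp[of t] t by (simp add: rec)
    qed
  qed (simp_all add: rec ec ca A.smult_mult_left)
  have "x = (\<Oplus>\<^bsub>?R\<^esub>u\<in>(UNIV :: unit set). \<one>\<^bsub>A\<^esub> \<triangleleft>\<^bsub>?R\<^esub> x)" if "x \<in> carrier A" for x
    using that by (simp add: UNIV_unit rec R.M.finsum_insert[of "{}"])
  then have t: "right_dual_basis ground_field A ?R (UNIV :: unit set) (\<lambda>_. \<one>\<^bsub>A\<^esub>) (\<lambda>_ t. t)"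
    by (intro right_dual_basis.intro right_dual_basis_axioms.intro R
        abelian_group_homI'[OF R.M.abelian_group_axioms A.is_abelian_group]) (simp_all add: rec)
  obtain x :: "'w \<times> unit \<Rightarrow> ('a \<times> 'a \<Rightarrow>\<^sub>0 int) set" and h
    where xh: "right_dual_basis A A (free_bimodule A) (W \<times> UNIV) x h"
      "\<And>i k j l a. i \<in> W \<Longrightarrow> k \<in> UNIV \<Longrightarrow> j \<in> W \<Longrightarrow> l \<in> UNIV \<Longrightarrow> a \<in> carrier A \<Longrightarrow>
        h (i, k) (a \<odot>\<^bsub>free_bimodule A\<^esub> x (j, l)) = coef i (a \<odot>\<^bsub>?L\<^esub> e j) \<odot>\<^bsub>?R\<^esub> \<one>\<^bsub>A\<^esub>"
    by (rule tensor_dual_basis[OF s t], rule that)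
  show thesis by (rule that[OF xh(1)]) (auto simp: xh(2) rec)
qed

lemma (in abelian_monoid) finsum_product_delta:
  assumes "finite I" "finite J" "i \<in> I" "\<And>j. j \<in> J \<Longrightarrow> y j \<in> carrier G"
    and "\<And>k j. k \<in> I \<Longrightarrow> j \<in> J \<Longrightarrow> x (k, j) = (if k = i then y j else \<zero>)"
  shows "(\<Oplus>p\<in>I\<times>J. x p) = (\<Oplus>j\<in>J. y j)"
proof -
  have "(\<Oplus>p\<in>I\<times>J. x p) = (\<Oplus>p\<in>I\<times>J. if fst p = i then y (snd p) else \<zero>)"
    by (rule finsum_cong') (use assms(4,5) in auto)
  also have "\<dots> = (\<Oplus>k\<in>I. \<Oplus>j\<in>J. if k = i then y j else \<zero>)"
    by (rule finsum_finsum_product[where x = "\<lambda>k j. if k = i then y j else \<zero>"]) (use assms in auto)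
  also have "\<dots> = (\<Oplus>k\<in>I. if i = k then (\<Oplus>j\<in>J. y j) else \<zero>)"
    by (rule finsum_cong') (use assms(4) in \<open>auto intro!: finsum_closed simp: finsum_zero\<close>)
  also have "\<dots> = (\<Oplus>j\<in>J. y j)"
    by (rule finsum_singleton[where f = "\<lambda>_. \<Oplus>j\<in>J. y j"]) (use assms in \<open>auto intro!: finsum_closed\<close>)
  finally show ?thesis .
qed

text \<open>
  The scalar matrices for \<open>A \<otimes>\<^sub>K A\<close> pass to every summand of finitely many copies: the block diagonal
  matrix \<open>L\<close> describes the action on the projected generators and on the restricted coordinates.
\<close>

lemma projective_bimodule_trace_zero:
  fixes A :: "('k::field, 'a) module" and P :: "('a, 'a, 'm) bimodule" and W :: "'w set"
  assumes A: "k_algebra A" and basis: "algebra_basis A W e coef"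
    and P: "bimodule A A P" and proj: "projective_bimodule A A P"
    and S: "finite S" "S \<subseteq> carrier P" "\<And>W. subbimodule A A W P \<Longrightarrow> S \<subseteq> W \<Longrightarrow> W = carrier P"
  obtains K :: "('m \<times> 'w \<times> unit) set" and y g where "right_dual_basis A A P K y g"
    "\<And>f a b. hochschild_cocycle A f \<Longrightarrow> a \<in> carrier A \<Longrightarrow> b \<in> carrier A \<Longrightarrow> trace_transfer P K y g f a b = 0"
proof -
  interpret A: k_algebra A by (rule A)
  interpret P: bimodule A A P by (rule P)
  let ?U = "free_bimodule A"
  define V where "V = W \<times> (UNIV :: unit set)"
  define cf where "cf p q a = coef (fst p) (a \<otimes>\<^bsub>A\<^esub> e (fst q))" for p q :: "'w \<times> unit" and a
  obtain x h where s: "right_dual_basis A A ?U V x h"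
    and hx: "\<And>a p q. a \<in> carrier A \<Longrightarrow> p \<in> V \<Longrightarrow> q \<in> V \<Longrightarrow> h p (a \<odot>\<^bsub>?U\<^esub> x q) = cf p q a \<odot>\<^bsub>A\<^esub> \<one>\<^bsub>A\<^esub>"
    by (rule free_bimodule_coordinates[OF A basis], rule that[unfolded V_def cf_def])
  interpret s: right_dual_basis A A ?U V x h by (rule s)
  \<comment> \<open>The scalar coefficients describe the action on generators and, by duality, on coordinates.\<close>
  have xl: "a \<odot>\<^bsub>?U\<^esub> x w = (\<Oplus>\<^bsub>?U\<^esub>v\<in>V. x v \<triangleleft>\<^bsub>?U\<^esub> (cf v w a \<odot>\<^bsub>A\<^esub> \<one>\<^bsub>A\<^esub>))"
    if a: "a \<in> carrier A" and w: "w \<in> V" for a w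
  proof -
    have "a \<odot>\<^bsub>?U\<^esub> x w = (\<Oplus>\<^bsub>?U\<^esub>v\<in>V. x v \<triangleleft>\<^bsub>?U\<^esub> h v (a \<odot>\<^bsub>?U\<^esub> x w))"
      by (rule s.expansion[OF s.lact_closed[OF a s.basis_closed[OF w]]])
    also have "\<dots> = (\<Oplus>\<^bsub>?U\<^esub>v\<in>V. x v \<triangleleft>\<^bsub>?U\<^esub> (cf v w a \<odot>\<^bsub>A\<^esub> \<one>\<^bsub>A\<^esub>))"
      by (rule s.M.finsum_cong') (auto simp: hx a w s.basis_closed intro!: s.ract_closed)
    finally show ?thesis .
  qed
  have hl: "h w (a \<odot>\<^bsub>?U\<^esub> t) = (\<Oplus>\<^bsub>A\<^esub>v\<in>V. (cf w v a \<odot>\<^bsub>A\<^esub> \<one>\<^bsub>A\<^esub>) \<otimes>\<^bsub>A\<^esub> h v t)"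
    if a: "a \<in> carrier A" and w: "w \<in> V" and t: "t \<in> carrier ?U" for a w t
  proof -
    have "h w ((a \<otimes>\<^bsub>A\<^esub> \<one>\<^bsub>A\<^esub>) \<odot>\<^bsub>?U\<^esub> t) = (\<Oplus>\<^bsub>A\<^esub>v\<in>V. h w (a \<odot>\<^bsub>?U\<^esub> x v) \<otimes>\<^bsub>A\<^esub> h v (\<one>\<^bsub>A\<^esub> \<odot>\<^bsub>?U\<^esub> t))"
      by (rule coordinates_mult[OF s s w t a A.one_closed])
    also have "\<dots> = (\<Oplus>\<^bsub>A\<^esub>v\<in>V. (cf w v a \<odot>\<^bsub>A\<^esub> \<one>\<^bsub>A\<^esub>) \<otimes>\<^bsub>A\<^esub> h v t)"
      by (rule A.finsum_cong') (use a w t in \<open>auto simp: hx s.lact_one\<close>)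
    finally show ?thesis using a by simp
  qed
  obtain J :: "'m set" and \<iota> \<pi> where J: "finite J"
    and \<iota>: "\<And>j. j \<in> J \<Longrightarrow> bimodule_hom A A P ?U (\<iota> j)"
    and \<pi>: "\<And>j. j \<in> J \<Longrightarrow> bimodule_hom A A ?U P (\<pi> j)"
    and exp: "\<And>p. p \<in> carrier P \<Longrightarrow> p = (\<Oplus>\<^bsub>P\<^esub>j\<in>J. \<pi> j (\<iota> j p))"
    by (rule finite_retraction[OF P s.bimodule_axioms proj[unfolded projective_bimodule_def] S(1,2)], rule S(3), assumption, assumption, rule that)
  have \<iota>h: "abelian_group_hom P ?U (\<iota> j)" and \<pi>h: "abelian_group_hom ?U P (\<pi> j)" if "j \<in> J" for j
    using \<iota>[OF that] \<pi>[OF that] by (simp_all add: bimodule_hom_def)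
  have \<iota>c: "\<iota> j t \<in> carrier ?U" if "j \<in> J" "t \<in> carrier P" for j t
    using abelian_group_hom.hom_closed[OF \<iota>h] that by blast
  have \<pi>c: "\<pi> j t \<in> carrier P" if "j \<in> J" "t \<in> carrier ?U" for j t
    using abelian_group_hom.hom_closed[OF \<pi>h] that by blast
  have \<iota>a: "\<iota> j (t \<oplus>\<^bsub>P\<^esub> t') = \<iota> j t \<oplus>\<^bsub>?U\<^esub> \<iota> j t'" if "j \<in> J" "t \<in> carrier P" "t' \<in> carrier P" for j t t'
    using abelian_group_hom.hom_add[OF \<iota>h] that by blast
  have \<iota>l: "\<iota> j (a \<odot>\<^bsub>P\<^esub> t) = a \<odot>\<^bsub>?U\<^esub> \<iota> j t" "\<iota> j (t \<triangleleft>\<^bsub>P\<^esub> a) = \<iota> j t \<triangleleft>\<^bsub>?U\<^esub> a"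
    if "j \<in> J" "t \<in> carrier P" "a \<in> carrier A" for j t a
    using \<iota>[OF that(1)] that(2,3) by (simp_all add: bimodule_hom_def)
  have \<pi>l: "\<pi> j (a \<odot>\<^bsub>?U\<^esub> t) = a \<odot>\<^bsub>P\<^esub> \<pi> j t" "\<pi> j (t \<triangleleft>\<^bsub>?U\<^esub> a) = \<pi> j t \<triangleleft>\<^bsub>P\<^esub> a"
    if "j \<in> J" "t \<in> carrier ?U" "a \<in> carrier A" for j t a
    using \<pi>[OF that(1)] that(2,3) by (simp_all add: bimodule_hom_def)
  have \<pi>sum: "\<pi> j (\<Oplus>\<^bsub>?U\<^esub>w\<in>V. x w \<triangleleft>\<^bsub>?U\<^esub> c w) = (\<Oplus>\<^bsub>P\<^esub>w\<in>V. \<pi> j (x w) \<triangleleft>\<^bsub>P\<^esub> c w)"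
    if j: "j \<in> J" and c: "\<And>w. w \<in> V \<Longrightarrow> c w \<in> carrier A" for j c
  proof -
    have "\<pi> j (\<Oplus>\<^bsub>?U\<^esub>w\<in>V. x w \<triangleleft>\<^bsub>?U\<^esub> c w) = (\<Oplus>\<^bsub>P\<^esub>w\<in>V. \<pi> j (x w \<triangleleft>\<^bsub>?U\<^esub> c w))"
      by (rule abelian_group_hom.hom_finsum[OF \<pi>h[OF j] s.finite_index])
        (use c in \<open>simp add: s.ract_closed s.basis_closed\<close>)
    also have "\<dots> = (\<Oplus>\<^bsub>P\<^esub>w\<in>V. \<pi> j (x w) \<triangleleft>\<^bsub>P\<^esub> c w)"
      by (rule P.M.finsum_cong') (use j c in \<open>auto simp: \<pi>l s.basis_closed intro!: P.ract_closed \<pi>c\<close>)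
    finally show ?thesis .
  qed
  define y where "y p = \<pi> (fst p) (x (snd p))" for p
  define g where "g p t = h (snd p) (\<iota> (fst p) t)" for p t
  define L where "L p q a = (if fst p = fst q then cf (snd p) (snd q) a else 0)"
    for p q :: "'m \<times> 'w \<times> unit" and a
  have yc: "y p \<in> carrier P" if "p \<in> J \<times> V" for p
    using that by (auto simp: y_def intro!: \<pi>c s.basis_closed)
  have gc: "g p t \<in> carrier A" if "p \<in> J \<times> V" "t \<in> carrier P" for p t
    using that by (auto simp: g_def intro!: \<iota>c)
  have dual: "right_dual_basis A A P (J \<times> V) y g"
  proof (intro right_dual_basis.intro right_dual_basis_axioms.intro P finite_cartesian_product J s.finite_index yc)
    fix p assume p: "p \<in> J \<times> V"
    show "abelian_group_hom P A (g p)"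
      by (rule abelian_group_homI'[OF P.M.abelian_group_axioms A.is_abelian_group])
        (use p in \<open>auto simp: gc g_def \<iota>a s.coord_add \<iota>c\<close>)
    show "g p (t \<triangleleft>\<^bsub>P\<^esub> b) = g p t \<otimes>\<^bsub>A\<^esub> b" if "t \<in> carrier P" "b \<in> carrier A" for t b
      using p that by (auto simp: g_def \<iota>l s.coord_ract \<iota>c)
  next
    fix t assume t: "t \<in> carrier P"
    have "t = (\<Oplus>\<^bsub>P\<^esub>j\<in>J. \<pi> j (\<iota> j t))" by (rule exp[OF t])
    also have "\<dots> = (\<Oplus>\<^bsub>P\<^esub>j\<in>J. \<Oplus>\<^bsub>P\<^esub>w\<in>V. \<pi> j (x w) \<triangleleft>\<^bsub>P\<^esub> h w (\<iota> j t))"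
    proof (rule P.M.finsum_cong')
      fix j assume j: "j \<in> J"
      show "\<pi> j (\<iota> j t) = (\<Oplus>\<^bsub>P\<^esub>w\<in>V. \<pi> j (x w) \<triangleleft>\<^bsub>P\<^esub> h w (\<iota> j t))"
        using \<pi>sum[OF j, of "\<lambda>w. h w (\<iota> j t)"] s.expansion[OF \<iota>c[OF j t]] \<iota>c[OF j t] by simp
    qed (use t in \<open>auto intro!: P.M.finsum_closed P.ract_closed \<pi>c \<iota>c s.basis_closed\<close>)
    also have "\<dots> = (\<Oplus>\<^bsub>P\<^esub>p\<in>J \<times> V. \<pi> (fst p) (x (snd p)) \<triangleleft>\<^bsub>P\<^esub> h (snd p) (\<iota> (fst p) t))"
      by (rule P.M.finsum_finsum_product[symmetric])
        (use t in \<open>auto simp: J s.finite_index intro!: P.ract_closed \<pi>c \<iota>c s.basis_closed\<close>)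
    finally show "t = (\<Oplus>\<^bsub>P\<^esub>p\<in>J \<times> V. y p \<triangleleft>\<^bsub>P\<^esub> g p t)" by (simp add: y_def g_def)
  qed
  have ly: "a \<odot>\<^bsub>P\<^esub> y q = (\<Oplus>\<^bsub>P\<^esub>p\<in>J \<times> V. y p \<triangleleft>\<^bsub>P\<^esub> (L p q a \<odot>\<^bsub>A\<^esub> \<one>\<^bsub>A\<^esub>))"
    if a: "a \<in> carrier A" and q: "q \<in> J \<times> V" for a q
  proof -
    obtain j w where jw: "q = (j, w)" "j \<in> J" "w \<in> V" using q by auto
    have "a \<odot>\<^bsub>P\<^esub> y q = (\<Oplus>\<^bsub>P\<^esub>v\<in>V. \<pi> j (x v) \<triangleleft>\<^bsub>P\<^esub> (cf v w a \<odot>\<^bsub>A\<^esub> \<one>\<^bsub>A\<^esub>))"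
      using \<pi>l(1)[of j "x w" a] xl[OF a jw(3)] \<pi>sum[OF jw(2), of "\<lambda>v. cf v w a \<odot>\<^bsub>A\<^esub> \<one>\<^bsub>A\<^esub>"] a jw
      by (simp add: y_def s.basis_closed)
    also have "\<dots> = (\<Oplus>\<^bsub>P\<^esub>p\<in>J \<times> V. y p \<triangleleft>\<^bsub>P\<^esub> (L p q a \<odot>\<^bsub>A\<^esub> \<one>\<^bsub>A\<^esub>))"
    proof (rule P.M.finsum_product_delta[symmetric, where i = j])
      have z: "(0 \<odot>\<^bsub>A\<^esub> \<one>\<^bsub>A\<^esub>) = \<zero>\<^bsub>A\<^esub>"
        using A.smult_l_null[of "\<one>\<^bsub>A\<^esub>"] by (simp add: ring_of_type_algebra_def)
      have "t \<triangleleft>\<^bsub>P\<^esub> \<zero>\<^bsub>A\<^esub> = \<zero>\<^bsub>P\<^esub>" if "t \<in> carrier P" for t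
        using abelian_group_hom.hom_zero[OF P.ract_hom_right[OF that]] .
      then show "y (k, v) \<triangleleft>\<^bsub>P\<^esub> (L (k, v) q a \<odot>\<^bsub>A\<^esub> \<one>\<^bsub>A\<^esub>) =
          (if k = j then \<pi> j (x v) \<triangleleft>\<^bsub>P\<^esub> (cf v w a \<odot>\<^bsub>A\<^esub> \<one>\<^bsub>A\<^esub>) else \<zero>\<^bsub>P\<^esub>)"
        if "k \<in> J" "v \<in> V" for k v
        using that \<pi>c[of k "x v"] s.basis_closed[of v] by (simp add: y_def L_def jw(1) z)
    qed (use jw in \<open>auto simp: J s.finite_index intro!: P.ract_closed \<pi>c s.basis_closed\<close>)
    finally show ?thesis .
  qed
  have gl: "g p (a \<odot>\<^bsub>P\<^esub> t) = (\<Oplus>\<^bsub>A\<^esub>q\<in>J \<times> V. (L p q a \<odot>\<^bsub>A\<^esub> \<one>\<^bsub>A\<^esub>) \<otimes>\<^bsub>A\<^esub> g q t)"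
    if a: "a \<in> carrier A" and p: "p \<in> J \<times> V" and t: "t \<in> carrier P" for a p t
  proof -
    obtain j w where jw: "p = (j, w)" "j \<in> J" "w \<in> V" using p by auto
    have "g p (a \<odot>\<^bsub>P\<^esub> t) = (\<Oplus>\<^bsub>A\<^esub>v\<in>V. (cf w v a \<odot>\<^bsub>A\<^esub> \<one>\<^bsub>A\<^esub>) \<otimes>\<^bsub>A\<^esub> h v (\<iota> j t))"
      using hl[OF a jw(3) \<iota>c[OF jw(2) t]] a jw t by (simp add: g_def \<iota>l)
    also have "\<dots> = (\<Oplus>\<^bsub>A\<^esub>q\<in>J \<times> V. (L p q a \<odot>\<^bsub>A\<^esub> \<one>\<^bsub>A\<^esub>) \<otimes>\<^bsub>A\<^esub> g q t)"
    proof (rule A.finsum_product_delta[symmetric, where i = j])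
      have z: "(0 \<odot>\<^bsub>A\<^esub> \<one>\<^bsub>A\<^esub>) = \<zero>\<^bsub>A\<^esub>"
        using A.smult_l_null[of "\<one>\<^bsub>A\<^esub>"] by (simp add: ring_of_type_algebra_def)
      show "(L p (k, v) a \<odot>\<^bsub>A\<^esub> \<one>\<^bsub>A\<^esub>) \<otimes>\<^bsub>A\<^esub> g (k, v) t =
          (if k = j then (cf w v a \<odot>\<^bsub>A\<^esub> \<one>\<^bsub>A\<^esub>) \<otimes>\<^bsub>A\<^esub> h v (\<iota> j t) else \<zero>\<^bsub>A\<^esub>)"
        if "k \<in> J" "v \<in> V" for k v
        using that gc[of "(k, v)"] t by (auto simp: g_def L_def jw(1) z)
    qed (use jw t in \<open>auto simp: J s.finite_index intro!: A.m_closed \<iota>c\<close>)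
    finally show ?thesis .
  qed
  have "trace_transfer P (J \<times> V) y g f a b = 0"
    if "hochschild_cocycle A f" "a \<in> carrier A" "b \<in> carrier A" for f a b
    by (rule trace_transfer_scalar_action[OF that(1) dual ly gl that(2,3)])
  then show thesis using that dual by blast
qed

lemma (in bimodule) subbimodule_finsum:
  assumes "subbimodule A B W M" "finite I" "\<And>i. i \<in> I \<Longrightarrow> x i \<in> W"
  shows "(\<Oplus>\<^bsub>M\<^esub>i\<in>I. x i) \<in> W"
proof -
  interpret W: additive_subgroup W M using assms(1) by (simp add: subbimodule_def)
  have "W \<subseteq> carrier M" by (rule W.a_subset)
  show ?thesis using assms(2,3)
  proof (induction I rule: finite_induct)
    case empty then show ?case by simp
  next
    case (insert i I)
    then have "x \<in> I \<rightarrow> carrier M" "x i \<in> carrier M" using \<open>W \<subseteq> carrier M\<close> by blast+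
    then show ?case using insert by simp
  qed
qed

text \<open>
  Adjoining the generator \<open>(1, 0)\<close> of the regular summand makes all matrices block diagonal, and the block
  of the regular summand contributes \<open>f\<close> itself.
\<close>

lemma dual_basis_regular_sum:
  fixes A :: "('k::field, 'a) module" and P :: "('a, 'a, 'm) bimodule" and K :: "'i set"
  assumes A: "k_algebra A" and s: "right_dual_basis A A P K y g"
  obtains I :: "'i option set" and x h where
    "right_dual_basis A A (direct_sum (regular_bimodule A) P) I x h"
    "\<And>f a b. hochschild_cocycle A f \<Longrightarrow> a \<in> carrier A \<Longrightarrow> b \<in> carrier A \<Longrightarrow>
      trace_transfer (direct_sum (regular_bimodule A) P) I x h f a b = f a b + trace_transfer P K y g f a b"
proof -
  interpret A: k_algebra A by (rule A)
  interpret s: right_dual_basis A A P K y g by (rule s)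
  let ?D = "direct_sum (regular_bimodule A) P"
  interpret D: bimodule A A ?D by (rule bimodule_direct_sum[OF A.bimodule_regular s.bimodule_axioms])
  have rec: "carrier ?D = carrier A \<times> carrier P"
    "\<And>a b c d. (a, b) \<oplus>\<^bsub>?D\<^esub> (c, d) = (a \<oplus>\<^bsub>A\<^esub> c, b \<oplus>\<^bsub>P\<^esub> d)"
    "\<And>a b c. a \<odot>\<^bsub>?D\<^esub> (b, c) = (a \<otimes>\<^bsub>A\<^esub> b, a \<odot>\<^bsub>P\<^esub> c)"
    "\<And>a b c. (b, c) \<triangleleft>\<^bsub>?D\<^esub> a = (b \<otimes>\<^bsub>A\<^esub> a, c \<triangleleft>\<^bsub>P\<^esub> a)"
    by (simp_all add: direct_sum_def regular_bimodule_def)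
  define x where "x r = (case r of None \<Rightarrow> (\<one>\<^bsub>A\<^esub>, \<zero>\<^bsub>P\<^esub>) | Some k \<Rightarrow> (\<zero>\<^bsub>A\<^esub>, y k))" for r
  define h where "h r d = (case r of None \<Rightarrow> fst d | Some k \<Rightarrow> g k (snd d))" for r d
  let ?I = "insert None (Some ` K)"
  have xc: "x r \<in> carrier ?D" if "r \<in> ?I" for r
    using that by (auto simp: x_def rec s.basis_closed)
  have hc: "h r d \<in> carrier A" if "r \<in> ?I" "d \<in> carrier ?D" for r d
    using that by (auto simp: h_def rec)
  have "right_dual_basis A A ?D ?I x h"
  proof (intro right_dual_basis.intro right_dual_basis_axioms.intro D.bimodule_axioms xc)
    show "finite ?I" using s.finite_index by simp
  next
    fix r assume r: "r \<in> ?I"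
    show "abelian_group_hom ?D A (h r)"
      by (rule abelian_group_homI'[OF D.M.abelian_group_axioms A.is_abelian_group])
        (use r in \<open>auto simp: h_def rec s.coord_add\<close>)
    show "h r (t \<triangleleft>\<^bsub>?D\<^esub> b) = h r t \<otimes>\<^bsub>A\<^esub> b" if "t \<in> carrier ?D" "b \<in> carrier A" for t b
      using r that by (auto simp: h_def rec s.coord_ract)
  next
    fix d assume d: "d \<in> carrier ?D"
    obtain a p where ap: "d = (a, p)" "a \<in> carrier A" "p \<in> carrier P" using d by (auto simp: rec)
    have inj: "inj_on Some K" by simp
    have i: "abelian_group_hom P ?D (\<lambda>p. (\<zero>\<^bsub>A\<^esub>, p))"
      by (rule abelian_group_homI') (auto simp: rec s.M.abelian_group_axioms D.M.abelian_group_axioms)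
    have "(\<Oplus>\<^bsub>?D\<^esub>r\<in>?I. x r \<triangleleft>\<^bsub>?D\<^esub> h r d) =
        x None \<triangleleft>\<^bsub>?D\<^esub> h None d \<oplus>\<^bsub>?D\<^esub> (\<Oplus>\<^bsub>?D\<^esub>r\<in>Some ` K. x r \<triangleleft>\<^bsub>?D\<^esub> h r d)"
    proof (rule D.M.finsum_insert)
      show "finite (Some ` K)" using s.finite_index by simp
      show "(\<lambda>r. x r \<triangleleft>\<^bsub>?D\<^esub> h r d) \<in> Some ` K \<rightarrow> carrier ?D"
        by (rule Pi_I) (use xc hc d in \<open>simp add: D.ract_closed\<close>)
      show "x None \<triangleleft>\<^bsub>?D\<^esub> h None d \<in> carrier ?D"
        by (rule D.ract_closed) (use xc hc d in simp_all)
    qed simp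
    also have "(\<Oplus>\<^bsub>?D\<^esub>r\<in>Some ` K. x r \<triangleleft>\<^bsub>?D\<^esub> h r d) = (\<Oplus>\<^bsub>?D\<^esub>k\<in>K. x (Some k) \<triangleleft>\<^bsub>?D\<^esub> h (Some k) d)"
    proof (rule D.M.finsum_reindex[OF _ inj])
      show "(\<lambda>r. x r \<triangleleft>\<^bsub>?D\<^esub> h r d) \<in> Some ` K \<rightarrow> carrier ?D"
        by (rule Pi_I) (use xc hc d in \<open>simp add: D.ract_closed\<close>)
    qed
    also have "\<dots> = (\<Oplus>\<^bsub>?D\<^esub>k\<in>K. (\<zero>\<^bsub>A\<^esub>, y k \<triangleleft>\<^bsub>P\<^esub> g k p))"
      by (rule D.M.finsum_cong')
        (use ap in \<open>auto simp: x_def h_def rec s.basis_closed intro!: s.ract_closed\<close>)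
    also have "\<dots> = (\<zero>\<^bsub>A\<^esub>, \<Oplus>\<^bsub>P\<^esub>k\<in>K. y k \<triangleleft>\<^bsub>P\<^esub> g k p)"
      by (rule abelian_group_hom.hom_finsum[OF i s.finite_index, symmetric])
        (use ap in \<open>auto simp: s.basis_closed intro!: s.ract_closed\<close>)
    also have "\<dots> = (\<zero>\<^bsub>A\<^esub>, p)" using s.expansion[OF ap(3)] by simp
    also have "x None \<triangleleft>\<^bsub>?D\<^esub> h None d \<oplus>\<^bsub>?D\<^esub> (\<zero>\<^bsub>A\<^esub>, p) = d"
      using ap by (simp add: x_def h_def rec)
    finally show "d = (\<Oplus>\<^bsub>?D\<^esub>r\<in>?I. x r \<triangleleft>\<^bsub>?D\<^esub> h r d)" by simp
  qed
  moreover have "trace_transfer ?D ?I x h f a b = f a b + trace_transfer P K y g f a b"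
    if f: "hochschild_cocycle A f" and a: "a \<in> carrier A" and b: "b \<in> carrier A" for f a b
  proof -
    interpret f: hochschild_cocycle A f by (rule f)
    have z: "f c \<zero>\<^bsub>A\<^esub> = 0" "f \<zero>\<^bsub>A\<^esub> c = 0" if "c \<in> carrier A" for c
      using A.linear_form_finsum[OF f.linear_right[OF that], of "{}"]
        A.linear_form_finsum[OF f.linear_left[OF that], of "{}"] by simp_all
    have gz: "g k \<zero>\<^bsub>P\<^esub> = \<zero>\<^bsub>A\<^esub>" if "k \<in> K" for k
      by (rule abelian_group_hom.hom_zero[OF s.coord_hom[OF that]])
    have sum: "(\<Sum>r\<in>?I. F r) = F None + (\<Sum>k\<in>K. F (Some k))" for F :: "'i option \<Rightarrow> 'k"
      using s.finite_index by (simp add: sum.reindex)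
    show ?thesis
      using a b by (simp add: mixed_trace_def trace_pairing_def sum x_def h_def rec z gz s.basis_closed s.lact_closed)
  qed
  ultimately show thesis by (rule that)
qed

text \<open>
  The two dual bases of \<open>M \<otimes> N \<cong> A \<oplus> P\<close>, one from the factors and one from the summands, give transfers
  that agree up to a coboundary. For the second one \<open>P\<close> has to be finitely generated; it is generated by the
  components of the generators of \<open>M \<otimes> N\<close>.
\<close>

theorem stable_equivalence_transfer:
  fixes A :: "('k::field, 'a) module" and B :: "('k, 'b) module" and W :: "'w set"
  assumes st: "stably_equivalent_Morita TYPE('u) A B" and basis: "algebra_basis A W e coef"
  obtains M :: "('a, 'b, 'u) bimodule" and N :: "('b, 'a, 'u) bimodule"
    and I :: "'u set" and m \<phi> and J :: "'u set" and n \<psi>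
  where "right_dual_basis A B M I m \<phi>" "right_dual_basis B A N J n \<psi>"
    "\<And>f. hochschild_cocycle A f \<Longrightarrow> hochschild_coboundary A
      (\<lambda>a b. trace_transfer M I m \<phi> (trace_transfer N J n \<psi> f) a b - f a b)"
proof -
  obtain M :: "('a, 'b, 'u) bimodule" and N :: "('b, 'a, 'u) bimodule" and P :: "('a, 'a, 'u) bimodule"
    where M: "bimodule A B M" "fg_projective_right B M" and N: "bimodule B A N" "fg_projective_right A N"
      and P: "bimodule A A P" "projective_bimodule A A P"
      and iso: "bimodule_iso A A (tensor B M N) (direct_sum (regular_bimodule A) P)"
    using st unfolding stably_equivalent_Morita_def by (elim exE conjE)
  interpret M: bimodule A B M by (rule M)
  interpret P: bimodule A A P by (rule P)
  have A: "k_algebra A" by (rule M.A.k_algebra_axioms)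
  obtain I :: "'u set" and m \<phi> where s: "right_dual_basis A B M I m \<phi>"
    by (rule dual_basis_of_fg_projective[OF M])
  obtain J :: "'u set" and n \<psi> where t: "right_dual_basis B A N J n \<psi>"
    by (rule dual_basis_of_fg_projective[OF N])
  interpret s: right_dual_basis A B M I m \<phi> by (rule s)
  interpret t: right_dual_basis B A N J n \<psi> by (rule t)
  let ?D = "direct_sum (regular_bimodule A) P" and ?T = "tensor B M N"
  have D: "bimodule A A ?D" by (rule bimodule_direct_sum[OF M.A.bimodule_regular P(1)])
  interpret D: bimodule A A ?D by (rule D)
  have T: "bimodule A A ?T"
    by (rule bimodule_pair.bimodule_tensor[OF bimodule_pair.intro[OF M(1) N(1)]])
  obtain x h where xh: "right_dual_basis A A ?T (I \<times> J) x h"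
    "\<And>i k j l a. i \<in> I \<Longrightarrow> k \<in> J \<Longrightarrow> j \<in> I \<Longrightarrow> l \<in> J \<Longrightarrow> a \<in> carrier A \<Longrightarrow>
      h (i, k) (a \<odot>\<^bsub>?T\<^esub> x (j, l)) = \<psi> k (\<phi> i (a \<odot>\<^bsub>M\<^esub> m j) \<odot>\<^bsub>N\<^esub> n l)"
    "\<And>(f :: 'a \<Rightarrow> 'a \<Rightarrow> 'k) a b. a \<in> carrier A \<Longrightarrow> b \<in> carrier A \<Longrightarrow>
      trace_transfer ?T (I \<times> J) x h f a b = trace_transfer M I m \<phi> (trace_transfer N J n \<psi> f) a b"
    by (rule tensor_dual_basis[OF s t], rule that)
  obtain \<theta> \<eta> where \<theta>: "bimodule_hom A A ?T ?D \<theta>" "bimodule_hom A A ?D ?T \<eta>"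
    "\<And>u. u \<in> carrier ?T \<Longrightarrow> \<eta> (\<theta> u) = u" "\<And>d. d \<in> carrier ?D \<Longrightarrow> \<theta> (\<eta> d) = d"
    by (rule bimodule_iso_inverse[OF T D iso], rule that)
  \<comment> \<open>Both dual bases are placed on \<open>A \<oplus> P\<close>, which is a bimodule by construction.\<close>
  define x' where "x' p = \<theta> (x p)" for p
  define h' where "h' p d = h p (\<eta> d)" for p d
  have s1: "right_dual_basis A A ?D (I \<times> J) x' h'"
    unfolding x'_def h'_def by (rule transport_dual_basis(1)[OF xh(1) D \<theta>])
  have tr1: "trace_transfer ?D (I \<times> J) x' h' f a b = trace_transfer M I m \<phi> (trace_transfer N J n \<psi> f) a b"
    if "a \<in> carrier A" "b \<in> carrier A" for f :: "'a \<Rightarrow> 'a \<Rightarrow> 'k" and a b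
    unfolding x'_def h'_def by (rule trans[OF transport_dual_basis(2)[OF xh(1) D \<theta> that] xh(3)[OF that]])
  interpret s1: right_dual_basis A A ?D "I \<times> J" x' h' by (rule s1)
  have rec: "carrier ?D = carrier A \<times> carrier P" by (simp add: direct_sum_def regular_bimodule_def)
  have snd: "bimodule_hom A A ?D P snd"
    unfolding bimodule_hom_def
    by (intro conjI ballI abelian_group_homI' D.M.abelian_group_axioms P.M.abelian_group_axioms)
      (auto simp: direct_sum_def)
  define S where "S = (\<lambda>p. snd (x' p)) ` (I \<times> J)"
  have finS: "finite S" by (simp add: S_def s.finite_index t.finite_index)
  have SP: "S \<subseteq> carrier P" using s1.basis_closed unfolding rec S_def by fastforce
  have gen: "V = carrier P" if V: "subbimodule A A V P" and SV: "S \<subseteq> V" for V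
  proof
    show "V \<subseteq> carrier P" using V additive_subgroup.a_subset unfolding subbimodule_def by blast
    show "carrier P \<subseteq> V"
    proof
      fix p assume p: "p \<in> carrier P"
      then have d: "(\<zero>\<^bsub>A\<^esub>, p) \<in> carrier ?D" by (simp add: rec)
      have "p = snd (\<Oplus>\<^bsub>?D\<^esub>i\<in>I\<times>J. x' i \<triangleleft>\<^bsub>?D\<^esub> h' i (\<zero>\<^bsub>A\<^esub>, p))"
        using s1.expansion[OF d] by (metis snd_conv)
      also have "\<dots> = (\<Oplus>\<^bsub>P\<^esub>i\<in>I\<times>J. snd (x' i \<triangleleft>\<^bsub>?D\<^esub> h' i (\<zero>\<^bsub>A\<^esub>, p)))"
        by (rule abelian_group_hom.hom_finsum[OF _ s1.finite_index])
          (use snd d in \<open>auto simp: bimodule_hom_def s1.basis_closed intro!: D.ract_closed\<close>)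
      also have "\<dots> \<in> V"
      proof (rule P.subbimodule_finsum[OF V s1.finite_index])
        fix i assume i: "i \<in> I \<times> J"
        have "snd (x' i \<triangleleft>\<^bsub>?D\<^esub> h' i (\<zero>\<^bsub>A\<^esub>, p)) = snd (x' i) \<triangleleft>\<^bsub>P\<^esub> h' i (\<zero>\<^bsub>A\<^esub>, p)"
          using snd s1.basis_closed[OF i] s1.coord_closed[OF i d] by (simp add: bimodule_hom_def)
        moreover have "snd (x' i) \<in> V" using SV i by (auto simp: S_def)
        ultimately show "snd (x' i \<triangleleft>\<^bsub>?D\<^esub> h' i (\<zero>\<^bsub>A\<^esub>, p)) \<in> V"
          using V s1.coord_closed[OF i d] by (simp add: subbimodule_def)
      qed
      finally show "p \<in> V" .
    qed
  qed
  obtain K :: "('u \<times> 'w \<times> unit) set" and y g where yg: "right_dual_basis A A P K y g"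
    "\<And>f a b. hochschild_cocycle A f \<Longrightarrow> a \<in> carrier A \<Longrightarrow> b \<in> carrier A \<Longrightarrow> trace_transfer P K y g f a b = 0"
    by (rule projective_bimodule_trace_zero[OF A basis P finS SP], rule gen, assumption, assumption, rule that)
  obtain L :: "('u \<times> 'w \<times> unit) option set" and z l where zl: "right_dual_basis A A ?D L z l"
    "\<And>f a b. hochschild_cocycle A f \<Longrightarrow> a \<in> carrier A \<Longrightarrow> b \<in> carrier A \<Longrightarrow>
      trace_transfer ?D L z l f a b = f a b + trace_transfer P K y g f a b"
    by (rule dual_basis_regular_sum[OF A yg(1)], rule that)
  show thesis
  proof (rule that[OF s t])
    fix f assume f: "hochschild_cocycle A f"
    obtain G where G: "linear_form A G"
      "\<And>a b. a \<in> carrier A \<Longrightarrow> b \<in> carrier A \<Longrightarrow>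
        trace_transfer ?D (I \<times> J) x' h' f a b - trace_transfer ?D L z l f a b = G (a \<otimes>\<^bsub>A\<^esub> b) - G (b \<otimes>\<^bsub>A\<^esub> a)"
      using trace_transfer_independent[OF f zl(1) s1] unfolding hochschild_coboundary_def by (elim exE conjE) simp
    show "hochschild_coboundary A (\<lambda>a b. trace_transfer M I m \<phi> (trace_transfer N J n \<psi> f) a b - f a b)"
      unfolding hochschild_coboundary_def
    proof (intro exI[of _ G] conjI G(1) ballI)
      fix a b assume ab: "a \<in> carrier A" "b \<in> carrier A"
      show "trace_transfer M I m \<phi> (trace_transfer N J n \<psi> f) a b - f a b = G (a \<otimes>\<^bsub>A\<^esub> b) - G (b \<otimes>\<^bsub>A\<^esub> a)"
        using G(2)[OF ab] tr1[OF ab] zl(2)[OF f ab] yg(2)[OF f ab] by simp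
    qed
  qed
qed

section \<open>Normal forms of words and the additional cocycle\<close>

fun other :: "letter \<Rightarrow> letter" where
  "other letter_x = letter_y" | "other letter_y = letter_x"

lemma neq_iff_other: "c \<noteq> d \<longleftrightarrow> d = other c"
  by (cases c; cases d) auto

lemma other_other [simp]: "other (other c) = c"
  by (cases c) auto

fun alternating :: "letter \<Rightarrow> nat \<Rightarrow> letter list" where
  "alternating c 0 = []"
| "alternating c (Suc n) = c # alternating (other c) n"

lemma length_alternating [simp]: "length (alternating c n) = n"
  by (induction n arbitrary: c) auto

lemma successively_alternating: "successively (\<noteq>) (alternating c n)"
proof (induction n arbitrary: c)
  case (Suc n)
  show ?case using Suc[of "other c"] by (cases n; cases c) auto
qed simp

lemma eq_alternating: "successively (\<noteq>) (c # w) \<Longrightarrow> c # w = alternating c (Suc (length w))"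
proof (induction w arbitrary: c)
  case (Cons d w)
  then have "c \<noteq> d" and "successively (\<noteq>) (d # w)" by simp_all
  moreover from this(1) have d: "d = other c" by (simp only: neq_iff_other)
  ultimately have "d # w = alternating d (Suc (length w))" by (intro Cons.IH)
  then show ?case unfolding d by simp
qed simp

lemma alternating_snoc: "alternating c (Suc n) = alternating c n @ [if even n then c else other c]"
proof (induction n arbitrary: c)
  case (Suc n)
  have "alternating c (Suc (Suc n)) = c # alternating (other c) (Suc n)" by (rule alternating.simps)
  also have "alternating (other c) (Suc n) = alternating (other c) n @ [if even n then other c else c]"
    using Suc[of "other c"] by simp
  finally show ?case by simp
qed simp

lemma alternating_append: "alternating c (m + n) = alternating c m @ alternating (if even m then c else other c) n"
  by (induction m arbitrary: c) auto

lemma finite_words: "finite {w :: letter list. length w \<le> n}"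
proof -
  have "(UNIV :: letter set) = {letter_x, letter_y}" using letter.exhaust by blast
  then have "finite (UNIV :: letter set)" by (metis finite.emptyI finite.insertI)
  then have "finite {w :: letter list. set w \<subseteq> UNIV \<and> length w \<le> n}" by (rule finite_lists_length_le)
  then show ?thesis by simp
qed

text \<open>
  The boolean \<open>e\<close> stands for the parameter \<open>d\<close>, which takes only the values \<open>0\<close> and \<open>1\<close>. For these
  values each word is zero or equal to a basis word, so that the algebra is the contracted algebra
  of a monoid with zero and can be studied on words alone.
\<close>

locale normal_forms =
  fixes k :: nat and e :: bool
  assumes k: "2 \<le> k"
begin

definition top :: "letter list" where "top = alternating letter_x (2 * k)"
definition top' :: "letter list" where "top' = alternating letter_y (2 * k)"

text \<open>
  \<open>None\<close> represents zero in the algebra.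
\<close>

definition nf :: "letter list \<Rightarrow> letter list option" where
  "nf w = (if successively (\<noteq>) w \<and> length w < 2 * k then Some w
     else if successively (\<noteq>) w \<and> length w = 2 * k \<or> w = [letter_x, letter_x] \<or> e \<and> w = [letter_y, letter_y]
     then Some top else None)"

definition normal_words :: "letter list set" where
  "normal_words = {w. nf w = Some w}"

lemma length_top [simp]: "length top = 2 * k" "length top' = 2 * k"
  by (simp_all add: top_def top'_def)

lemma top_alternates: "successively (\<noteq>) top" "successively (\<noteq>) top'"
  unfolding top_def top'_def by (rule successively_alternating)+

lemma nf_top [simp]: "nf top = Some top" "nf top' = Some top"
  using top_alternates by (simp_all add: nf_def)

lemma top_nonempty [simp]: "top \<noteq> []" "top' \<noteq> []"
  using k length_top by (metis length_0_conv mult_is_0 not_numeral_le_zero zero_neq_numeral)+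

lemma long_word: "length w > 2 * k \<Longrightarrow> nf w = None"
  using k by (auto simp: nf_def)

lemma nf_SomeD:
  assumes "nf w = Some v"
  shows "v = w \<or> v = top \<and> (w = top' \<or> w = [letter_x, letter_x] \<or> e \<and> w = [letter_y, letter_y])"
proof (cases "successively (\<noteq>) w \<and> length w = 2 * k")
  case True
  then obtain c u where "w = c # u" using k by (cases w) auto
  then have "w = alternating c (length w)" using eq_alternating[of c u] conjunct1[OF True] \<open>w = c # u\<close> by simp
  then have "w = alternating c (2 * k)" unfolding conjunct2[OF True] .
  moreover have "v = top" using assms True by (auto simp: nf_def split: if_splits)
  ultimately show ?thesis by (cases c) (auto simp: top_def top'_def)
qed (use assms in \<open>auto simp: nf_def split: if_splits\<close>)

lemma nf_idem:
  assumes "nf w = Some v" shows "nf v = Some v"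
  using nf_SomeD[OF assms] assms nf_top(1) by (elim disjE conjE) (simp_all only:)

lemma normal_wordsI: "nf w = Some v \<Longrightarrow> v \<in> normal_words"
  using nf_idem by (simp add: normal_words_def)

lemma finite_normal_words: "finite normal_words"
proof (rule finite_subset[OF _ finite_words[of "2 * k"]], clarify)
  fix w assume "w \<in> normal_words"
  then have "nf w = Some w" by (simp add: normal_words_def)
  moreover have "length w < 2 * k \<or> nf w = Some top \<or> nf w = None" using k by (auto simp: nf_def)
  ultimately have "length w < 2 * k \<or> w = top" by auto
  then show "length w \<le> 2 * k" using length_top(1) by auto
qed

lemma nf_Nil [simp]: "nf [] = Some []"
  using k by (simp add: nf_def)

lemma nf_letter [simp]: "nf [c] = Some [c]"
  using k by (simp add: nf_def)

text \<open>
  Multiplication is well defined on normal forms: every word of length above two that is not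
  alternating, and every word of length above \<open>2k\<close>, is zero.
\<close>

lemma nf_context: "nf (p @ w @ q) = (case nf w of None \<Rightarrow> None | Some v \<Rightarrow> nf (p @ v @ q))"
proof (cases "nf w")
  case None
  have "nf (p @ w @ q) = None"
  proof (cases "successively (\<noteq>) w")
    case True
    then have "length w > 2 * k" using None by (auto simp: nf_def split: if_splits)
    then show ?thesis by (intro long_word) simp
  next
    case False
    then have "\<not> successively (\<noteq>) (p @ w @ q)" by (simp add: successively_append_iff)
    moreover have "p @ w @ q \<noteq> [letter_x, letter_x]" "\<not> (e \<and> p @ w @ q = [letter_y, letter_y])"
      using False None by (auto simp: nf_def append_eq_Cons_conv split: if_splits)
    ultimately show ?thesis by (auto simp: nf_def)
  qed
  then show ?thesis using None by simp
next
  case (Some v)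
  consider "v = w" | "p = []" "q = []" | "v = top" "w = top' \<or> w = [letter_x, letter_x] \<or> w = [letter_y, letter_y]"
      "p \<noteq> [] \<or> q \<noteq> []"
    using nf_SomeD[OF Some] by blast
  then show ?thesis
  proof cases
    case 2 then show ?thesis using Some nf_idem by simp
  next
    case 3
    have pq: "length p + length q > 0" using 3(3) by auto
    have "nf (p @ v @ q) = None" by (rule long_word) (use pq 3(1) in auto)
    moreover have "nf (p @ w @ q) = None"
    proof (cases "w = top'")
      case True
      then show ?thesis by (intro long_word) (use pq in auto)
    next
      case False
      then have "\<not> successively (\<noteq>) w" "length w = 2" using 3(2) by auto
      then have "\<not> successively (\<noteq>) (p @ w @ q)" "length (p @ w @ q) \<noteq> 2"
        using pq by (auto simp: successively_append_iff)
      moreover from this(2) have "p @ w @ q \<noteq> [letter_x, letter_x]" "p @ w @ q \<noteq> [letter_y, letter_y]"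
        by (metis length_Cons list.size(3) numeral_2_eq_2)+
      ultimately show ?thesis by (simp add: nf_def)
    qed
    ultimately show ?thesis using Some by simp
  qed (use Some in simp)
qed

lemma nf_append_left: "nf (w @ q) = (case nf w of None \<Rightarrow> None | Some v \<Rightarrow> nf (v @ q))"
  using nf_context[of "[]" w q] by (cases "nf w") simp_all

lemma nf_append_right: "nf (p @ w) = (case nf w of None \<Rightarrow> None | Some v \<Rightarrow> nf (p @ v))"
  using nf_context[of p w "[]"] by (cases "nf w") simp_all

text \<open>
  The normal form of a word is reached by the defining relations. Here \<open>E\<close> is any relation "equal in
  the quotient" and \<open>Z\<close> any predicate "zero in the quotient" that hold for the defining relations and
  are stable under multiplication. The lemma is used for membership in the ideal and
  for the values of the additional cocycle.
\<close>

lemma reduction_induct: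
  fixes E :: "letter list \<Rightarrow> letter list \<Rightarrow> bool" and Z :: "letter list \<Rightarrow> bool"
  assumes refl: "\<And>w. E w w" and sym: "\<And>v w. E v w \<Longrightarrow> E w v"
    and Z_context: "\<And>p w q. Z w \<Longrightarrow> Z (p @ w @ q)"
    and EZ: "\<And>p v w q. E v w \<Longrightarrow> Z (p @ w @ q) \<Longrightarrow> Z (p @ v @ q)"
    and xx: "E [letter_x, letter_x] top"
    and yy: "e \<Longrightarrow> E [letter_y, letter_y] top" "\<not> e \<Longrightarrow> Z [letter_y, letter_y]"
    and tt: "E top top'"
    and tx: "Z (top @ [letter_x])" and ty: "Z (top' @ [letter_y])"
  shows "nf w = None \<Longrightarrow> Z w" and "nf w = Some v \<Longrightarrow> E w v"
proof -
  have topx: "top @ [letter_x] = letter_x # top'" and topy: "top' @ [letter_y] = letter_y # top"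
    unfolding top_def top'_def
    using alternating_snoc[of letter_x "2 * k"] alternating_snoc[of letter_y "2 * k"] by simp_all
  \<comment> \<open>Each of the two spellings \<open>(xy)\<^sup>k = (yx)\<^sup>k\<close> is annihilated by one letter, so the word is annihilated by both.\<close>
  have after: "Z (top @ [c])" for c
    using tx EZ[OF tt, of "[]" "[letter_y]"] ty by (cases c) simp_all
  have before: "Z (c # top)" for c
    using EZ[OF tt, of "[letter_x]" "[]"] tx ty topx topy by (cases c) simp_all
  have around: "Z (p @ top @ q)" if "p \<noteq> [] \<or> q \<noteq> []" for p q
  proof (cases q)
    case Nil
    with that have "p \<noteq> []" by simp
    then obtain p' c where "p = p' @ [c]" by (cases p rule: rev_cases) auto
    then show ?thesis using Z_context[OF before[of c], of p' q] Nil by simp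
  next
    case (Cons c q')
    then show ?thesis using Z_context[OF after[of c], of p q'] by simp
  qed
  show "E w v" if "nf w = Some v"
    using nf_SomeD[OF that] refl xx yy(1) sym[OF tt] by auto
  show "Z w" if None: "nf w = None"
  proof (cases "successively (\<noteq>) w")
    case True
    then have len: "length w > 2 * k" using None by (auto simp: nf_def split: if_splits)
    then obtain c u where cu: "w = c # u" by (cases w) auto
    have "w = alternating c (length w)" using eq_alternating[of c u] True cu by simp
    moreover obtain n where "length w = Suc (2 * k) + n" using len by (metis Suc_leI le_Suc_ex)
    ultimately have w: "w = alternating c (Suc (2 * k) + n)" by simp
    have "Z (alternating c (Suc (2 * k)))"
      unfolding alternating_snoc using tx ty by (cases c) (simp_all add: top_def top'_def)
    then show ?thesis
      unfolding w alternating_append[of c "Suc (2 * k)"]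
      using Z_context[of "alternating c (Suc (2 * k))" "[]"] by (simp only: append_Nil)
  next
    case False
    have "\<exists>p c q. w = p @ [c, c] @ q"
      using False
    proof (induction w)
      case (Cons a w)
      show ?case
      proof (cases "successively (\<noteq>) w")
        case True
        then obtain b w' where "w = b # w'" "a = b" using Cons.prems by (cases w) auto
        then have "a # w = [] @ [a, a] @ w'" by simp
        then show ?thesis by blast
      next
        case False
        then obtain p c q where "w = p @ [c, c] @ q" using Cons.IH by blast
        then have "a # w = (a # p) @ [c, c] @ q" by simp
        then show ?thesis by blast
      qed
    qed simp
    then obtain p c q where w: "w = p @ [c, c] @ q" by blast
    show ?thesis
    proof (cases "c = letter_y \<and> \<not> e")
      case True
      then show ?thesis unfolding w using Z_context[OF yy(2)] by simp
    next
      case False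
      then have E: "E [c, c] top" using xx yy(1) by (cases c) auto
      have "p \<noteq> [] \<or> q \<noteq> []" using None False w k by (cases c) (auto simp: nf_def split: if_splits)
      then show ?thesis unfolding w by (intro EZ[OF E] around)
    qed
  qed
qed

end

locale char2_normal_forms = normal_forms +
  fixes char2 :: "'k::field itself"
  assumes two_zero: "(2::'k) = 0"
begin

lemma double_zero: "(a::'k) + a = 0"
  using two_zero by (metis mult_2 mult_zero_left)

text \<open>
  The coefficient of \<open>(xy)\<^sup>k\<close> in \<open>q D(c)\<close>, where \<open>D(y) = 1\<close> and \<open>D(x) = (xy)\<^sup>k\<^sup>-\<^sup>1\<close>: the word \<open>q (xy)\<^sup>k\<^sup>-\<^sup>1\<close> equals
  \<open>(xy)\<^sup>k\<close> exactly for \<open>q = xy\<close>.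
\<close>

definition local_term :: "letter \<Rightarrow> letter list \<Rightarrow> 'k" where
  "local_term c q = of_bool (nf q = Some (case c of letter_x \<Rightarrow> [letter_x, letter_y] | letter_y \<Rightarrow> top))"

text \<open>
  The coefficient of \<open>(xy)\<^sup>k\<close> in \<open>u D(v)\<close>, computed by the Leibniz rule: by symmetry of the coefficient form,
  the factors of \<open>v\<close> to the right of the letter under \<open>D\<close> move in front of \<open>u\<close>.
\<close>

fun cyc :: "letter list \<Rightarrow> letter list \<Rightarrow> 'k" where
  "cyc u [] = 0"
| "cyc u (c # v) = local_term c (v @ u) + cyc (u @ [c]) v"

text \<open>
  This is the cocycle identity on the free algebra, where it holds by construction. The remaining work is to
  show that \<open>cyc\<close> descends to the quotient in both arguments.
\<close>

lemma cyc_append: "cyc u (v @ w) = cyc (w @ u) v + cyc (u @ v) w"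
  by (induction v arbitrary: u) (simp_all add: add.assoc)

lemma local_term_nf:
  assumes "nf u = nf u'"
  shows "local_term c (p @ u @ q) = local_term c (p @ u' @ q)"
  unfolding local_term_def using assms nf_context[of p u q] nf_context[of p u' q] by simp

lemma local_term_zero: "nf u = None \<Longrightarrow> local_term c (p @ u @ q) = 0"
  unfolding local_term_def using nf_context[of p u q] by simp

lemma cyc_left:
  "nf u = nf u' \<Longrightarrow> cyc u v = cyc u' v"
proof (induction v arbitrary: u u')
  case (Cons c v)
  have "nf (u @ [c]) = nf (u' @ [c])"
    using Cons.prems nf_append_left[of u "[c]"] nf_append_left[of u' "[c]"] by simp
  then show ?case
    using Cons.IH[of "u @ [c]" "u' @ [c]"] local_term_nf[OF Cons.prems, of c v "[]"] by simp
qed simp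

lemma cyc_left_zero: "nf u = None \<Longrightarrow> cyc u v = 0"
proof (induction v arbitrary: u)
  case (Cons c v)
  have "nf (u @ [c]) = None" using Cons.prems nf_append_left[of u "[c]"] by simp
  then show ?case using Cons.IH[of "u @ [c]"] local_term_zero[OF Cons.prems, of c v "[]"] by simp
qed simp

lemma cyc_sum: "cyc u v = (\<Sum>i<length v. local_term (v ! i) (drop (Suc i) v @ u @ take i v))"
proof (induction v arbitrary: u)
  case (Cons c v)
  show ?case by (simp add: Cons.IH sum.lessThan_Suc_shift del: sum.lessThan_Suc)
qed simp

lemma nf_eq_xy: "nf q = Some [letter_x, letter_y] \<longleftrightarrow> q = [letter_x, letter_y]"
proof
  have ne: "top \<noteq> [letter_x, letter_y]"
  proof
    assume "top = [letter_x, letter_y]"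
    then have "length top = 2" by simp
    then show False using length_top(1) k by simp
  qed
  assume "nf q = Some [letter_x, letter_y]"
  from nf_SomeD[OF this] ne show "q = [letter_x, letter_y]" by metis
next
  assume "q = [letter_x, letter_y]"
  then show "nf q = Some [letter_x, letter_y]" using k by (simp add: nf_def)
qed

lemma nf_eq_top: "length q > 2 \<Longrightarrow> nf q = Some top \<longleftrightarrow> successively (\<noteq>) q \<and> length q = 2 * k"
  using length_top(1) by (auto simp: nf_def split: if_splits)

lemma local_term_x: "local_term letter_x q = of_bool (q = [letter_x, letter_y])"
  by (simp add: local_term_def nf_eq_xy)

lemma local_term_y: "length q > 2 \<Longrightarrow> local_term letter_y q = of_bool (successively (\<noteq>) q \<and> length q = 2 * k)"
  by (simp add: local_term_def nf_eq_top)

lemma nth_alternating: "i < n \<Longrightarrow> alternating c n ! i = (if even i then c else other c)"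
  by (induction n arbitrary: c i) (auto simp: nth_Cons split: nat.splits)

text \<open>
  In the sum over the letters of \<open>(xy)\<^sup>k\<close>, a term is nonzero only if the rotated word is alternating of
  length \<open>2k\<close>. This forces \<open>u\<close> to be a single letter and the differentiated letter to be the last \<open>y\<close>; for
  \<open>(yx)\<^sup>k\<close> in the next lemma it is the first one.
\<close>

lemma cyc_top: "cyc u top = of_bool (u = [letter_y])"
proof -
  have "local_term (top ! i) (drop (Suc i) top @ u @ take i top) = (if i = 2 * k - 1 then of_bool (u = [letter_y]) else 0)"
    if i: "i < 2 * k" for i
  proof -
    let ?q = "drop (Suc i) top @ u @ take i top"
    have len: "length ?q = 2 * k - 1 + length u" using i by simp
    have nth: "top ! j = (if even j then letter_x else letter_y)" if "j < 2 * k" for j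
      using nth_alternating[OF that, of letter_x] by (simp add: top_def)
    show ?thesis
    proof (cases "even i")
      case True
      then have "i \<noteq> 2 * k - 1" using k by presburger
      moreover have "?q \<noteq> [letter_x, letter_y]"
      proof
        assume "?q = [letter_x, letter_y]"
        then have "length ?q = 2" by simp
        then show False using len k by linarith
      qed
      ultimately show ?thesis using True nth[OF i] by (simp add: local_term_x)
    next
      case False
      have "successively (\<noteq>) ?q \<and> length ?q = 2 * k \<longleftrightarrow> i = 2 * k - 1 \<and> u = [letter_y]"
      proof
        assume *: "successively (\<noteq>) ?q \<and> length ?q = 2 * k"
        then have "length u = 1" using len k by linarith
        then obtain a where a: "u = [a]" by (cases u) auto
        have tk: "take i top \<noteq> []" "hd (take i top) = letter_x"
          using False i nth[of 0] k by (auto simp: hd_conv_nth odd_pos)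
        have "a \<noteq> letter_x" using * tk by (auto simp: a successively_append_iff successively_Cons)
        then have ay: "a = letter_y" by (cases a) auto
        have "i = 2 * k - 1"
        proof (rule ccontr)
          assume "i \<noteq> 2 * k - 1"
          moreover have "last top = letter_y"
            using nth[of "2 * k - 1"] k by (simp add: last_conv_nth)
          ultimately have "drop (Suc i) top \<noteq> []" "last (drop (Suc i) top) = letter_y"
            using i by (simp_all add: last_drop)
          then show False using * by (auto simp: a ay successively_append_iff)
        qed
        then show "i = 2 * k - 1 \<and> u = [letter_y]" using a ay by simp
      next
        assume *: "i = 2 * k - 1 \<and> u = [letter_y]"
        have "take (2 * k - 1) top = alternating letter_x (2 * k - 1)"
          using alternating_append[of letter_x "2 * k - 1" 1] k by (simp add: top_def)
        then have "?q = alternating letter_y (Suc (2 * k - 1))" using * by simp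
        then show "successively (\<noteq>) ?q \<and> length ?q = 2 * k"
          using successively_alternating[of letter_y "Suc (2 * k - 1)"] k by simp
      qed
      moreover have "2 < length ?q" using len k by linarith
      ultimately show ?thesis using False nth[OF i] by (simp only: local_term_y if_False) auto
    qed
  qed
  then have "cyc u top = (\<Sum>i<2 * k. if i = 2 * k - 1 then of_bool (u = [letter_y]) else 0)"
    by (simp add: cyc_sum)
  also have "\<dots> = of_bool (u = [letter_y])" using k by (simp add: sum.delta)
  finally show ?thesis .
qed

lemma cyc_top': "cyc u top' = of_bool (u = [letter_y])"
proof -
  have "local_term (top' ! i) (drop (Suc i) top' @ u @ take i top') = (if i = 0 then of_bool (u = [letter_y]) else 0)"
    if i: "i < 2 * k" for i
  proof -
    let ?q = "drop (Suc i) top' @ u @ take i top'"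
    have len: "length ?q = 2 * k - 1 + length u" using i by simp
    have nth: "top' ! j = (if even j then letter_y else letter_x)" if "j < 2 * k" for j
      using nth_alternating[OF that, of letter_y] by (simp add: top'_def)
    show ?thesis
    proof (cases "even i")
      case False
      then have "i \<noteq> 0" by (metis even_zero)
      moreover have "?q \<noteq> [letter_x, letter_y]"
      proof
        assume "?q = [letter_x, letter_y]"
        then have "length ?q = 2" by simp
        then show False using len k by linarith
      qed
      ultimately show ?thesis using False nth[OF i] by (simp add: local_term_x)
    next
      case True
      have "i \<noteq> 2 * k - 1" using True k by presburger
      then have dr: "drop (Suc i) top' \<noteq> []" using i by simp
      have "last top' = letter_x" using nth[of "2 * k - 1"] k by (simp add: last_conv_nth)
      with dr have last: "last (drop (Suc i) top') = letter_x" by (simp add: last_drop)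
      have "successively (\<noteq>) ?q \<and> length ?q = 2 * k \<longleftrightarrow> i = 0 \<and> u = [letter_y]"
      proof
        assume *: "successively (\<noteq>) ?q \<and> length ?q = 2 * k"
        then have "length u = 1" using len k by linarith
        then obtain a where a: "u = [a]" by (cases u) auto
        have "a \<noteq> letter_x" using * dr last by (auto simp: a successively_append_iff)
        then have ay: "a = letter_y" by (cases a) auto
        have "i = 0"
        proof (rule ccontr)
          assume "i \<noteq> 0"
          then have "take i top' \<noteq> []" "hd (take i top') = letter_y"
            using nth[of 0] k by (auto simp: hd_conv_nth)
          then show False using * by (auto simp: a ay successively_append_iff successively_Cons)
        qed
        then show "i = 0 \<and> u = [letter_y]" using a ay by simp
      next
        assume *: "i = 0 \<and> u = [letter_y]"
        have "top' = letter_y # alternating letter_x (2 * k - 1)"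
          using k by (cases "2 * k") (simp_all add: top'_def)
        then have "?q = alternating letter_x (2 * k - 1) @ [letter_y]" using * by simp
        also have "\<dots> = alternating letter_x (Suc (2 * k - 1))"
          using k by (simp only: alternating_snoc) auto
        finally show "successively (\<noteq>) ?q \<and> length ?q = 2 * k"
          using successively_alternating[of letter_x "Suc (2 * k - 1)"] k by simp
      qed
      moreover have "2 < length ?q" using len k by linarith
      ultimately show ?thesis using True nth[OF i] by (simp only: local_term_y if_True) auto
    qed
  qed
  then have "cyc u top' = (\<Sum>i<2 * k. if i = 0 then of_bool (u = [letter_y]) else 0)"
    by (simp add: cyc_sum)
  also have "\<dots> = of_bool (u = [letter_y])" using k by (simp add: sum.delta)
  finally show ?thesis .
qed

lemma cyc_context: "cyc u (p @ w @ q) = cyc (w @ q @ u) p + cyc (q @ u @ p) w + cyc (u @ p @ w) q"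
  using cyc_append[of u p "w @ q"] cyc_append[of "u @ p" w q] by simp

text \<open>
  Both \<open>Z\<close> and \<open>E\<close> quantify over contexts, which makes them stable under multiplication. By \<open>cyc_append\<close> and
  well-definedness in the first argument, the relations need only be checked without context; the
  relations \<open>y\<^sup>2 = 0\<close> and \<open>(yx)\<^sup>k y = 0\<close> hold because two equal terms cancel in characteristic 2.
\<close>

lemma cyc_nf:
  assumes e: "\<not> e"
  shows "cyc u v = (case nf v of None \<Rightarrow> 0 | Some t \<Rightarrow> cyc u t)"
proof -
  define Z where "Z w \<longleftrightarrow> nf w = None \<and> (\<forall>u p q. cyc u (p @ w @ q) = 0)" for w
  define E where "E w v \<longleftrightarrow> nf w = nf v \<and> (\<forall>u p q. cyc u (p @ w @ q) = cyc u (p @ v @ q))" for w v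
  have ZI: "Z w" if w: "nf w = None" "\<And>u. cyc u w = 0" for w
  proof -
    have "nf (w @ q @ u) = None" "nf (u @ p @ w) = None" for u p q
      using w nf_append_left[of w "q @ u"] nf_append_right[of "u @ p" w] by simp_all
    then show ?thesis using w by (simp add: Z_def cyc_context cyc_left_zero)
  qed
  have EI: "E w v" if w: "nf w = nf v" "\<And>u. cyc u w = cyc u v" for w v
  proof -
    have nf: "nf (w @ q @ u) = nf (v @ q @ u)" "nf (u @ p @ w) = nf (u @ p @ v)" for u p q
      using w nf_append_left[of w "q @ u"] nf_append_left[of v "q @ u"]
        nf_append_right[of "u @ p" w] nf_append_right[of "u @ p" v] by simp_all
    have "cyc u (p @ w @ q) = cyc u (p @ v @ q)" for u p q
      unfolding cyc_context cyc_left[OF nf(1)] cyc_left[OF nf(2)] w(2) ..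
    then show ?thesis using w(1) by (simp add: E_def)
  qed
  have zz: "nf [letter_x, letter_x] = Some top" "nf [letter_y, letter_y] = None"
    unfolding nf_def using e by simp_all
  have long: "nf (top @ [letter_x]) = None" "nf (top' @ [letter_y]) = None"
    by (rule long_word, simp)+
  \<comment> \<open>Both sides test whether \<open>u\<close> is \<open>x(yx)\<^sup>k\<^sup>-\<^sup>1\<close>.\<close>
  have yy: "local_term letter_y (letter_y # u) = local_term letter_y (u @ [letter_y])" for u
  proof -
    have "nf (letter_y # u) = Some top \<longleftrightarrow> nf (u @ [letter_y]) = Some top"
    proof (cases "length u = 2 * k - 1")
      case False
      then have "length (letter_y # u) \<noteq> 2 * k" "length (u @ [letter_y]) \<noteq> 2 * k" using k by auto
      moreover from this have "letter_y # u \<noteq> top" "u @ [letter_y] \<noteq> top" using length_top(1) by metis+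
      ultimately show ?thesis unfolding nf_def using e by auto
    next
      case True
      have "successively (\<noteq>) (letter_y # u) \<longleftrightarrow> u = alternating letter_x (2 * k - 1)"
      proof
        assume "successively (\<noteq>) (letter_y # u)"
        from eq_alternating[OF this] True show "u = alternating letter_x (2 * k - 1)" by simp
      next
        assume "u = alternating letter_x (2 * k - 1)"
        then show "successively (\<noteq>) (letter_y # u)"
          using successively_alternating[of letter_y "Suc (2 * k - 1)"] by simp
      qed
      moreover have "successively (\<noteq>) (u @ [letter_y]) \<longleftrightarrow> u = alternating letter_x (2 * k - 1)"
      proof
        have od: "odd (2 * k - 1)" using k by simp
        assume *: "successively (\<noteq>) (u @ [letter_y])"
        obtain c v where cv: "u @ [letter_y] = c # v" by (cases "u @ [letter_y]") auto
        have "length v = 2 * k - 1" using arg_cong[OF cv, of length] True by simp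
        then have "u @ [letter_y] = alternating c (Suc (2 * k - 1))"
          using eq_alternating[of c v] * unfolding cv by simp
        also have "\<dots> = alternating c (2 * k - 1) @ [other c]"
          unfolding alternating_snoc using od by simp
        finally have "u = alternating c (2 * k - 1)" "other c = letter_y" by simp_all
        then show "u = alternating letter_x (2 * k - 1)" by (cases c) simp_all
      next
        assume u: "u = alternating letter_x (2 * k - 1)"
        have "alternating letter_x (Suc (2 * k - 1)) = u @ [letter_y]"
          unfolding alternating_snoc u using k by simp
        then show "successively (\<noteq>) (u @ [letter_y])"
          using successively_alternating[of letter_x "Suc (2 * k - 1)"] by simp
      qed
      ultimately show ?thesis
        using True k nf_eq_top[of "letter_y # u"] nf_eq_top[of "u @ [letter_y]"] by simp
    qed
    then show ?thesis by (simp add: local_term_def)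
  qed
  have tail: "nf (u @ top') = Some top \<longleftrightarrow> u = []" for u
  proof
    assume "nf (u @ top') = Some top"
    then have "\<not> length (u @ top') > 2 * k" using long_word[of "u @ top'"] by auto
    then show "u = []" by simp
  qed simp
  have u_top: "u @ top \<noteq> [letter_x, letter_y]" for u
  proof
    assume "u @ top = [letter_x, letter_y]"
    from arg_cong[OF this, of length] show False using k by simp
  qed
  note red = reduction_induct[of E Z]
  have "nf v = None \<Longrightarrow> Z v" "\<And>t. nf v = Some t \<Longrightarrow> E v t"
  proof (atomize (full), intro conjI impI allI)
    have ax: "(\<forall>w. E w w) \<and> (\<forall>v w. E v w \<longrightarrow> E w v) \<and> (\<forall>p w q. Z w \<longrightarrow> Z (p @ w @ q))
        \<and> (\<forall>p v w q. E v w \<longrightarrow> Z (p @ w @ q) \<longrightarrow> Z (p @ v @ q))"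
    proof (intro conjI allI impI)
      fix p w q assume Zw: "Z w"
      have "cyc u (p' @ (p @ w @ q) @ q') = 0" for u p' q'
        using Zw unfolding Z_def by (metis append.assoc)
      moreover have "nf (p @ w @ q) = None" using Zw nf_context[of p w q] by (simp add: Z_def)
      ultimately show "Z (p @ w @ q)" by (simp add: Z_def)
    next
      fix p v w q assume E: "E v w" and Zw: "Z (p @ w @ q)"
      have "cyc u (p' @ (p @ v @ q) @ q') = cyc u (p' @ (p @ w @ q) @ q')" for u p' q'
        using E unfolding E_def by (metis append.assoc)
      moreover have "nf (p @ v @ q) = nf (p @ w @ q)"
        using E nf_context[of p w q] nf_context[of p v q] by (simp add: E_def)
      ultimately show "Z (p @ v @ q)" using Zw by (simp add: Z_def)
    qed (simp_all add: E_def)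
    have xx: "E [letter_x, letter_x] top"
      by (rule EI) (auto simp: zz cyc_top local_term_x)
    have yyZ: "Z [letter_y, letter_y]"
      by (rule ZI) (simp_all add: zz yy double_zero)
    have tt: "E top top'" by (rule EI) (simp_all add: cyc_top cyc_top')
    have tx: "Z (top @ [letter_x])"
      by (rule ZI) (simp_all add: long cyc_append cyc_top local_term_x u_top)
    have ty: "Z (top' @ [letter_y])"
      by (rule ZI) (simp_all add: long cyc_append cyc_top' local_term_def tail double_zero)
    show "Z v" if "nf v = None"
      by (rule red(1)) (use ax xx yyZ tt tx ty e that in blast)+
    show "E v t" if "nf v = Some t" for t
      by (rule red(2)) (use ax xx yyZ tt tx ty e that in blast)+
  qed
  note ZE = this
  show ?thesis
  proof (cases "nf v")
    case None
    then have "cyc u ([] @ v @ []) = 0" using ZE(1) unfolding Z_def by blast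
    then show ?thesis using None by simp
  next
    case (Some t)
    then have "cyc u ([] @ v @ []) = cyc u ([] @ t @ [])" using ZE(2) unfolding E_def by blast
    then show ?thesis using Some by simp
  qed
qed

end

section \<open>The word basis of the algebras\<close>

lemma poly_mapping_single_induct [case_names single add]:
  fixes p :: "'a \<Rightarrow>\<^sub>0 'b::comm_monoid_add"
  assumes single: "\<And>u c. P (Poly_Mapping.single u c)" and add: "\<And>p q. P p \<Longrightarrow> P q \<Longrightarrow> P (p + q)"
  shows "P p"
proof -
  have "P (\<Sum>u\<in>S. Poly_Mapping.single u (Poly_Mapping.lookup p u))" if "finite S" for S
    using that
  proof (induction S rule: finite_induct)
    case empty
    then show ?case using single[of undefined 0] by simp
  next
    case (insert u S)
    then show ?case using add[OF single] by simp
  qed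
  moreover have "p = (\<Sum>u\<in>Poly_Mapping.keys p. Poly_Mapping.single u (Poly_Mapping.lookup p u))"
    by (rule poly_mapping_eqI) (auto simp: lookup_sum lookup_single when_def in_keys_iff)
  ultimately show ?thesis by (metis finite_keys)
qed

lemma free_ring_simps [simp]:
  "carrier free_ring = UNIV" "monoid.mult free_ring = (*)" "one free_ring = 1"
  "ring.zero free_ring = 0" "add free_ring = (+)"
  by (simp_all add: free_ring_def ring_of_type_algebra_def)

lemma ring_free_ring: "ring (free_ring :: 'k::field free_alg ring)"
proof (rule ringI)
  show "abelian_group (free_ring :: 'k free_alg ring)"
    by (rule abelian_groupI) (auto simp: algebra_simps intro: exI[of _ "- x" for x])
  show "monoid (free_ring :: 'k free_alg ring)" by (rule monoidI) (auto simp: algebra_simps)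
qed (auto simp: algebra_simps)

definition word :: "letter list \<Rightarrow> 'k::field free_alg" where
  "word w = Poly_Mapping.single (Word w) 1"

lemma word_mult: "word u * word v = word (u @ v)"
  by (simp add: word_def mult_single plus_free_word_def)

lemma word_Nil: "word [] = 1"
  by (simp add: word_def zero_free_word_def[symmetric])

lemma single_eq_scalar_word: "Poly_Mapping.single (Word w) c = scalar c * word w"
  by (simp add: scalar_def word_def mult_single zero_free_word_def plus_free_word_def)

lemma gen_word: "gen_x = word [letter_x]" "gen_y = word [letter_y]"
  by (simp_all add: gen_x_def gen_y_def word_def)

lemma gen_power: "(gen_x * gen_y) ^ n = word (alternating letter_x (2 * n))"
  "(gen_y * gen_x) ^ n = word (alternating letter_y (2 * n))"
  by (induction n) (simp_all add: gen_word word_mult word_Nil)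

lemma scalar_commute: "scalar c * p = p * scalar c"
  by (induction p rule: poly_mapping_single_induct)
    (simp_all add: scalar_def mult_single algebra_simps)

lemma scalar_simps: "scalar 1 = 1" "scalar 0 = 0" "scalar (c + d) = scalar c + scalar d"
  "scalar (c * d) = scalar c * scalar d"
  by (simp_all add: scalar_def single_add mult_single)

locale D1A_words = normal_forms k e for k e +
  fixes ground :: "'k::field itself"
begin

definition relations :: "'k free_alg set" where "relations = D1A_ideal k (of_bool e)"
definition A :: "('k, 'k free_alg set) module" where "A = D1A k (of_bool e)"
abbreviation cls :: "'k free_alg \<Rightarrow> 'k free_alg set" where "cls p \<equiv> relations +>\<^bsub>free_ring\<^esub> p"

lemma ideal_relations: "ideal relations (free_ring :: 'k free_alg ring)"
  unfolding relations_def D1A_ideal_def by (rule ring.genideal_ideal[OF ring_free_ring]) simp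

sublocale I: ideal relations "free_ring :: 'k free_alg ring"
  by (rule ideal_relations)

lemma relations_add: "p \<in> relations \<Longrightarrow> q \<in> relations \<Longrightarrow> p + q \<in> relations"
  using additive_subgroup.a_closed[OF I.additive_subgroup_axioms, of p q] by simp

lemma relations_mult: "p \<in> relations \<Longrightarrow> q * p \<in> relations" "p \<in> relations \<Longrightarrow> p * q \<in> relations"
  using I.I_l_closed[of p q] I.I_r_closed[of p q] by simp_all

lemma relations_minus: "p \<in> relations \<Longrightarrow> - p \<in> relations"
  using relations_mult(1)[of p "- 1"] by simp

lemma relations_diff: "p \<in> relations \<Longrightarrow> q \<in> relations \<Longrightarrow> p - q \<in> relations"
  using relations_add[OF _ relations_minus] by fastforce

lemma generators:
  "word [letter_x, letter_x] - word top \<in> relations"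
  "word [letter_y, letter_y] - of_bool e * word top \<in> relations"
  "word top - word top' \<in> relations"
  "word (top @ [letter_x]) \<in> relations"
  "word (top' @ [letter_y]) \<in> relations"
proof -
  have gen: "{gen_x ^ 2 - (gen_x * gen_y) ^ k,
      gen_y ^ 2 - scalar (of_bool e) * (gen_x * gen_y) ^ k,
      (gen_x * gen_y) ^ k - (gen_y * gen_x) ^ k,
      (gen_x * gen_y) ^ k * gen_x,
      (gen_y * gen_x) ^ k * gen_y} \<subseteq> relations"
    unfolding relations_def D1A_ideal_def by (rule ring.genideal_self[OF ring_free_ring]) simp
  have sq: "gen_x ^ 2 = (word [letter_x, letter_x] :: 'k free_alg)" "gen_y ^ 2 = (word [letter_y, letter_y] :: 'k free_alg)"
    by (simp_all add: power2_eq_square gen_word word_mult)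
  have sc: "scalar (of_bool e) = (of_bool e :: 'k free_alg)" by (cases e) (simp_all add: scalar_simps)
  note gen = gen[unfolded gen_power sq sc, unfolded gen_word word_mult, folded top_def top'_def]
  show "word [letter_x, letter_x] - word top \<in> relations"
    "word [letter_y, letter_y] - of_bool e * word top \<in> relations"
    "word top - word top' \<in> relations"
    "word (top @ [letter_x]) \<in> relations"
    "word (top' @ [letter_y]) \<in> relations"
    using gen by blast+
qed

lemma word_reduction:
  "nf w = None \<Longrightarrow> word w \<in> relations"
  "nf w = Some v \<Longrightarrow> word w - word v \<in> relations"
proof -
  note red = reduction_induct[of "\<lambda>w v. word w - word v \<in> relations" "\<lambda>w. word w \<in> relations"]
  have refl: "word w - word w \<in> relations" for w using relations_diff[OF generators(4) generators(4)] by simp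
  have sym: "word w - word v \<in> relations" if "word v - word w \<in> relations" for v w
    using relations_minus[OF that] by simp
  have ctx: "word (p @ w @ q) \<in> relations" if "word w \<in> relations" for p w q
    using relations_mult(1)[OF relations_mult(2)[OF that], of "word p" "word q"] by (simp add: word_mult)
  have ez: "word (p @ v @ q) \<in> relations" if "word v - word w \<in> relations" "word (p @ w @ q) \<in> relations" for p v w q
  proof -
    have "word p * ((word v - word w) * word q) + word (p @ w @ q) \<in> relations"
      by (intro relations_add relations_mult that)
    then show ?thesis by (simp add: algebra_simps word_mult)
  qed
  have yy1: "word [letter_y, letter_y] - word top \<in> relations" if e using generators(2) that by simp
  have yy2: "word [letter_y, letter_y] \<in> relations" if "\<not> e" using generators(2) that by simp
  show "nf w = None \<Longrightarrow> word w \<in> relations"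
    by (rule red(1)[OF refl sym ctx ez generators(1) yy1 yy2 generators(3-5)])
  show "nf w = Some v \<Longrightarrow> word w - word v \<in> relations"
    by (rule red(2)[OF refl sym ctx ez generators(1) yy1 yy2 generators(3-5)])
qed

text \<open>
  The coefficient of the basis word \<open>t\<close> after rewriting every word of \<open>p\<close> to its normal form.
\<close>

definition coeff :: "letter list \<Rightarrow> 'k free_alg \<Rightarrow> 'k" where
  "coeff t p = (\<Sum>u\<in>Poly_Mapping.keys p. if nf (letters u) = Some t then Poly_Mapping.lookup p u else 0)"

lemma coeff_add: "coeff t (p + q) = coeff t p + coeff t q"
proof -
  have ext: "coeff t r = (\<Sum>u\<in>Poly_Mapping.keys p \<union> Poly_Mapping.keys q. if nf (letters u) = Some t then Poly_Mapping.lookup r u else 0)"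
    if "Poly_Mapping.keys r \<subseteq> Poly_Mapping.keys p \<union> Poly_Mapping.keys q" for r
    unfolding coeff_def by (rule sum.mono_neutral_left) (use that in \<open>auto simp: in_keys_iff\<close>)
  show ?thesis
    using ext[of "p + q"] ext[of p] ext[of q] keys_add[of p q]
    by (simp add: lookup_add sum.distrib[symmetric] if_distrib cong: if_cong)
qed

lemma coeff_single: "coeff t (Poly_Mapping.single u c) = (if nf (letters u) = Some t then c else 0)"
  by (cases "c = 0") (simp_all add: coeff_def)

lemma coeff_zero [simp]: "coeff t 0 = 0"
  by (simp add: coeff_def)

lemma coeff_minus: "coeff t (- p) = - coeff t p"
  using coeff_add[of t p "- p"] by (simp add: eq_neg_iff_add_eq_0 add.commute)

lemma coeff_diff: "coeff t (p - q) = coeff t p - coeff t q"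
  using coeff_add[of t p "- q"] by (simp add: coeff_minus)

lemma sum_select:
  assumes "a \<in> normal_words"
  shows "(\<Sum>v\<in>normal_words. if P v then (if a = v then d else 0) else 0) = (if P a then d else (0 :: 'k))"
proof -
  have "(\<Sum>v\<in>normal_words. if P v then (if a = v then d else 0) else 0) =
      (\<Sum>v\<in>normal_words. if v = a then (if P a then d else 0) else 0)"
    by (rule sum.cong) auto
  then show ?thesis using assms finite_normal_words by simp
qed

lemma coeff_single_mult:
  "coeff t (Poly_Mapping.single u c * p) =
    c * (\<Sum>v\<in>normal_words. if nf (letters u @ v) = Some t then coeff v p else 0)"
proof (induction p rule: poly_mapping_single_induct)
  case (single v d)
  show ?case
  proof (cases "nf (letters v)")
    case None
    then have "nf (letters u @ letters v) = None" using nf_append_right[of "letters u" "letters v"] by simp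
    then show ?thesis using None by (simp add: mult_single plus_free_word_def coeff_single cong: if_cong)
  next
    case (Some a)
    then have "nf (letters u @ letters v) = nf (letters u @ a)" using nf_append_right[of "letters u" "letters v"] by simp
    then show ?thesis using sum_select[OF normal_wordsI[OF Some], of "\<lambda>v. nf (letters u @ v) = Some t" d] Some
      by (simp add: mult_single plus_free_word_def coeff_single cong: if_cong)
  qed
next
  case (add p q)
  have "(\<Sum>v\<in>normal_words. if nf (letters u @ v) = Some t then coeff v (p + q) else 0) =
      (\<Sum>v\<in>normal_words. if nf (letters u @ v) = Some t then coeff v p else 0) +
      (\<Sum>v\<in>normal_words. if nf (letters u @ v) = Some t then coeff v q else 0)"
    unfolding sum.distrib[symmetric] by (rule sum.cong) (simp_all add: coeff_add)
  then show ?case using add by (simp add: distrib_left distrib_right coeff_add)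
qed

lemma coeff_mult_single:
  "coeff t (p * Poly_Mapping.single u c) =
    c * (\<Sum>v\<in>normal_words. if nf (v @ letters u) = Some t then coeff v p else 0)"
proof (induction p rule: poly_mapping_single_induct)
  case (single v d)
  show ?case
  proof (cases "nf (letters v)")
    case None
    then have "nf (letters v @ letters u) = None" using nf_append_left[of "letters v" "letters u"] by simp
    then show ?thesis using None by (simp add: mult_single plus_free_word_def coeff_single cong: if_cong)
  next
    case (Some a)
    then have "nf (letters v @ letters u) = nf (a @ letters u)" using nf_append_left[of "letters v" "letters u"] by simp
    then show ?thesis using sum_select[OF normal_wordsI[OF Some], of "\<lambda>v. nf (v @ letters u) = Some t" d] Some
      by (simp add: mult_single plus_free_word_def coeff_single mult.commute cong: if_cong)
  qed
next
  case (add p q)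
  have "(\<Sum>v\<in>normal_words. if nf (v @ letters u) = Some t then coeff v (p + q) else 0) =
      (\<Sum>v\<in>normal_words. if nf (v @ letters u) = Some t then coeff v p else 0) +
      (\<Sum>v\<in>normal_words. if nf (v @ letters u) = Some t then coeff v q else 0)"
    unfolding sum.distrib[symmetric] by (rule sum.cong) (simp_all add: coeff_add)
  then show ?case using add by (simp add: distrib_left distrib_right coeff_add)
qed

text \<open>
  The elements with vanishing coefficients form an ideal that contains the generators. With
  \<open>normal_form_expansion\<close> this shows that the normal words are a basis of the quotient.
\<close>

lemma coeff_relations:
  assumes "p \<in> relations" shows "coeff t p = 0"
proof -
  let ?N = "{p. \<forall>t. coeff t p = 0}"
  have l: "q * p \<in> ?N" if p: "p \<in> ?N" for p q
  proof (induction q rule: poly_mapping_single_induct)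
    case (single u c)
    have "coeff t (Poly_Mapping.single u c * p) = 0" for t
      unfolding coeff_single_mult using p by (simp cong: if_cong)
    then show ?case by simp
  qed (simp add: distrib_right coeff_add)
  have r: "p * q \<in> ?N" if p: "p \<in> ?N" for p q
  proof (induction q rule: poly_mapping_single_induct)
    case (single u c)
    have "coeff t (p * Poly_Mapping.single u c) = 0" for t
      unfolding coeff_mult_single using p by (simp cong: if_cong)
    then show ?case by simp
  qed (simp add: distrib_left coeff_add)
  have "ideal ?N (free_ring :: 'k free_alg ring)"
  proof (rule idealI[OF ring_free_ring])
    have grp: "group (add_monoid (free_ring :: 'k free_alg ring))"
      by (rule abelian_group.a_group[OF ring.is_abelian_group[OF ring_free_ring]])
    show "subgroup ?N (add_monoid (free_ring :: 'k free_alg ring))"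
    proof (rule group.subgroupI[OF grp])
      fix a :: "'k free_alg" assume a: "a \<in> ?N"
      have "inv\<^bsub>add_monoid free_ring\<^esub> a = - a"
        by (rule group.inv_equality[OF grp]) simp_all
      then show "inv\<^bsub>add_monoid free_ring\<^esub> a \<in> ?N" using a by (simp add: coeff_minus)
    qed (auto simp: coeff_add intro: exI[of _ 0])
  qed (use l r in auto)
  then have "relations \<subseteq> ?N"
    unfolding relations_def D1A_ideal_def
  proof (rule ring.genideal_minimal[OF ring_free_ring])
    have sq: "gen_x ^ 2 = (word [letter_x, letter_x] :: 'k free_alg)" "gen_y ^ 2 = (word [letter_y, letter_y] :: 'k free_alg)"
      by (simp_all add: power2_eq_square gen_word word_mult)
    have cw: "coeff t (word w) = of_bool (nf w = Some t)" for t w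
      by (simp add: word_def coeff_single)
    have csw: "coeff t (scalar c * word w) = c * of_bool (nf w = Some t)" for t w c
      unfolding single_eq_scalar_word[symmetric] by (simp add: coeff_single)
    have nfs: "nf [letter_x, letter_x] = Some top" "nf [letter_y, letter_y] = (if e then Some top else None)"
      by (simp_all add: nf_def)
    have long: "nf (top @ [c]) = None" "nf (top' @ [c]) = None" for c
      by (rule long_word, simp)+
    show "{gen_x ^ 2 - (gen_x * gen_y) ^ k,
      gen_y ^ 2 - scalar (of_bool e) * (gen_x * gen_y) ^ k,
      (gen_x * gen_y) ^ k - (gen_y * gen_x) ^ k,
      (gen_x * gen_y) ^ k * gen_x,
      (gen_y * gen_x) ^ k * gen_y} \<subseteq> ?N"
      unfolding gen_power sq unfolding gen_word word_mult top_def[symmetric] top'_def[symmetric]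
      by (auto simp: coeff_diff cw csw nfs long)
  qed
  then show ?thesis using assms by blast
qed

lemma normal_form_expansion:
  "p - (\<Sum>t\<in>normal_words. scalar (coeff t p) * word t) \<in> relations"
proof (induction p rule: poly_mapping_single_induct)
  case (single u c)
  obtain w where u: "u = Word w" by (cases u)
  show ?case
  proof (cases "nf w")
    case None
    then have "(\<Sum>t\<in>normal_words. scalar (coeff t (Poly_Mapping.single u c)) * word t) = (0 :: 'k free_alg)"
      by (intro sum.neutral) (simp add: coeff_single u scalar_simps)
    then show ?thesis
      using relations_mult(1)[OF word_reduction(1)[OF None], of "scalar c"] by (simp add: u single_eq_scalar_word)
  next
    case (Some v)
    have "(\<Sum>t\<in>normal_words. scalar (coeff t (Poly_Mapping.single u c)) * word t) =
        (\<Sum>t\<in>normal_words. if t = v then scalar c * word v else (0 :: 'k free_alg))"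
      by (intro sum.cong) (auto simp: coeff_single u Some scalar_simps)
    also have "\<dots> = scalar c * word v"
      using finite_normal_words normal_wordsI[OF Some] by simp
    finally show ?thesis
      using relations_mult(1)[OF word_reduction(2)[OF Some], of "scalar c"]
      by (simp add: u single_eq_scalar_word right_diff_distrib)
  qed
next
  case (add p q)
  have "(\<Sum>t\<in>normal_words. scalar (coeff t (p + q)) * word t) =
     (\<Sum>t\<in>normal_words. scalar (coeff t p) * word t) + (\<Sum>t\<in>normal_words. scalar (coeff t q) * (word t :: 'k free_alg))"
    by (simp add: coeff_add scalar_simps distrib_right sum.distrib)
  then show ?case using relations_add[OF add] by (simp add: algebra_simps)
qed

lemma cls_eqI: "p - q \<in> relations \<Longrightarrow> cls p = cls q"
proof -
  assume "p - q \<in> relations"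
  then have "p \<in> cls q" by (auto simp: a_r_coset_def r_coset_def intro: bexI[of _ "p - q"])
  then show ?thesis using I.a_repr_independence'[of p q] by simp
qed

lemma cls_eqD: "cls p = cls q \<Longrightarrow> p - q \<in> relations"
proof -
  assume "cls p = cls q"
  then have "p \<in> cls q" using I.a_rcos_self[of p] by simp
  then show ?thesis by (auto simp: a_r_coset_def r_coset_def)
qed

lemma D1A_simps:
  "carrier A = range cls" "cls p \<otimes>\<^bsub>A\<^esub> cls q = cls (p * q)" "cls p \<oplus>\<^bsub>A\<^esub> cls q = cls (p + q)"
  "\<one>\<^bsub>A\<^esub> = cls 1" "\<zero>\<^bsub>A\<^esub> = cls 0" "c \<odot>\<^bsub>A\<^esub> cls p = cls (scalar c * p)"
  using I.rcoset_mult_add[of p q] I.rcoset_mult_add[of "scalar c" p] I.a_rcos_sum[of p q] I.a_rcos_const[of 0]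
  relations_diff[OF generators(4) generators(4)]
  unfolding A_def D1A_def Let_def relations_def[symmetric]
  by (auto simp: FactRing_def A_RCOSETS_def' ring.defs module.defs)

lemma k_algebra_D1A: "k_algebra A"
proof -
  have ab: "abelian_group A"
  proof (rule abelian_groupI, goal_cases)
    case (6 x)
    then obtain p where "x = cls p" by (auto simp: D1A_simps)
    then show ?case by (intro bexI[of _ "cls (- p)"]) (auto simp: D1A_simps)
  qed (auto simp: D1A_simps algebra_simps)
  have ring: "ring A"
  proof (rule ringI[OF ab])
    show "monoid A" by (rule monoidI) (auto simp: D1A_simps algebra_simps)
  qed (auto simp: D1A_simps algebra_simps)
  have "module (ring_of_type_algebra :: 'k ring) A"
    by (rule moduleI[OF cring_from_type_algebra ab])
      (auto simp: ring_of_type_algebra_def D1A_simps scalar_simps algebra_simps)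
  moreover have "p * (scalar c * q) = scalar c * (p * q)" for p q :: "'k free_alg" and c
    by (metis mult.assoc scalar_commute)
  ultimately show ?thesis
    by (intro k_algebra.intro k_algebra_axioms.intro ring) (auto simp: D1A_simps mult.assoc)
qed

definition coord :: "letter list \<Rightarrow> 'k free_alg set \<Rightarrow> 'k" where
  "coord t a = coeff t (SOME p. a = cls p)"

lemma coord_cls: "coord t (cls p) = coeff t p"
proof -
  have "cls p = cls (SOME q. cls p = cls q)" by (rule someI[of _ p]) simp
  from cls_eqD[OF this] coeff_relations[of _ t] show ?thesis
    unfolding coord_def by (fastforce simp: coeff_diff)
qed

lemma coeff_scalar_mult: "coeff t (scalar c * p) = c * coeff t p"
  by (induction p rule: poly_mapping_single_induct)
    (simp_all add: distrib_left coeff_add scalar_def mult_single coeff_single)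

lemma algebra_basis_D1A: "algebra_basis A normal_words (\<lambda>w. cls (word w)) coord"
proof -
  interpret A: k_algebra A by (rule k_algebra_D1A)
  have "linear_form A (coord w)" for w
    by (auto simp: linear_form_def D1A_simps coord_cls coeff_add coeff_scalar_mult)
  moreover have "a = (\<Oplus>\<^bsub>A\<^esub>w\<in>normal_words. coord w a \<odot>\<^bsub>A\<^esub> cls (word w))" if "a \<in> carrier A" for a
  proof -
    obtain p where a: "a = cls p" using \<open>a \<in> carrier A\<close> by (auto simp: D1A_simps)
    have fin: "(\<Oplus>\<^bsub>A\<^esub>w\<in>S. cls (f w)) = cls (sum f S)" if "finite S" for S :: "letter list set" and f
      using that by (induction S rule: finite_induct) (auto simp: D1A_simps A.finsum_insert Pi_iff)
    have "a = cls (\<Sum>t\<in>normal_words. scalar (coeff t p) * word t)"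
      unfolding a by (rule cls_eqI[OF normal_form_expansion])
    also have "\<dots> = (\<Oplus>\<^bsub>A\<^esub>w\<in>normal_words. coord w a \<odot>\<^bsub>A\<^esub> cls (word w))"
      by (simp add: fin[OF finite_normal_words, symmetric] D1A_simps a coord_cls)
    finally show ?thesis .
  qed
  ultimately show ?thesis
    by (auto simp: algebra_basis_def finite_normal_words D1A_simps)
qed

end

section \<open>Comparison of the two spaces of cocycles\<close>

lemma vector_space_functions: "vector_space (\<lambda>c (F :: 'i \<Rightarrow> 'k::field) x. c * F x)"
  by unfold_locales (auto simp: fun_eq_iff algebra_simps)

interpretation fun_space: vector_space "\<lambda>c (F :: 'i \<Rightarrow> 'k::field) x. c * F x"
  by (rule vector_space_functions)

text \<open>
  Bilinear forms are stored as tables of their values on pairs of basis words, that is, as functions on a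
  finite set; this bounds the dimension.
\<close>

lemma finitely_supported_in_span:
  fixes F :: "'i \<Rightarrow> 'k::field"
  assumes "finite S" "\<And>x. x \<notin> S \<Longrightarrow> F x = 0"
  shows "F \<in> fun_space.span ((\<lambda>y x. of_bool (x = y)) ` S)"
proof -
  have "F = (\<Sum>y\<in>S. (\<lambda>x. F y * of_bool (x = y)))"
  proof
    fix x
    have "(\<Sum>y\<in>S. (\<lambda>x. F y * of_bool (x = y))) x = (\<Sum>y\<in>S. F y * of_bool (x = y))"
      by (induction S rule: infinite_finite_induct) auto
    also have "\<dots> = (\<Sum>y\<in>S. if y = x then F x else 0)" by (rule sum.cong) auto
    also have "\<dots> = F x" using assms by auto
    finally show "F x = (\<Sum>y\<in>S. (\<lambda>x. F y * of_bool (x = y))) x" by simp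
  qed
  also have "\<dots> \<in> fun_space.span ((\<lambda>y x. of_bool (x = y)) ` S)"
    by (intro fun_space.span_sum fun_space.span_scale fun_space.span_base) auto
  finally show ?thesis .
qed

context D1A_words
begin

lemma word_in_carrier [simp]: "cls p \<in> carrier A"
  by (simp add: D1A_simps)

lemma cls_word: "cls (word w) = (case nf w of None \<Rightarrow> cls 0 | Some t \<Rightarrow> cls (word t))"
proof (cases "nf w")
  case None
  have "cls (word w) = cls 0" by (rule cls_eqI) (use word_reduction(1)[OF None] in simp)
  then show ?thesis using None by simp
next
  case (Some t)
  then show ?thesis using cls_eqI[OF word_reduction(2)[OF Some]] by simp
qed

lemma linear_form_expansion:
  assumes "linear_form A g" "a \<in> carrier A"
  shows "g a = (\<Sum>t\<in>normal_words. coord t a * g (cls (word t)))"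
proof -
  interpret A: k_algebra A by (rule k_algebra_D1A)
  have "a = (\<Oplus>\<^bsub>A\<^esub>w\<in>normal_words. coord w a \<odot>\<^bsub>A\<^esub> cls (word w))"
    using algebra_basis_D1A assms(2) unfolding algebra_basis_def by blast
  then have "g a = g (\<Oplus>\<^bsub>A\<^esub>w\<in>normal_words. coord w a \<odot>\<^bsub>A\<^esub> cls (word w))" by simp
  also have "\<dots> = (\<Sum>w\<in>normal_words. g (coord w a \<odot>\<^bsub>A\<^esub> cls (word w)))"
    by (rule A.linear_form_finsum[OF assms(1) finite_normal_words]) simp
  also have "\<dots> = (\<Sum>t\<in>normal_words. coord t a * g (cls (word t)))"
    using assms(1) by (simp add: linear_form_def)
  finally show ?thesis .
qed

text \<open>
  The value at two arbitrary words of the bilinear form with table \<open>F\<close>.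
\<close>

definition on_words :: "(letter list \<times> letter list \<Rightarrow> 'k) \<Rightarrow> letter list \<Rightarrow> letter list \<Rightarrow> 'k" where
  "on_words F u v = (case nf u of None \<Rightarrow> 0 | Some s \<Rightarrow> (case nf v of None \<Rightarrow> 0 | Some t \<Rightarrow> F (s, t)))"

definition bilinear :: "(letter list \<times> letter list \<Rightarrow> 'k) \<Rightarrow> 'k free_alg set \<Rightarrow> 'k free_alg set \<Rightarrow> 'k" where
  "bilinear F a b = (\<Sum>s\<in>normal_words. \<Sum>t\<in>normal_words. coord s a * coord t b * F (s, t))"

definition table :: "('k free_alg set \<Rightarrow> 'k free_alg set \<Rightarrow> 'k) \<Rightarrow> letter list \<times> letter list \<Rightarrow> 'k" where
  "table f = (\<lambda>(u, v). if u \<in> normal_words \<and> v \<in> normal_words then f (cls (word u)) (cls (word v)) else 0)"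

lemma coord_add: "coord t (cls (p + q)) = coord t (cls p) + coord t (cls q)"
  by (simp add: coord_cls coeff_add)

lemma bilinear_add_left: "bilinear F (cls (p + q)) b = bilinear F (cls p) b + bilinear F (cls q) b"
  by (simp add: bilinear_def coord_add distrib_right sum.distrib)

lemma bilinear_add_right: "bilinear F b (cls (p + q)) = bilinear F b (cls p) + bilinear F b (cls q)"
  by (simp add: bilinear_def coord_add distrib_right distrib_left sum.distrib)

lemma linear_form_bilinear: "linear_form A (\<lambda>a. bilinear F a b)" "linear_form A (bilinear F b)"
  by (auto simp: linear_form_def D1A_simps bilinear_add_left bilinear_add_right)
    (simp_all add: bilinear_def coord_cls coeff_scalar_mult sum_distrib_left algebra_simps)

lemma bilinear_single:
  "bilinear F (cls (Poly_Mapping.single u c)) (cls (Poly_Mapping.single v d)) = c * d * on_words F (letters u) (letters v)"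
proof -
  have *: "(\<Sum>s\<in>normal_words. coord s (cls (Poly_Mapping.single u c)) * h s) =
      (case nf (letters u) of None \<Rightarrow> 0 | Some s \<Rightarrow> c * h s)" for u c and h :: "letter list \<Rightarrow> 'k"
  proof (cases "nf (letters u)")
    case (Some a)
    have "(\<Sum>s\<in>normal_words. coord s (cls (Poly_Mapping.single u c)) * h s) =
        (\<Sum>s\<in>normal_words. if s = a then c * h a else 0)"
      by (rule sum.cong) (auto simp: coord_cls coeff_single Some)
    then show ?thesis using finite_normal_words normal_wordsI[OF Some] Some by simp
  qed (simp add: coord_cls coeff_single)
  have "bilinear F (cls (Poly_Mapping.single u c)) (cls (Poly_Mapping.single v d)) =
      (\<Sum>s\<in>normal_words. coord s (cls (Poly_Mapping.single u c)) *
        (\<Sum>t\<in>normal_words. coord t (cls (Poly_Mapping.single v d)) * F (s, t)))"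
    by (simp add: bilinear_def sum_distrib_left mult.assoc)
  then show ?thesis by (simp add: * on_words_def split: option.splits)
qed

lemma bilinear_word: "bilinear F (cls (word u)) (cls (word v)) = on_words F u v"
  using bilinear_single[of F "Word u" 1 "Word v" 1] by (simp add: word_def)

definition cocycle_tables :: "(letter list \<times> letter list \<Rightarrow> 'k) set" where
  "cocycle_tables = {F. (\<forall>u v. u \<notin> normal_words \<or> v \<notin> normal_words \<longrightarrow> F (u, v) = 0) \<and>
     (\<forall>u v w. on_words F (u @ v) w - on_words F u (v @ w) + on_words F (w @ u) v = 0)}"

definition coboundary_tables :: "(letter list \<times> letter list \<Rightarrow> 'k) set" where
  "coboundary_tables = {F. (\<forall>u v. u \<notin> normal_words \<or> v \<notin> normal_words \<longrightarrow> F (u, v) = 0) \<and>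
     (\<exists>G. \<forall>u\<in>normal_words. \<forall>v\<in>normal_words. F (u, v) =
        (case nf (u @ v) of None \<Rightarrow> 0 | Some t \<Rightarrow> G t) - (case nf (v @ u) of None \<Rightarrow> 0 | Some t \<Rightarrow> G t))}"

lemma bilinear_cocycle:
  assumes F: "F \<in> cocycle_tables"
  shows "hochschild_cocycle A (bilinear F)"
proof -
  let ?f = "\<lambda>p q. bilinear F (cls p) (cls q)"
  have "?f (p * q) r - ?f p (q * r) + ?f (r * p) q = 0" for p q r
  proof (induction p rule: poly_mapping_single_induct)
    case (single u c1)
    show ?case
    proof (induction q rule: poly_mapping_single_induct)
      case (single v c2)
      show ?case
      proof (induction r rule: poly_mapping_single_induct)
        case (single w c3)
        have "c1 * c2 * c3 * (on_words F (letters u @ letters v) (letters w) - on_words F (letters u) (letters v @ letters w)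
            + on_words F (letters w @ letters u) (letters v)) = 0"
          using F unfolding cocycle_tables_def by simp
        then show ?case by (simp add: mult_single bilinear_single plus_free_word_def algebra_simps)
      next
        case (add r r')
        then show ?case by (simp add: distrib_left distrib_right bilinear_add_left bilinear_add_right algebra_simps)
      qed
    next
      case (add q q')
      then show ?case by (simp add: distrib_left distrib_right bilinear_add_left bilinear_add_right algebra_simps)
    qed
  next
    case (add p p')
    then show ?case by (simp add: distrib_left distrib_right bilinear_add_left bilinear_add_right algebra_simps)
  qed
  then show ?thesis
    by (intro hochschild_cocycle.intro k_algebra_D1A hochschild_cocycle_axioms.intro linear_form_bilinear)
      (auto simp: D1A_simps)
qed

lemma bilinear_table:
  assumes "\<And>b. b \<in> carrier A \<Longrightarrow> linear_form A (\<lambda>a. f a b)" "\<And>a. a \<in> carrier A \<Longrightarrow> linear_form A (f a)"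
    and a: "a \<in> carrier A" and b: "b \<in> carrier A"
  shows "bilinear (table f) a b = f a b"
proof -
  have "f a b = (\<Sum>s\<in>normal_words. coord s a * f (cls (word s)) b)"
    by (rule linear_form_expansion[OF assms(1)[OF b] a])
  also have "\<dots> = (\<Sum>s\<in>normal_words. coord s a * (\<Sum>t\<in>normal_words. coord t b * f (cls (word s)) (cls (word t))))"
    by (rule sum.cong) (simp_all add: linear_form_expansion[OF assms(2) b])
  also have "\<dots> = bilinear (table f) a b"
    by (simp add: bilinear_def table_def sum_distrib_left mult.assoc)
  finally show ?thesis by simp
qed

lemma table_cocycle:
  assumes f: "hochschild_cocycle A f"
  shows "table f \<in> cocycle_tables"
proof -
  interpret f: hochschild_cocycle A f by (rule f)
  have w: "on_words (table f) u v = f (cls (word u)) (cls (word v))" for u v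
    unfolding bilinear_word[symmetric]
    by (rule bilinear_table) (simp_all add: f.linear_left f.linear_right)
  have "on_words (table f) (u @ v) w - on_words (table f) u (v @ w) + on_words (table f) (w @ u) v = 0" for u v w
    using f.cocycle[of "cls (word u)" "cls (word v)" "cls (word w)"]
    by (simp add: w D1A_simps word_mult)
  then show ?thesis by (auto simp: cocycle_tables_def table_def)
qed

lemma table_coboundary:
  assumes f: "hochschild_coboundary A f"
  shows "table f \<in> coboundary_tables"
proof -
  obtain g where g: "linear_form A g"
    "\<And>a b. a \<in> carrier A \<Longrightarrow> b \<in> carrier A \<Longrightarrow> f a b = g (a \<otimes>\<^bsub>A\<^esub> b) - g (b \<otimes>\<^bsub>A\<^esub> a)"
    using f unfolding hochschild_coboundary_def by blast
  have "g (cls 0 \<oplus>\<^bsub>A\<^esub> cls 0) = g (cls 0) + g (cls 0)" using g(1) unfolding linear_form_def by simp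
  then have "g (cls 0) + g (cls 0) = g (cls 0) + 0" by (simp only: D1A_simps add_0_right)
  then have "g (cls 0) = 0" by (simp only: add_left_cancel)
  then have "g (cls (word w)) = (case nf w of None \<Rightarrow> 0 | Some t \<Rightarrow> g (cls (word t)))" for w
    using cls_word[of w] by (cases "nf w") simp_all
  then have "f (cls (word u)) (cls (word v)) =
      (case nf (u @ v) of None \<Rightarrow> 0 | Some t \<Rightarrow> g (cls (word t))) - (case nf (v @ u) of None \<Rightarrow> 0 | Some t \<Rightarrow> g (cls (word t)))" for u v
    using g(2)[of "cls (word u)" "cls (word v)"] by (simp add: D1A_simps word_mult)
  then show ?thesis
    unfolding coboundary_tables_def table_def by (auto intro!: exI[of _ "\<lambda>t. g (cls (word t))"])
qed

lemma bilinear_coboundary: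
  assumes F: "F \<in> coboundary_tables"
  shows "hochschild_coboundary A (bilinear F)"
proof -
  interpret A: k_algebra A by (rule k_algebra_D1A)
  obtain G where G: "\<And>u v. u \<in> normal_words \<Longrightarrow> v \<in> normal_words \<Longrightarrow> F (u, v) =
        (case nf (u @ v) of None \<Rightarrow> 0 | Some t \<Rightarrow> G t) - (case nf (v @ u) of None \<Rightarrow> 0 | Some t \<Rightarrow> G t)"
    using F unfolding coboundary_tables_def by blast
  define g where "g a = (\<Sum>t\<in>normal_words. coord t a * G t)" for a
  have g: "linear_form A g"
    by (auto simp: linear_form_def D1A_simps g_def coord_cls coeff_add coeff_scalar_mult distrib_right sum.distrib
        sum_distrib_left mult.assoc)
  have gw: "g (cls (word w)) = (case nf w of None \<Rightarrow> 0 | Some t \<Rightarrow> G t)" for w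
  proof (cases "nf w")
    case (Some a)
    have "g (cls (word w)) = (\<Sum>s\<in>normal_words. if s = a then G a else 0)"
      unfolding g_def by (rule sum.cong) (auto simp: word_def coord_cls coeff_single Some)
    then show ?thesis using finite_normal_words normal_wordsI[OF Some] Some by simp
  qed (simp add: g_def word_def coord_cls coeff_single)
  define f where "f a b = g (a \<otimes>\<^bsub>A\<^esub> b) - g (b \<otimes>\<^bsub>A\<^esub> a)" for a b
  have lin: "g ((a \<oplus>\<^bsub>A\<^esub> a') \<otimes>\<^bsub>A\<^esub> b) = g (a \<otimes>\<^bsub>A\<^esub> b) + g (a' \<otimes>\<^bsub>A\<^esub> b)" "g (b \<otimes>\<^bsub>A\<^esub> (a \<oplus>\<^bsub>A\<^esub> a')) = g (b \<otimes>\<^bsub>A\<^esub> a) + g (b \<otimes>\<^bsub>A\<^esub> a')"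
    "g ((c \<odot>\<^bsub>A\<^esub> a) \<otimes>\<^bsub>A\<^esub> b) = c * g (a \<otimes>\<^bsub>A\<^esub> b)" "g (b \<otimes>\<^bsub>A\<^esub> (c \<odot>\<^bsub>A\<^esub> a)) = c * g (b \<otimes>\<^bsub>A\<^esub> a)"
    if "a \<in> carrier A" "a' \<in> carrier A" "b \<in> carrier A" for a a' b c
    using g that by (simp_all add: linear_form_def A.l_distr A.r_distr A.smult_mult_left A.smult_mult_right)
  have l: "linear_form A (\<lambda>a. f a b)" "linear_form A (f b)" if "b \<in> carrier A" for b
    using that by (auto simp: linear_form_def f_def lin algebra_simps)
  have "F (u, v) = table f (u, v)" for u v
    using G[of u v] F by (auto simp: table_def f_def D1A_simps word_mult gw coboundary_tables_def)
  then have "F = table f" by auto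
  then have "bilinear F a b = f a b" if "a \<in> carrier A" "b \<in> carrier A" for a b
    using bilinear_table[OF l that] by simp
  then show ?thesis using g unfolding hochschild_coboundary_def f_def by blast
qed

lemma on_words_add: "on_words (F + G) u v = on_words F u v + on_words G u v"
  by (simp add: on_words_def split: option.split)

lemma on_words_scale: "on_words (\<lambda>x. c * F x) u v = c * on_words F u v"
  by (simp add: on_words_def split: option.split)

lemma bilinear_table_add: "bilinear (F + G) a b = bilinear F a b + bilinear G a b"
  by (simp add: bilinear_def distrib_left sum.distrib)

lemma bilinear_table_scale: "bilinear (\<lambda>x. c * F x) a b = c * bilinear F a b"
  by (simp add: bilinear_def sum_distrib_left algebra_simps)

lemma subspace_cocycle_tables: "fun_space.subspace cocycle_tables"
proof (rule fun_space.subspaceI)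
  show "0 \<in> cocycle_tables" by (simp add: cocycle_tables_def on_words_def split: option.split)
next
  fix F G :: "letter list \<times> letter list \<Rightarrow> 'k" assume F: "F \<in> cocycle_tables" and G: "G \<in> cocycle_tables"
  have "on_words (F + G) (u @ v) w - on_words (F + G) u (v @ w) + on_words (F + G) (w @ u) v =
      (on_words F (u @ v) w - on_words F u (v @ w) + on_words F (w @ u) v) +
      (on_words G (u @ v) w - on_words G u (v @ w) + on_words G (w @ u) v)" for u v w
    by (simp add: on_words_add)
  then show "F + G \<in> cocycle_tables" using F G by (simp add: cocycle_tables_def)
next
  fix c and F :: "letter list \<times> letter list \<Rightarrow> 'k" assume F: "F \<in> cocycle_tables"
  have "on_words (\<lambda>x. c * F x) (u @ v) w - on_words (\<lambda>x. c * F x) u (v @ w) + on_words (\<lambda>x. c * F x) (w @ u) v =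
      c * (on_words F (u @ v) w - on_words F u (v @ w) + on_words F (w @ u) v)" for u v w
    by (simp add: on_words_scale algebra_simps)
  then show "(\<lambda>x. c * F x) \<in> cocycle_tables" using F by (simp add: cocycle_tables_def)
qed

lemma subspace_coboundary_tables: "fun_space.subspace coboundary_tables"
proof (rule fun_space.subspaceI)
  show "0 \<in> coboundary_tables"
    by (auto simp: coboundary_tables_def split: option.split intro!: exI[of _ "\<lambda>_. 0"])
next
  fix F F' :: "letter list \<times> letter list \<Rightarrow> 'k" assume F: "F \<in> coboundary_tables" and F': "F' \<in> coboundary_tables"
  obtain G G' where "\<forall>u\<in>normal_words. \<forall>v\<in>normal_words. F (u, v) =
        (case nf (u @ v) of None \<Rightarrow> 0 | Some t \<Rightarrow> G t) - (case nf (v @ u) of None \<Rightarrow> 0 | Some t \<Rightarrow> G t)"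
     "\<forall>u\<in>normal_words. \<forall>v\<in>normal_words. F' (u, v) =
        (case nf (u @ v) of None \<Rightarrow> 0 | Some t \<Rightarrow> G' t) - (case nf (v @ u) of None \<Rightarrow> 0 | Some t \<Rightarrow> G' t)"
    using F F' unfolding coboundary_tables_def by blast
  then have "\<forall>u\<in>normal_words. \<forall>v\<in>normal_words. (F + F') (u, v) =
        (case nf (u @ v) of None \<Rightarrow> 0 | Some t \<Rightarrow> G t + G' t) - (case nf (v @ u) of None \<Rightarrow> 0 | Some t \<Rightarrow> G t + G' t)"
    by (simp split: option.split)
  then show "F + F' \<in> coboundary_tables"
    using F F' unfolding coboundary_tables_def by (auto intro!: exI[of _ "\<lambda>t. G t + G' t"])
next
  fix c and F :: "letter list \<times> letter list \<Rightarrow> 'k" assume F: "F \<in> coboundary_tables"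
  obtain G where "\<forall>u\<in>normal_words. \<forall>v\<in>normal_words. F (u, v) =
        (case nf (u @ v) of None \<Rightarrow> 0 | Some t \<Rightarrow> G t) - (case nf (v @ u) of None \<Rightarrow> 0 | Some t \<Rightarrow> G t)"
    using F unfolding coboundary_tables_def by blast
  then have "\<forall>u\<in>normal_words. \<forall>v\<in>normal_words. c * F (u, v) =
        (case nf (u @ v) of None \<Rightarrow> 0 | Some t \<Rightarrow> c * G t) - (case nf (v @ u) of None \<Rightarrow> 0 | Some t \<Rightarrow> c * G t)"
    by (simp add: right_diff_distrib split: option.split)
  then show "(\<lambda>x. c * F x) \<in> coboundary_tables"
    using F unfolding coboundary_tables_def by (auto intro!: exI[of _ "\<lambda>t. c * G t"])
qed

lemma coboundary_tables_subset: "coboundary_tables \<subseteq> cocycle_tables"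
proof
  fix F assume F: "F \<in> coboundary_tables"
  obtain g where g: "\<And>a b. a \<in> carrier A \<Longrightarrow> b \<in> carrier A \<Longrightarrow> bilinear F a b = g (a \<otimes>\<^bsub>A\<^esub> b) - g (b \<otimes>\<^bsub>A\<^esub> a)"
    using bilinear_coboundary[OF F] unfolding hochschild_coboundary_def by blast
  have "on_words F u v = g (cls (word (u @ v))) - g (cls (word (v @ u)))" for u v
    using g[of "cls (word u)" "cls (word v)"] by (simp add: bilinear_word D1A_simps word_mult)
  then show "F \<in> cocycle_tables" using F by (simp add: cocycle_tables_def coboundary_tables_def)
qed

text \<open>
  The instances \<open>(1, x, x)\<close> and \<open>(c, c, c)\<close> of the cocycle identity, with \<open>c\<^sup>2 = (xy)\<^sup>k\<close>, settle
  \<open>F(t, (xy)\<^sup>k)\<close> for words \<open>t\<close> of length at most one; here \<open>y\<^sup>2 = (xy)\<^sup>k\<close> and characteristic 2 are essential.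
  For longer words \<open>t = uv\<close> the instance \<open>((xy)\<^sup>k, u, v)\<close> suffices, as \<open>(xy)\<^sup>k\<close> annihilates \<open>u\<close> and \<open>v\<close>.
  The identity for \<open>(1, (xy)\<^sup>k, t)\<close> exchanges the two arguments.
\<close>

lemma on_words_top_vanishes:
  assumes two: "(2::'k) = 0" and e: e and F: "F \<in> cocycle_tables" and t: "t \<in> normal_words"
  shows "F (top, t) = 0" "F (t, top) = 0"
proof -
  have c: "on_words F (u @ v) w - on_words F u (v @ w) + on_words F (w @ u) v = 0" for u v w
    using F by (simp add: cocycle_tables_def)
  have double: "(a::'k) + a = 0" for a using two by (metis mult_2 mult_zero_left)
  have nft: "nf t = Some t" using t by (simp add: normal_words_def)
  have sq: "nf [c, c] = Some top" for c unfolding nf_def using e by (cases c) simp_all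
  have left_zero: "on_words F u v = 0" if "nf u = None" for u v using that by (simp add: on_words_def)
  have right_zero: "on_words F u v = 0" if "nf v = None" for u v using that by (simp add: on_words_def split: option.split)
  have FT: "F (top, t) = on_words F top t" "F (t, top) = on_words F t top"
    by (simp_all add: on_words_def nft)
  have anti: "F (top, t) + F (t, top) = 0" if "t \<noteq> []"
    using c[of "[]" top t] right_zero[of "top @ t" "[]"] long_word[of "top @ t"] that
    by (simp add: FT right_zero)
  consider (Nil) "t = []" | (letter) a where "t = [a]" | (long) a b t' where "t = a # b # t'"
    by (metis list.exhaust)
  then show "F (top, t) = 0" "F (t, top) = 0"
  proof (atomize (full), cases)
    case Nil
    have "on_words F top [] = 0" using c[of top "[]" "[]"] by simp
    moreover have "on_words F [] top = 0"
    proof -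
      have "on_words F [] top = on_words F [] [letter_x, letter_x]" by (simp add: on_words_def sq)
      also have "\<dots> = 0"
        using c[of "[]" "[letter_x]" "[letter_x]"] double[of "on_words F [letter_x] [letter_x]"]
        by (simp add: algebra_simps)
      finally show ?thesis .
    qed
    ultimately show "F (top, t) = 0 \<and> F (t, top) = 0" using FT Nil by simp
  next
    case (letter a)
    have "on_words F [a] [a, a] = 0"
      using c[of "[a]" "[a]" "[a]"] double[of "on_words F [a, a] [a]"] by (simp add: algebra_simps)
    then have "on_words F [a] top = 0" by (simp add: on_words_def sq)
    then have "F (t, top) = 0" using FT(2) letter by simp
    then show "F (top, t) = 0 \<and> F (t, top) = 0" using anti letter by simp
  next
    case (long a b t')
    have "on_words F top t = 0"
      using c[of top "[a]" "b # t'"] left_zero[OF long_word[of "top @ [a]"]] left_zero[OF long_word[of "(b # t') @ top"]] long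
      by simp
    then have "F (top, t) = 0" using FT(1) by simp
    then show "F (top, t) = 0 \<and> F (t, top) = 0" using anti long by simp
  qed
qed

end

lemma (in normal_forms) normal_words_eq:
  "normal_words = insert (alternating letter_x (2 * k)) {w. successively (\<noteq>) w \<and> length w < 2 * k}"
proof
  show "normal_words \<subseteq> insert (alternating letter_x (2 * k)) {w. successively (\<noteq>) w \<and> length w < 2 * k}"
  proof
    fix w assume "w \<in> normal_words"
    then have "nf w = Some w" by (simp add: normal_words_def)
    then show "w \<in> insert (alternating letter_x (2 * k)) {w. successively (\<noteq>) w \<and> length w < 2 * k}"
      by (auto simp: nf_def top_def split: if_splits)
  qed
  show "insert (alternating letter_x (2 * k)) {w. successively (\<noteq>) w \<and> length w < 2 * k} \<subseteq> normal_words"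
    using nf_top(1) by (auto simp: normal_words_def nf_def top_def)
qed

context
  fixes k :: nat and ground :: "'k::field itself"
  assumes k: "2 \<le> k" and two: "(2::'k) = 0"
begin

interpretation w0: D1A_words k False ground by unfold_locales (rule k)
interpretation w1: D1A_words k True ground by unfold_locales (rule k)
interpretation c0: char2_normal_forms k False ground by unfold_locales (rule two)

lemma normal_words_agree: "w1.normal_words = w0.normal_words"
  unfolding w0.normal_words_eq w1.normal_words_eq ..

lemma nf_agree: "w1.nf w = w0.nf w \<or> w = [letter_y, letter_y] \<and> w0.nf w = None \<and> w1.nf w = Some w0.top"
proof (cases "w = [letter_y, letter_y]")
  case True then show ?thesis by (simp add: w0.nf_def w1.nf_def)
next
  case False then show ?thesis by (simp add: w0.nf_def w1.nf_def)
qed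

text \<open>
  The products differ only for \<open>yy\<close>, and this word never contributes to a commutator of basis words.
\<close>

lemma coboundary_tables_agree: "w1.coboundary_tables = (w0.coboundary_tables :: (_ \<Rightarrow> 'k) set)"
proof -
  have "(case w1.nf (u @ v) of None \<Rightarrow> 0 | Some t \<Rightarrow> G t) - (case w1.nf (v @ u) of None \<Rightarrow> 0 | Some t \<Rightarrow> G t) =
      (case w0.nf (u @ v) of None \<Rightarrow> 0 | Some t \<Rightarrow> G t) - (case w0.nf (v @ u) of None \<Rightarrow> 0 | Some t \<Rightarrow> (G t :: 'k))"
    if uv: "u \<in> w0.normal_words" "v \<in> w0.normal_words" for u v G
  proof -
    have "u @ v = [letter_y, letter_y] \<longleftrightarrow> v @ u = [letter_y, letter_y]"
    proof -
      have "\<not> [letter_y, letter_y] \<in> w0.normal_words" by (simp add: w0.normal_words_def w0.nf_def)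
      then show ?thesis using uv by (auto simp: append_eq_Cons_conv)
    qed
    then show ?thesis using nf_agree[of "u @ v"] nf_agree[of "v @ u"] by auto
  qed
  then show ?thesis
    unfolding w0.coboundary_tables_def w1.coboundary_tables_def normal_words_agree by auto
qed

lemma cocycle_tables_subset: "w1.cocycle_tables \<subseteq> (w0.cocycle_tables :: (_ \<Rightarrow> 'k) set)"
proof
  fix F :: "letter list \<times> letter list \<Rightarrow> 'k" assume F: "F \<in> w1.cocycle_tables"
  note z = w1.on_words_top_vanishes[OF two TrueI F]
  have "w1.on_words F u v = w0.on_words F u v" for u v
    using nf_agree[of u] nf_agree[of v] z w1.normal_wordsI
    by (auto simp: w0.on_words_def w1.on_words_def split: option.splits)
  then show "F \<in> w0.cocycle_tables"
    using F unfolding w0.cocycle_tables_def w1.cocycle_tables_def normal_words_agree by simp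
qed

text \<open>
  The separating value is at \<open>((xy)\<^sup>k, y)\<close>, where \<open>cyc\<close> is \<open>1\<close>.
\<close>

lemma cocycle_tables_strict: "w1.cocycle_tables \<noteq> (w0.cocycle_tables :: (_ \<Rightarrow> 'k) set)"
proof
  assume eq: "w1.cocycle_tables = (w0.cocycle_tables :: (_ \<Rightarrow> 'k) set)"
  define F where "F = (\<lambda>(u, v). if u \<in> w0.normal_words \<and> v \<in> w0.normal_words then c0.cyc u v else (0 :: 'k))"
  have "w0.on_words F u v = c0.cyc u v" for u v
  proof (cases "w0.nf u")
    case None then show ?thesis by (simp add: w0.on_words_def c0.cyc_left_zero)
  next
    case (Some s)
    have "c0.cyc u v = c0.cyc s v" by (rule c0.cyc_left) (use Some w0.nf_idem[OF Some] in simp)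
    then show ?thesis using Some w0.normal_wordsI[OF Some] w0.normal_wordsI[of v]
      by (simp add: w0.on_words_def F_def c0.cyc_nf[of s v] split: option.split)
  qed
  then have "F \<in> w0.cocycle_tables"
    using c0.cyc_append by (auto simp: w0.cocycle_tables_def F_def algebra_simps)
  then have "F \<in> w1.cocycle_tables" using eq by simp
  from w1.on_words_top_vanishes(1)[OF two TrueI this, of "[letter_y]"]
  have "F (w0.top, [letter_y]) = 0" using w1.normal_wordsI[OF w1.nf_letter] by simp
  moreover have "F (w0.top, [letter_y]) = 1"
    using w0.normal_wordsI[OF w0.nf_letter] w0.normal_wordsI[OF w0.nf_top(1)]
    by (simp add: F_def c0.local_term_def)
  ultimately show False by simp
qed

text \<open>
  Transfer along \<open>N\<close> carries the cocycles for \<open>d = 0\<close> to those for \<open>d = 1\<close>, and transfer along \<open>M\<close> back. Since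
  the latter are among the former, both transfers are endomorphisms of one space of tables.
\<close>

lemma D1A_not_stably_equivalent:
  "\<not> stably_equivalent_Morita TYPE('u) (D1A k (0::'k)) (D1A k (1::'k))"
proof
  have A: "D1A k (0::'k) = w0.A" "D1A k (1::'k) = w1.A" by (simp_all add: w0.A_def w1.A_def)
  assume "stably_equivalent_Morita TYPE('u) (D1A k (0::'k)) (D1A k (1::'k))"
  then have st: "stably_equivalent_Morita TYPE('u) w0.A w1.A" unfolding A .
  obtain M :: "('k free_alg set, 'k free_alg set, 'u) bimodule" and N :: "('k free_alg set, 'k free_alg set, 'u) bimodule"
    and I :: "'u set" and m \<phi> and J :: "'u set" and n \<psi>
  where M: "right_dual_basis w0.A w1.A M I m \<phi>" and N: "right_dual_basis w1.A w0.A N J n \<psi>"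
    and MN: "\<And>f. hochschild_cocycle w0.A f \<Longrightarrow> hochschild_coboundary w0.A
      (\<lambda>a b. trace_transfer M I m \<phi> (trace_transfer N J n \<psi> f) a b - f a b)"
    by (rule stable_equivalence_transfer[OF st w0.algebra_basis_D1A], rule that)
  interpret M: right_dual_basis w0.A w1.A M I m \<phi> by (rule M)
  interpret N: right_dual_basis w1.A w0.A N J n \<psi> by (rule N)
  define \<Phi> where "\<Phi> F = w1.table (trace_transfer N J n \<psi> (w0.bilinear F))" for F :: "letter list \<times> letter list \<Rightarrow> 'k"
  define \<Psi> where "\<Psi> F = w0.table (trace_transfer M I m \<phi> (w1.bilinear F))" for F :: "letter list \<times> letter list \<Rightarrow> 'k"
  have lin: "Vector_Spaces.linear (\<lambda>c F x. c * F x) (\<lambda>c F x. c * F x) \<Phi>"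
    "Vector_Spaces.linear (\<lambda>c F x. c * F x) (\<lambda>c F x. c * F x) \<Psi>"
    unfolding Vector_Spaces.linear_iff
    by (auto simp: vector_space_functions fun_eq_iff \<Phi>_def \<Psi>_def w0.table_def w1.table_def mixed_trace_def
        trace_pairing_def w0.bilinear_table_add w1.bilinear_table_add w0.bilinear_table_scale w1.bilinear_table_scale
        sum.distrib sum_distrib_left)
  have \<Phi>Z: "\<Phi> F \<in> w1.cocycle_tables" if "F \<in> w0.cocycle_tables" for F
    unfolding \<Phi>_def by (intro w1.table_cocycle trace_transfer_cocycle[OF _ N] w0.bilinear_cocycle that)
  have \<Psi>C: "\<Psi> F \<in> w0.coboundary_tables" if "F \<in> w0.coboundary_tables" for F
    unfolding \<Psi>_def
    by (intro w0.table_coboundary trace_transfer_coboundary[OF _ M] w1.bilinear_coboundary)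
      (use that coboundary_tables_agree in simp)
  have retract: "\<Psi> (\<Phi> F) - F \<in> w0.coboundary_tables" if F: "F \<in> w0.cocycle_tables" for F
  proof -
    let ?f = "w0.bilinear F" and ?tf = "trace_transfer N J n \<psi> (w0.bilinear F)"
    have f: "hochschild_cocycle w0.A ?f" by (rule w0.bilinear_cocycle[OF F])
    interpret tf: hochschild_cocycle w1.A ?tf by (rule trace_transfer_cocycle[OF f N])
    have bt: "w1.bilinear (\<Phi> F) a b = ?tf a b" if "a \<in> carrier w1.A" "b \<in> carrier w1.A" for a b
      unfolding \<Phi>_def by (rule w1.bilinear_table[OF tf.linear_left tf.linear_right that])
    have tr: "trace_transfer M I m \<phi> (w1.bilinear (\<Phi> F)) a b = trace_transfer M I m \<phi> ?tf a b"
      if "a \<in> carrier w0.A" "b \<in> carrier w0.A" for a b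
      unfolding mixed_trace_def[of M] trace_pairing_def
      by (intro sum.cong refl bt M.coord_closed M.lact_closed M.basis_closed that)
    have "F (u, v) = (if u \<in> w0.normal_words \<and> v \<in> w0.normal_words then ?f (w0.cls (word u)) (w0.cls (word v)) else 0)" for u v
      using F by (auto simp: w0.bilinear_word w0.on_words_def w0.normal_words_def w0.cocycle_tables_def)
    then have "\<Psi> (\<Phi> F) - F = w0.table (\<lambda>a b. trace_transfer M I m \<phi> ?tf a b - ?f a b)"
      by (auto simp: fun_eq_iff \<Psi>_def w0.table_def tr)
    then show ?thesis using w0.table_coboundary[OF MN[OF f]] by simp
  qed
  let ?S = "(\<lambda>y x. of_bool (x = y)) ` (w0.normal_words \<times> w0.normal_words) :: (letter list \<times> letter list \<Rightarrow> 'k) set"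
  have "w1.cocycle_tables = (w0.cocycle_tables :: (_ \<Rightarrow> 'k) set)"
  proof (rule fun_space.subspace_eq_of_injection_modulo[OF lin w0.subspace_coboundary_tables
        w1.subspace_cocycle_tables w0.subspace_cocycle_tables])
    show "w0.coboundary_tables \<subseteq> w1.cocycle_tables"
      using w1.coboundary_tables_subset unfolding coboundary_tables_agree .
    show "w1.cocycle_tables \<subseteq> w0.cocycle_tables" by (rule cocycle_tables_subset)
    show "finite ?S" by (intro finite_imageI finite_cartesian_product w0.finite_normal_words)
    show "w0.cocycle_tables \<subseteq> fun_space.span ?S"
    proof
      fix F :: "letter list \<times> letter list \<Rightarrow> 'k" assume "F \<in> w0.cocycle_tables"
      then show "F \<in> fun_space.span ?S"
        by (intro finitely_supported_in_span finite_cartesian_product w0.finite_normal_words)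
          (auto simp: w0.cocycle_tables_def)
    qed
  qed (use \<Phi>Z \<Psi>C retract in auto)
  then show False using cocycle_tables_strict by simp
qed

end

theorem corollary3p3:
  fixes k :: nat
  assumes "CHAR('k::alg_closed_field) = 2"
    and "k \<ge> 2"
  shows "\<not> stably_equivalent_Morita TYPE('u) (D1A k (0::'k)) (D1A k (1::'k))"
proof -
  have "(2::'k) = of_nat CHAR('k)" using assms(1) by simp
  then have "(2::'k) = 0" by (simp only: of_nat_CHAR)
  with assms(2) show ?thesis by (rule D1A_not_stably_equivalent)
qed

end
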